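(* Let $d\ge 2$, let $h\in L^2(S^d)$ and set $b_m=\frac1{\delta_m}(\Pi_m h)(o)$ for $m\in\mathbb N$. Assume that $b_0\neq 0$ and that there are constants $c\ge 0$ and $\gamma\ge 0$ such that $$|b_m|\le c\,(1+\lambda_m^2)^{-\gamma/2}\qquad\text{for all } m\in\mathbb N .$$ Let $F f=h*f$. Fix $f^\dagger\in H^\omega(S^d)$ with $\omega\ge 0$, let $\zeta\ge 0$, put $\sigma=\omega+\gamma$ and assume $\sigma>d/2+\zeta$. Let $m\in\mathbb N$, $0<\varepsilon<1$, $C_1>0$, $L_m=\lceil C_1(\lambda_m^2)^{d/2}\rceil$, and let $\{x_j\}_{j=1}^{L_m}$ be a family of distinct points of $S^d$ such that $$(1-\varepsilon)\|p\|_2^2\le\frac1{L_m}\sum_{j=1}^{L_m}|p(x_j)|^2\le(1+\varepsilon)\|p\|_2^2\qquad\text{for all }p\in\mathcal Q_m .$$ Let $\beta\ge 0$ and let $\{y_j\}_{j=1}^{L_m}$ be numbers with $|y_j-Ff^\dagger(x_j)|\le\beta$ for $j=1,\dots,L_m$. Choose $$p_m^\beta\in\operatorname*{argmin}_{p\in\mathcal Q_m}\frac1{L_m}\sum_{j=1}^{L_m}|y_j-Fp(x_j)|^2 .$$ Then, with $\kappa=\frac{1+\varepsilon}{1-\varepsilon}$, $$\|Ff^\dagger-Fp_m^\beta\|_{H^\zeta(S^d)}\le\sqrt{\frac{1+\kappa}{\sigma-\zeta-\frac d2}}\;\|Ff^\dagger\|_{H^\sigma(S^d)}\,(1+\lambda_m^2)^{-\frac{\sigma-\zeta}2+\frac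 d4}+\sqrt\kappa\,\beta\,(1+\lambda_m^2)^{\frac\zeta2}.$$ If furthermore $\zeta\ge\gamma$ and there is a constant $c_0>0$ such that $|b_k|\ge c_0(1+\lambda_k^2)^{-\zeta/2}$ for all $k\ge 0$, then $$\|f^\dagger-p_m^\beta\|_2\le c_0^{-1}\,\|Ff^\dagger-Fp_m^\beta\|_{H^\zeta(S^d)} .$$
   Context: $\mathbb N=\{0,1,2,\dots\}$. $S^d$ is the unit sphere of $\mathbb R^{d+1}$ with Riemannian measure $\mu$ normalized by $\mu(S^d)=1$; $\|\cdot\|_2$ is the norm of $L^2(S^d)=L^2(S^d,\mu)$; $o$ is the north pole. $SO(d+1)$ acts on $S^d$ and $dg$ is its Haar measure of total mass $1$. For $h\in L^1(S^d)$ and $f\in L^2(S^d)$ the convolution is $(h*f)(x)=\int_{SO(d+1)}h(g^{-1}x)f(go)\,dg$. $\Delta$ is the Laplace-Beltrami operator regarded as a positive self-adjoint operator on $L^2(S^d)$; its distinct eigenvalues are $\lambda_m^2=m(m+d-1)$, $m\in\mathbb N$, with $\lambda_m\ge0$. $\mathcal H_m$ is the eigenspace of $\lambda_m^2$ (spherical harmonics of degree $m$), $\delta_m=\dim\mathcal H_m$, $\Pi_m$ is the orthogonal projection of $L^2(S^d)$ onto $\mathcal H_m$, and $\mathcal Q_m=\bigoplus_{\ell=0}^m\mathcal H_\ell$. For $h\in L^2(S^d)$ one has $h*f=\sum_{m\ge0}b_m\Pi_mf$ with $b_m$ as in the claim. For $s\ge0$, $H^s(S^d)=\{f\in L^2(S^d):\|f\|_{H^s(S^d)}^2:=\sum_{m\ge0}(1+\lambda_m^2)^s\|\Pi_mf\|_2^2<\infty\}$.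 Since $Ff^\dagger\in H^\sigma(S^d)$ with $\sigma>d/2$, $Ff^\dagger$ is (identified with) a continuous function, so its point values are meaningful. *)

theory Defs
  imports "HOL-Probability.Probability" "HOL-Library.Function_Algebras"
begin

text \<open>
  \<open>\<real>\<^bsup>d+1\<^esup>\<close> is \<^typ>\<open>real ^ ('d option)\<close> with \<open>d = CARD('d)\<close>; the extra coordinate
  \<^term>\<open>None\<close> is the polar one. A function on \<open>S\<^sup>d\<close> is a complex-valued function on the ambient
  space, of which only the values on \<^term>\<open>sphere 0 1\<close> matter.
\<close>

definition north_pole :: "real ^ ('d::finite option)"
  where "north_pole = axis None 1"


subsection \<open>The normalized measure and \<open>L\<^sup>2\<close>\<close>

text \<open>
  In polar coordinates the Riemannian measure of \<open>A\<close> is the dimension of the ambient space times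
  the Lebesgue measure of the cone \<open>{r x | 0 < r < 1, x \<in> A}\<close>. Normalized, it is the image of
  the uniform distribution on the unit ball under the radial projection \<open>x \<mapsto> x / |x|\<close>,
  which is \<^const>\<open>sgn\<close>.
\<close>

definition sphere_measure :: "'a::euclidean_space measure"
  where "sphere_measure =
    restrict_space (distr (uniform_measure lborel (ball 0 1)) borel sgn) (sphere 0 1)"

definition sphere_L2 :: "('a::euclidean_space \<Rightarrow> complex) set"
  where "sphere_L2 = {f. f \<in> borel_measurable sphere_measure \<and>
    integrable sphere_measure (\<lambda>x. (cmod (f x))\<^sup>2)}"

definition L2_inner :: "('a::euclidean_space \<Rightarrow> complex) \<Rightarrow> ('a \<Rightarrow> complex) \<Rightarrow> complex"
  where "L2_inner f g = (\<integral>x. f x * cnj (g x) \<partial>sphere_measure)"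

definition L2_norm :: "('a::euclidean_space \<Rightarrow> complex) \<Rightarrow> real"
  where "L2_norm f = sqrt (\<integral>x. (cmod (f x))\<^sup>2 \<partial>sphere_measure)"


subsection \<open>The Laplace--Beltrami operator\<close>

primrec Ck_on ::
  "nat \<Rightarrow> ('a::euclidean_space \<Rightarrow> 'b::real_normed_vector) \<Rightarrow> 'a set \<Rightarrow> bool"
  where
    "Ck_on 0 f S \<longleftrightarrow> continuous_on S f"
  | "Ck_on (Suc k) f S \<longleftrightarrow> f differentiable_on S \<and>
      (\<forall>b\<in>Basis. Ck_on k (\<lambda>x. frechet_derivative f (at x) b) S)"

definition laplacian ::
  "('a::euclidean_space \<Rightarrow> 'b::real_normed_vector) \<Rightarrow> 'a \<Rightarrow> 'b"
  where "laplacian f x =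
    (\<Sum>b\<in>Basis. frechet_derivative (\<lambda>y. frechet_derivative f (at y) b) (at x) b)"

text \<open>
  Smoothness on the sphere and the Laplace--Beltrami operator are expressed through the
  extension \<open>y \<mapsto> f (y / |y|)\<close>, homogeneous of degree \<open>0\<close>: the Euclidean Laplacian of this extension
  agrees on the sphere with the Laplace--Beltrami operator. The sign makes it positive.
\<close>

definition smooth_on_sphere :: "('a::euclidean_space \<Rightarrow> complex) \<Rightarrow> bool"
  where "smooth_on_sphere f \<longleftrightarrow> (\<forall>k. Ck_on k (\<lambda>y. f (sgn y)) (- {0}))"

definition laplace_beltrami :: "('a::euclidean_space \<Rightarrow> complex) \<Rightarrow> 'a \<Rightarrow> complex"
  where "laplace_beltrami f x = - laplacian (\<lambda>y. f (sgn y)) x"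

text \<open>
  Graph of the self-adjoint operator on \<open>L\<^sup>2\<close>: the operator on smooth functions is essentially
  self-adjoint, so its self-adjoint realization is its adjoint.
\<close>

definition laplace_beltrami_L2 ::
  "('a::euclidean_space \<Rightarrow> complex) \<Rightarrow> ('a \<Rightarrow> complex) \<Rightarrow> bool"
  where "laplace_beltrami_L2 f u \<longleftrightarrow> f \<in> sphere_L2 \<and> u \<in> sphere_L2 \<and>
    (\<forall>\<phi>. smooth_on_sphere \<phi> \<longrightarrow> L2_inner f (laplace_beltrami \<phi>) = L2_inner u \<phi>)"


subsection \<open>Spherical harmonics\<close>

definition lb_eigenvalue :: "nat \<Rightarrow> nat \<Rightarrow> real"
  where "lb_eigenvalue d m = real m * (real m + real d - 1)"

text \<open>
  Each element of the eigenspace is represented by its continuous representative, extended by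
  \<open>0\<close> off the sphere; thus equality in the eigenspace is equality of functions, and
  the dimension of the eigenspace is the dimension of this set of functions.
\<close>

definition harmonics :: "nat \<Rightarrow> (real ^ ('d::finite option) \<Rightarrow> complex) set"
  where "harmonics m = {f. continuous_on (sphere 0 1) f \<and> (\<forall>x. x \<notin> sphere 0 1 \<longrightarrow> f x = 0) \<and>
    laplace_beltrami_L2 f (\<lambda>x. of_real (lb_eigenvalue CARD('d) m) * f x)}"

interpretation cfun: vector_space "\<lambda>(c::complex) (f::'a \<Rightarrow> complex) x. c * f x"
  by unfold_locales (auto simp: fun_eq_iff algebra_simps)

definition harmonic_proj ::
  "nat \<Rightarrow> (real ^ ('d::finite option) \<Rightarrow> complex) \<Rightarrow> real ^ ('d option) \<Rightarrow> complex"
  where "harmonic_proj m f =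
    (THE p. p \<in> harmonics m \<and> (\<forall>q\<in>harmonics m. L2_inner (\<lambda>x. f x - p x) q = 0))"

definition harmonics_upto :: "nat \<Rightarrow> (real ^ ('d::finite option) \<Rightarrow> complex) set"
  where "harmonics_upto m = {\<lambda>x. \<Sum>l\<le>m. q l x | q. \<forall>l\<le>m. q l \<in> harmonics l}"


subsection \<open>Sobolev spaces\<close>

definition sobolev :: "real \<Rightarrow> (real ^ ('d::finite option) \<Rightarrow> complex) set"
  where "sobolev s = {f \<in> sphere_L2.
    summable (\<lambda>m. (1 + lb_eigenvalue CARD('d) m) powr s * (L2_norm (harmonic_proj m f))\<^sup>2)}"

definition sobolev_norm :: "real \<Rightarrow> (real ^ ('d::finite option) \<Rightarrow> complex) \<Rightarrow> real"
  where "sobolev_norm s f =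
    sqrt (\<Sum>m. (1 + lb_eigenvalue CARD('d) m) powr s * (L2_norm (harmonic_proj m f))\<^sup>2)"


subsection \<open>Convolution\<close>

definition haar_prob_SO :: "(real ^ 'n ^ 'n::finite) measure \<Rightarrow> bool"
  where "haar_prob_SO G \<longleftrightarrow> prob_space G \<and>
    sets G = sets (restrict_space borel {g. rotation_matrix g}) \<and>
    (\<forall>g. rotation_matrix g \<longrightarrow> distr G G (\<lambda>k. g ** k) = G)"

text \<open>
  For \<open>h\<close> and \<open>f\<close> in \<open>L\<^sup>2\<close> the integral exists for every \<open>x\<close> on the sphere, does not depend on the
  representatives of \<open>h\<close> and \<open>f\<close>, and is continuous in \<open>x\<close>. Hence \<open>sphere_conv G h f x\<close>
  is the point value of the continuous representative of the convolution.
\<close>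

definition sphere_conv ::
  "(real ^ ('d::finite option) ^ ('d option)) measure \<Rightarrow> (real ^ ('d option) \<Rightarrow> complex) \<Rightarrow>
    (real ^ ('d option) \<Rightarrow> complex) \<Rightarrow> real ^ ('d option) \<Rightarrow> complex"
  where "sphere_conv G h f x = (\<integral>g. h (matrix_inv g *v x) * f (g *v north_pole) \<partial>G)"

definition conv_coeff :: "(real ^ ('d::finite option) \<Rightarrow> complex) \<Rightarrow> nat \<Rightarrow> complex"
  where "conv_coeff h m = harmonic_proj m h north_pole /
    of_nat (cfun.dim (harmonics m :: (real ^ ('d option) \<Rightarrow> complex) set))"

end

theory Submission
  imports Defs
begin

text \<open>
  Spherical harmonics are the restrictions of harmonic polynomials: the Laplace--Beltrami operator
  is a sum of squares of infinitesimal rotations, hence symmetric and given by the Euler identity on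
  homogeneous harmonic polynomials, and these span a dense subspace by Stone--Weierstrass. A harmonic
  polynomial is determined by its Cauchy data on a hyperplane; this bounds \<open>\<delta>\<^sub>k\<close> and shows that zonal
  harmonics are unique up to a factor, whence convolution acts on \<open>\<H>\<^sub>k\<close> as multiplication by \<open>b\<^sub>k\<close>.

  For the estimate, split \<open>F f - F p\<close> at degree \<open>m\<close>. The high degrees are controlled by the Sobolev
  norm of \<open>F f\<close>. The low part \<open>Q\<close> lies in \<open>F \<Q>\<^sub>m\<close>, and minimality of \<open>p\<close> makes its discrete
  norm at most that of \<open>y - F p - Q\<close>, which is the data error plus the tail of \<open>F f\<close>. From
  \<open>|Y(x)| \<le> \<delta>\<^sub>k\<^bsup>1/2\<^esup> |Y|\<^sub>2\<close> for \<open>Y \<in> \<H>\<^sub>k\<close> and a telescoping bound of \<open>\<Sum>\<^sub>k\<^sub>>\<^sub>m \<delta>\<^sub>k (1 + \<lambda>\<^sub>k\<^sup>2)\<^bsup>-s-d/2\<^esup>\<close> by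
  \<open>(1 + \<lambda>\<^sub>m\<^sup>2)\<^bsup>-s\<^esup> / s\<close> with \<open>s = \<sigma> - \<zeta> - d/2\<close>, the tail is bounded uniformly, and the sampling inequality
  returns from the discrete norm to the \<open>L\<^sup>2\<close> norm of \<open>Q\<close>.
\<close>


subsection \<open>Directional derivatives\<close>

text \<open>Three obstacles shape the proof. The eigenspaces are given weakly, by pairings with
  smooth functions. Instead of regularity theory, orthogonality is used: what remains of an
  eigenfunction after removing its projection onto the polynomials of its degree is orthogonal to
  the harmonic polynomials of every degree, so density makes it vanish. Second, multipliers b_k may
  be zero, so F cannot be inverted. The competitor that moves F p towards the truncation of F f is
  therefore formed before F is applied, by moving p towards the truncation of f; both stay in the
  polynomials of degree at most m. Third, the constant (1 + \<kappa>) / s leaves no room for a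
  factor depending on the dimension. The uniform tail and the omitted degrees in the Sobolev norm
  must both fit under exactly \<open>eig m powr (- s) / s\<close>, so the dimension estimate has to
  telescope with constant one. The interaction of noise and tail is then absorbed by \<kappa> \<le>
  sqrt (\<kappa> (1 + \<kappa>)).\<close>

definition dd :: "'a::euclidean_space \<Rightarrow> ('a \<Rightarrow> complex) \<Rightarrow> 'a \<Rightarrow> complex"
  where "dd u f = (\<lambda>x. frechet_derivative f (at x) u)"

lemma dd_eqI: "(f has_derivative f') (at x) \<Longrightarrow> dd u f x = f' u"
  unfolding dd_def by (metis frechet_derivative_at)

lemma has_derivative_dd:
  "f differentiable (at x) \<Longrightarrow> (f has_derivative (\<lambda>u. dd u f x)) (at x)"
  unfolding dd_def by (simp add: frechet_derivative_works)

lemma dd_linear: "f differentiable (at x) \<Longrightarrow> linear (\<lambda>u. dd u f x)"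
  using has_derivative_dd has_derivative_linear by blast

lemma dd_const [simp]: "dd u (\<lambda>x. c) = (\<lambda>x. 0)"
  by (rule ext, rule dd_eqI[where f' = "\<lambda>_. 0"]) simp

lemma dd_add:
  "f differentiable (at x) \<Longrightarrow> g differentiable (at x) \<Longrightarrow>
    dd u (\<lambda>x. f x + g x) x = dd u f x + dd u g x"
  by (rule dd_eqI[where f' = "\<lambda>u. dd u f x + dd u g x"])
    (intro has_derivative_add has_derivative_dd)

lemma dd_diff:
  "f differentiable (at x) \<Longrightarrow> g differentiable (at x) \<Longrightarrow>
    dd u (\<lambda>x. f x - g x) x = dd u f x - dd u g x"
  by (rule dd_eqI[where f' = "\<lambda>u. dd u f x - dd u g x"])
    (intro has_derivative_diff has_derivative_dd)

lemma dd_mult: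
  "f differentiable (at x) \<Longrightarrow> g differentiable (at x) \<Longrightarrow>
    dd u (\<lambda>x. f x * g x) x = f x * dd u g x + dd u f x * g x"
  by (rule dd_eqI[where f' = "\<lambda>u. f x * dd u g x + dd u f x * g x"])
    (intro has_derivative_mult has_derivative_dd)

lemma dd_cmult:
  "f differentiable (at x) \<Longrightarrow> dd u (\<lambda>x. c * f x) x = c * dd u f x"
  by (subst dd_mult) auto

lemma dd_cnj:
  "f differentiable (at x) \<Longrightarrow> dd u (\<lambda>x. cnj (f x)) x = cnj (dd u f x)"
  by (rule dd_eqI[where f' = "\<lambda>u. cnj (dd u f x)"])
    (intro has_derivative_cnj has_derivative_dd)

lemma has_derivative_coord:
  "((\<lambda>x. complex_of_real (x \<bullet> b)) has_derivative (\<lambda>u. complex_of_real (u \<bullet> b))) (at x)"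
  by (auto intro!: derivative_eq_intros)

lemma differentiable_coord: "(\<lambda>x. complex_of_real (x \<bullet> b)) differentiable (at x)"
  using has_derivative_coord by (rule differentiableI)

lemma dd_coord: "dd u (\<lambda>x. complex_of_real (x \<bullet> b)) x = complex_of_real (u \<bullet> b)"
  using has_derivative_coord by (rule dd_eqI)

lemma dd_coord_mult:
  assumes "f differentiable (at x)"
  shows "dd u (\<lambda>x. complex_of_real (x \<bullet> b) * f x) x =
    of_real (u \<bullet> b) * f x + of_real (x \<bullet> b) * dd u f x"
  using assms by (simp add: dd_mult differentiable_coord dd_coord)

lemma dd_sum:
  assumes "finite A" "\<And>i. i \<in> A \<Longrightarrow> f i differentiable (at x)"
  shows "dd u (\<lambda>x. \<Sum>i\<in>A. f i x) x = (\<Sum>i\<in>A. dd u (f i) x)"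
  by (rule dd_eqI[where f' = "\<lambda>u. \<Sum>i\<in>A. dd u (f i) x"])
    (auto intro!: has_derivative_sum has_derivative_dd assms)

text \<open>Near x the two functions have the same derivatives, so
  \<open>frechet_derivative\<close>, a choice among these, agrees as well, even at a point where no
  derivative exists.\<close>

lemma dd_transform_open:
  assumes "open S" "x \<in> S" "\<And>y. y \<in> S \<Longrightarrow> f y = g y"
  shows "dd u f x = dd u g x"
proof -
  have "(f has_derivative F) (at x) \<longleftrightarrow> (g has_derivative F) (at x)" for F
    using has_derivative_transform_within_open[OF _ assms(1,2)] assms(3) by metis
  then show ?thesis
    unfolding dd_def frechet_derivative_def by simp
qed

lemma dd_expand:
  assumes "f differentiable (at x)"
  shows "dd u f x = (\<Sum>b\<in>Basis. of_real (u \<bullet> b) * dd b f x)"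
proof -
  interpret L: linear "\<lambda>u. dd u f x"
    by (rule dd_linear[OF assms])
  have "dd u f x = dd (\<Sum>b\<in>Basis. (u \<bullet> b) *\<^sub>R b) f x"
    by (simp add: euclidean_representation)
  also have "\<dots> = (\<Sum>b\<in>Basis. of_real (u \<bullet> b) * dd b f x)"
    by (simp add: L.sum L.scale scaleR_conv_of_real)
  finally show ?thesis .
qed

lemma dd_compose_linear:
  assumes "linear R" "f differentiable (at (R x))"
  shows "dd u (\<lambda>x. f (R x)) x = dd (R u) f (R x)"
proof (rule dd_eqI[where f' = "\<lambda>u. dd (R u) f (R x)"])
  have "(R has_derivative R) (at x)"
    using assms(1) by (simp add: linear_imp_has_derivative)
  from has_derivative_compose[OF this has_derivative_dd[OF assms(2)]]
  show "((\<lambda>x. f (R x)) has_derivative (\<lambda>u. dd (R u) f (R x))) (at x)" .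
qed

lemma laplacian_eq_dd: "laplacian f x = (\<Sum>b\<in>Basis. dd b (dd b f) x)"
  unfolding laplacian_def dd_def ..


subsection \<open>Homogeneous polynomials\<close>

text \<open>An inductive closure, so that homogeneity, Euler's identity and the symmetry of second
  derivatives follow by induction from the product rule for one coordinate factor. The zero function
  has every degree.\<close>

inductive hpoly :: "nat \<Rightarrow> ('a::euclidean_space \<Rightarrow> complex) \<Rightarrow> bool" where
  hpoly_const: "hpoly 0 (\<lambda>x. c)"
| hpoly_coord: "hpoly k p \<Longrightarrow> b \<in> Basis \<Longrightarrow> hpoly (Suc k) (\<lambda>x. of_real (x \<bullet> b) * p x)"
| hpoly_add: "hpoly k p \<Longrightarrow> hpoly k q \<Longrightarrow> hpoly k (\<lambda>x. p x + q x)"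

lemma hpoly_zero: "hpoly k (\<lambda>x. 0)"
proof (induction k)
  case (Suc k)
  obtain b :: 'a where "b \<in> Basis" using nonempty_Basis by blast
  from hpoly_coord[OF Suc this] show ?case by simp
qed (rule hpoly_const)

lemma hpoly_cmult: "hpoly k p \<Longrightarrow> hpoly k (\<lambda>x. c * p x)"
proof (induction rule: hpoly.induct)
  case (hpoly_coord k p b)
  from hpoly.hpoly_coord[OF hpoly_coord(3,2)] show ?case by (simp add: mult_ac)
next
  case (hpoly_add k p q)
  from hpoly.hpoly_add[OF hpoly_add(3,4)] show ?case by (simp add: distrib_left)
qed (rule hpoly_const)

lemma hpoly_diff: "hpoly k p \<Longrightarrow> hpoly k q \<Longrightarrow> hpoly k (\<lambda>x. p x - q x)"
  using hpoly_add[of k p "\<lambda>x. (-1) * q x"] hpoly_cmult[of k q "-1"] by simp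

lemma hpoly_sum:
  "(\<And>i. i \<in> A \<Longrightarrow> hpoly k (f i)) \<Longrightarrow> hpoly k (\<lambda>x. \<Sum>i\<in>A. f i x)"
  by (induction A rule: infinite_finite_induct) (auto intro: hpoly_zero hpoly_add)

lemma hpoly_inner: 
  assumes "hpoly k p" shows "hpoly (Suc k) (\<lambda>x. of_real (x \<bullet> v) * p x)"
proof -
  have "of_real (x \<bullet> v) * p x = (\<Sum>b\<in>Basis. of_real (v \<bullet> b) * (of_real (x \<bullet> b) * p x))" for x
  proof -
    have "complex_of_real (x \<bullet> v) = (\<Sum>b\<in>Basis. of_real (x \<bullet> b) * of_real (v \<bullet> b))"
      by (subst euclidean_inner) simp
    then show ?thesis by (simp add: sum_distrib_left sum_distrib_right mult_ac)
  qed
  moreover have "hpoly (Suc k) (\<lambda>x. \<Sum>b\<in>Basis. of_real (v \<bullet> b) * (of_real (x \<bullet> b) * p x))"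
    by (intro hpoly_sum hpoly_cmult hpoly_coord assms)
  ultimately show ?thesis by simp
qed

lemma hpoly_mult: "hpoly k p \<Longrightarrow> hpoly l q \<Longrightarrow> hpoly (k + l) (\<lambda>x. p x * q x)"
proof (induction rule: hpoly.induct)
  case (hpoly_const c)
  then show ?case by (simp add: hpoly_cmult)
next
  case (hpoly_coord k p b)
  from hpoly.hpoly_coord[OF hpoly_coord(3)[OF hpoly_coord(4)] hpoly_coord(2)]
  show ?case by (simp add: mult_ac)
next
  case (hpoly_add k p q)
  then show ?case by (simp add: distrib_right hpoly.hpoly_add)
qed

lemma hpoly_compose_linear:
  assumes R: "linear (R :: 'a::euclidean_space \<Rightarrow> 'a)"
  shows "hpoly k p \<Longrightarrow> hpoly k (\<lambda>x. p (R x))"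
proof (induction rule: hpoly.induct)
  case (hpoly_coord k p b)
  have "R x \<bullet> b = x \<bullet> adjoint R b" for x
    using adjoint_works[OF R] by (simp add: inner_commute)
  then show ?case
    using hpoly_inner[OF hpoly_coord(3), of "adjoint R b"] by simp
qed (auto intro: hpoly.intros)

lemma hpoly_normsq: "hpoly 2 (\<lambda>x. of_real (x \<bullet> x))"
proof -
  have "hpoly 2 (\<lambda>x::'a. \<Sum>b\<in>Basis. of_real (x \<bullet> b) * (of_real (x \<bullet> b) * 1))"
    by (intro hpoly_sum) (simp only: numeral_2_eq_2, intro hpoly_coord hpoly_const)
  moreover have "complex_of_real (x \<bullet> x) = (\<Sum>b\<in>Basis. of_real (x \<bullet> b) * (of_real (x \<bullet> b) * 1))" for x :: 'a
    by (subst euclidean_inner) simp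
  ultimately show ?thesis by simp
qed

lemma hpoly_homogeneous: "hpoly k p \<Longrightarrow> p (t *\<^sub>R x) = of_real t ^ k * p x"
  by (induction rule: hpoly.induct) (auto simp: algebra_simps)

text \<open>One induction for differentiability and for the degree of the derivative, since the
  product rule needs both. The clause for \<open>k = 0\<close> compensates for truncated
  subtraction: a coordinate times the derivative of a constant would otherwise count as degree one
  instead of zero.\<close>

lemma hpoly_diff_aux:
  "hpoly k p \<Longrightarrow> (\<forall>x. p differentiable (at x)) \<and>
    (\<forall>u. hpoly (k - 1) (dd u p) \<and> (k = 0 \<longrightarrow> dd u p = (\<lambda>x. 0)))"
proof (induction rule: hpoly.induct)
  case (hpoly_coord k p b)
  then have D: "p differentiable (at x)" for x by blast
  have eq: "dd u (\<lambda>x. of_real (x \<bullet> b) * p x) = (\<lambda>x. of_real (u \<bullet> b) * p x + of_real (x \<bullet> b) * dd u p x)" for u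
    using dd_coord_mult[OF D] by blast
  have "hpoly k (\<lambda>x. of_real (x \<bullet> b) * dd u p x)" for u
  proof (cases k)
    case 0
    then show ?thesis using hpoly_coord by (simp add: hpoly_zero)
  next
    case (Suc j)
    then have "hpoly j (dd u p)" using hpoly_coord by auto
    from hpoly.hpoly_coord[OF this hpoly_coord(2)] show ?thesis using Suc by simp
  qed
  then show ?case
    using D by (auto simp: eq intro!: hpoly.hpoly_add hpoly_cmult hpoly_coord(1) differentiable_mult differentiable_coord)
next
  case (hpoly_add k p q)
  then have "p differentiable (at x)" "q differentiable (at x)" for x by blast+
  then have "dd u (\<lambda>x. p x + q x) = (\<lambda>x. dd u p x + dd u q x)" for u
    using dd_add by blast
  with hpoly_add show ?case by (auto intro: hpoly.hpoly_add differentiable_add)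
qed (auto intro: hpoly.hpoly_const)

lemma hpoly_differentiable: "hpoly k p \<Longrightarrow> p differentiable (at x)"
  using hpoly_diff_aux by blast

lemma hpoly_dd: "hpoly k p \<Longrightarrow> hpoly (k - 1) (dd u p)"
  using hpoly_diff_aux by blast

lemma hpoly_dd_0: "hpoly 0 p \<Longrightarrow> dd u p = (\<lambda>x. 0)"
  using hpoly_diff_aux by blast

lemma hpoly_continuous: "hpoly k p \<Longrightarrow> continuous_on S p"
  using hpoly_differentiable differentiable_imp_continuous_within
  by (metis continuous_at_imp_continuous_on)

lemma hpoly_euler: "hpoly k p \<Longrightarrow> dd x p x = of_nat k * p x"
proof (induction rule: hpoly.induct)
  case (hpoly_coord k p b)
  then show ?case
    by (subst dd_coord_mult[OF hpoly_differentiable[OF hpoly_coord(1)]]) (simp add: algebra_simps)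
next
  case (hpoly_add k p q)
  then show ?case
    by (subst dd_add[OF hpoly_differentiable[OF hpoly_add(1)] hpoly_differentiable[OF hpoly_add(2)]])
      (simp add: algebra_simps)
qed simp

text \<open>For a coordinate factor the second derivative consists of one second-order term,
  symmetric by induction, and two first-order terms that u and v exchange.\<close>

lemma hpoly_dd_commute: "hpoly k p \<Longrightarrow> dd u (dd v p) = dd v (dd u p)"
proof (induction rule: hpoly.induct)
  case (hpoly_coord k p b)
  note D = hpoly_differentiable[OF hpoly_coord(1)] hpoly_differentiable[OF hpoly_dd[OF hpoly_coord(1)]]
  have eq: "dd u (\<lambda>x. of_real (x \<bullet> b) * p x) = (\<lambda>x. of_real (u \<bullet> b) * p x + of_real (x \<bullet> b) * dd u p x)" for u
    using dd_coord_mult[OF D(1)] by blast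
  have "dd u (dd v (\<lambda>x. of_real (x \<bullet> b) * p x)) x = 
    of_real (v \<bullet> b) * dd u p x + (of_real (u \<bullet> b) * dd v p x + of_real (x \<bullet> b) * dd u (dd v p) x)" for u v x
    unfolding eq
    by (subst dd_add)
      (auto intro!: differentiable_mult differentiable_coord D simp: dd_cmult[OF D(1)] dd_coord_mult[OF D(2)])
  with hpoly_coord(3) show ?case by (auto simp: fun_eq_iff)
next
  case (hpoly_add k p q)
  have eq: "dd u (\<lambda>x. p x + q x) = (\<lambda>x. dd u p x + dd u q x)" if "hpoly l p" "hpoly l q" for u l p q
    using dd_add[OF hpoly_differentiable hpoly_differentiable] that by blast
  show ?case
    using hpoly_add(3,4) by (simp add: eq[OF hpoly_add(1,2)] eq[OF hpoly_dd[OF hpoly_add(1)] hpoly_dd[OF hpoly_add(2)]])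
qed simp

lemma dd_hpoly_add: "hpoly k p \<Longrightarrow> hpoly l q \<Longrightarrow> dd u (\<lambda>x. p x + q x) = (\<lambda>x. dd u p x + dd u q x)"
  using dd_add hpoly_differentiable by blast

lemma dd_hpoly_diff: "hpoly k p \<Longrightarrow> hpoly l q \<Longrightarrow> dd u (\<lambda>x. p x - q x) = (\<lambda>x. dd u p x - dd u q x)"
  using dd_diff hpoly_differentiable by blast

lemma dd_hpoly_cmult: "hpoly k p \<Longrightarrow> dd u (\<lambda>x. c * p x) = (\<lambda>x. c * dd u p x)"
  using dd_cmult hpoly_differentiable by blast

lemma laplacian_hpoly_add:
  "hpoly k p \<Longrightarrow> hpoly l q \<Longrightarrow> laplacian (\<lambda>x. p x + q x) = (\<lambda>x. laplacian p x + laplacian q x)"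
  by (auto simp: laplacian_eq_dd dd_hpoly_add dd_hpoly_add[OF hpoly_dd hpoly_dd] sum.distrib)

lemma laplacian_hpoly_diff:
  "hpoly k p \<Longrightarrow> hpoly l q \<Longrightarrow> laplacian (\<lambda>x. p x - q x) = (\<lambda>x. laplacian p x - laplacian q x)"
  by (auto simp: laplacian_eq_dd dd_hpoly_diff dd_hpoly_diff[OF hpoly_dd hpoly_dd] sum_subtractf)

lemma laplacian_hpoly_cmult:
  "hpoly k p \<Longrightarrow> laplacian (\<lambda>x. c * p x) = (\<lambda>x. c * laplacian p x)"
  by (auto simp: laplacian_eq_dd dd_hpoly_cmult dd_hpoly_cmult[OF hpoly_dd] sum_distrib_left)

lemma hpoly_laplacian: "hpoly k p \<Longrightarrow> hpoly (k - 2) (laplacian p)"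
proof -
  assume "hpoly k p"
  then have "hpoly (k - 1 - 1) (\<lambda>x. \<Sum>b\<in>Basis. dd b (dd b p) x)"
    by (intro hpoly_sum hpoly_dd)
  then show ?thesis
    by (simp add: laplacian_eq_dd[abs_def] numeral_2_eq_2)
qed

lemma laplacian_hpoly_low: 
  assumes "hpoly k p" "k < 2" shows "laplacian p = (\<lambda>x. 0)"
proof -
  have "dd b (dd b p) = (\<lambda>x. 0)" for b
    using hpoly_dd_0[of "dd b p" b] hpoly_dd[OF assms(1), of b] assms(2) by simp
  then show ?thesis by (auto simp: laplacian_eq_dd)
qed

lemma dd_normsq: "dd u (\<lambda>x. complex_of_real (x \<bullet> x)) = (\<lambda>x. 2 * of_real (x \<bullet> u))"
proof
  fix x
  show "dd u (\<lambda>x. complex_of_real (x \<bullet> x)) x = 2 * of_real (x \<bullet> u)"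
    by (rule dd_eqI[where f' = "\<lambda>u. complex_of_real (x \<bullet> u + u \<bullet> x)", THEN trans])
      (auto intro!: derivative_eq_intros simp: inner_commute)
qed

text \<open>Twice the dimension is the Laplacian of the squared norm. The cross term, twice the
  pairing of the gradients, is \<open>4 * dd x q x\<close>, which Euler's identity turns into 4 k
  q.\<close>

lemma laplacian_normsq_mult:
  assumes q: "hpoly k (q :: 'a::euclidean_space \<Rightarrow> complex)"
  shows "laplacian (\<lambda>x. of_real (x \<bullet> x) * q x) =
    (\<lambda>x. (2 * of_nat DIM('a) + 4 * of_nat k) * q x + of_real (x \<bullet> x) * laplacian q x)"
proof
  fix x :: 'a
  note N = hpoly_differentiable[OF hpoly_normsq]
  note D = hpoly_differentiable[OF q] hpoly_differentiable[OF hpoly_dd[OF q]]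
  have 1: "dd b (\<lambda>x. of_real (x \<bullet> x) * q x) = (\<lambda>x. of_real (x \<bullet> x) * dd b q x + 2 * (of_real (x \<bullet> b) * q x))" for b
    using dd_mult[OF N D(1)] by (simp add: dd_normsq fun_eq_iff mult_ac)
  have 2: "dd b (dd b (\<lambda>x. of_real (x \<bullet> x) * q x)) x =
     of_real (x \<bullet> x) * dd b (dd b q) x + 4 * (of_real (x \<bullet> b) * dd b q x) + 2 * q x" if "b \<in> Basis" for b
  proof -
    have "dd b (\<lambda>x. of_real (x \<bullet> x) * dd b q x) x = of_real (x \<bullet> x) * dd b (dd b q) x + 2 * of_real (x \<bullet> b) * dd b q x"
      by (subst dd_mult[OF N D(2)]) (simp add: dd_normsq)
    moreover have "dd b (\<lambda>x. 2 * (of_real (x \<bullet> b) * q x)) x = 2 * (q x + of_real (x \<bullet> b) * dd b q x)"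
      using that by (subst dd_cmult) (auto intro: differentiable_mult differentiable_coord D simp: dd_coord_mult[OF D(1)])
    ultimately show ?thesis
      unfolding 1
      by (subst dd_add) (auto intro!: differentiable_mult differentiable_coord N D simp: algebra_simps)
  qed
  have "laplacian (\<lambda>x. of_real (x \<bullet> x) * q x) x =
      of_real (x \<bullet> x) * laplacian q x + 4 * (\<Sum>b\<in>Basis. of_real (x \<bullet> b) * dd b q x) + 2 * of_nat DIM('a) * q x"
    by (simp add: laplacian_eq_dd 2 sum.distrib sum_distrib_left)
  also have "(\<Sum>b\<in>Basis. of_real (x \<bullet> b) * dd b q x) = of_nat k * q x"
    using dd_expand[OF D(1), of x x] hpoly_euler[OF q] by simp
  finally show "laplacian (\<lambda>x. of_real (x \<bullet> x) * q x) x =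
    (2 * of_nat DIM('a) + 4 * of_nat k) * q x + of_real (x \<bullet> x) * laplacian q x"
    by (simp add: algebra_simps)
qed


subsection \<open>Harmonic polynomials\<close>

definition hharm :: "nat \<Rightarrow> ('a::euclidean_space \<Rightarrow> complex) \<Rightarrow> bool"
  where "hharm k p \<longleftrightarrow> hpoly k p \<and> laplacian p = (\<lambda>x. 0)"

lemma hharm_hpoly: "hharm k p \<Longrightarrow> hpoly k p"
  by (simp add: hharm_def)

lemma hharm_zero: "hharm k (\<lambda>x. 0)"
  by (auto simp: hharm_def hpoly_zero laplacian_eq_dd)

lemma hharm_add: "hharm k p \<Longrightarrow> hharm k q \<Longrightarrow> hharm k (\<lambda>x. p x + q x)"
  by (auto simp: hharm_def hpoly_add laplacian_hpoly_add)

lemma hharm_diff: "hharm k p \<Longrightarrow> hharm k q \<Longrightarrow> hharm k (\<lambda>x. p x - q x)"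
  by (auto simp: hharm_def hpoly_diff laplacian_hpoly_diff)

lemma hharm_cmult: "hharm k p \<Longrightarrow> hharm k (\<lambda>x. c * p x)"
  by (auto simp: hharm_def hpoly_cmult laplacian_hpoly_cmult)

lemma hharm_dd:
  assumes "hharm k p" shows "hharm (k - 1) (dd u p)"
proof -
  have p: "hpoly k p" and L: "laplacian p = (\<lambda>x. 0)"
    using assms by (auto simp: hharm_def)
  have "dd b (dd b (dd u p)) = dd u (dd b (dd b p))" for b
    by (metis hpoly_dd_commute hpoly_dd p)
  then have "laplacian (dd u p) x = dd u (laplacian p) x" for x
    unfolding laplacian_eq_dd[abs_def]
    by (subst dd_sum) (auto intro!: hpoly_differentiable[OF hpoly_dd[OF hpoly_dd[OF p]]])
  then show ?thesis
    using hpoly_dd[OF p] by (auto simp: hharm_def L)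
qed

text \<open>By the chain rule the left side is the Hessian of p at R x, contracted with the sum over
  b of the coordinate products of R b. This sum is the identity matrix because the inverse of R
  preserves inner products.\<close>

lemma laplacian_compose_orthogonal:
  assumes R: "orthogonal_transformation (R :: 'a::euclidean_space \<Rightarrow> 'a)" and p: "hpoly k p"
  shows "laplacian (\<lambda>x. p (R x)) x = laplacian p (R x)"
proof -
  have lin: "linear R" using R by (rule orthogonal_transformation_linear)
  let ?S = "inv R"
  have S: "orthogonal_transformation ?S" using R orthogonal_transformation_inv by blast
  have adj: "R b \<bullet> c = b \<bullet> ?S c" for b c
  proof -
    have "R (?S c) = c" using orthogonal_transformation_surj[OF R] by (simp add: surj_f_inv_f)
    then show ?thesis using R unfolding orthogonal_transformation_def by metis
  qed
  let ?H = "\<lambda>u v. dd u (dd v p) (R x)"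
  have D1: "dd u (\<lambda>x. p (R x)) = (\<lambda>x. dd (R u) p (R x))" for u
    using dd_compose_linear[OF lin hpoly_differentiable[OF p]] by blast
  have "dd b (dd b (\<lambda>x. p (R x))) x = (\<Sum>c\<in>Basis. \<Sum>c'\<in>Basis. of_real ((R b \<bullet> c) * (R b \<bullet> c')) * ?H c c')" for b
  proof -
    have "dd b (dd b (\<lambda>x. p (R x))) x = dd (R b) (dd (R b) p) (R x)"
      unfolding D1 by (rule dd_compose_linear[OF lin hpoly_differentiable[OF hpoly_dd[OF p]]])
    also have "\<dots> = (\<Sum>c\<in>Basis. of_real (R b \<bullet> c) * dd c (dd (R b) p) (R x))"
      by (rule dd_expand[OF hpoly_differentiable[OF hpoly_dd[OF p]]])
    also have "\<dots> = (\<Sum>c\<in>Basis. of_real (R b \<bullet> c) * dd (R b) (dd c p) (R x))"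
      by (simp add: hpoly_dd_commute[OF p])
    also have "\<dots> = (\<Sum>c\<in>Basis. of_real (R b \<bullet> c) * (\<Sum>c'\<in>Basis. of_real (R b \<bullet> c') * dd c' (dd c p) (R x)))"
      by (simp add: dd_expand[OF hpoly_differentiable[OF hpoly_dd[OF p]], of "R b"])
    finally show ?thesis
      by (simp add: sum_distrib_left mult_ac hpoly_dd_commute[OF p])
  qed
  then have "laplacian (\<lambda>x. p (R x)) x =
     (\<Sum>b\<in>Basis. \<Sum>c\<in>Basis. \<Sum>c'\<in>Basis. of_real ((R b \<bullet> c) * (R b \<bullet> c')) * ?H c c')"
    by (simp add: laplacian_eq_dd)
  also have "\<dots> = (\<Sum>c\<in>Basis. \<Sum>c'\<in>Basis. \<Sum>b\<in>Basis. of_real ((R b \<bullet> c) * (R b \<bullet> c')) * ?H c c')"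
    by (rule trans[OF sum.swap], rule sum.cong[OF refl], rule sum.swap)
  also have "\<dots> = (\<Sum>c\<in>Basis. \<Sum>c'\<in>Basis. of_real (c \<bullet> c') * ?H c c')"
  proof (intro sum.cong refl)
    fix c c' :: 'a
    have "(\<Sum>b\<in>Basis. (R b \<bullet> c) * (R b \<bullet> c')) = ?S c \<bullet> ?S c'"
      unfolding adj by (subst euclidean_inner) (simp add: inner_commute)
    also have "\<dots> = c \<bullet> c'" using S by (simp add: orthogonal_transformation_def)
    finally show "(\<Sum>b\<in>Basis. of_real ((R b \<bullet> c) * (R b \<bullet> c')) * ?H c c') = of_real (c \<bullet> c') * ?H c c'"
      by (simp only: sum_distrib_right[symmetric] of_real_sum[symmetric])
  qed
  also have "\<dots> = (\<Sum>c\<in>Basis. ?H c c)"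
    by (intro sum.cong refl) (simp add: inner_Basis if_distrib if_distribR sum.delta cong: if_cong)
  finally show ?thesis by (simp add: laplacian_eq_dd)
qed

lemma hharm_compose_orthogonal:
  assumes R: "orthogonal_transformation (R :: 'a::euclidean_space \<Rightarrow> 'a)" and p: "hharm k p"
  shows "hharm k (\<lambda>x. p (R x))"
proof -
  have "hpoly k (\<lambda>x. p (R x))"
    by (rule hpoly_compose_linear[OF orthogonal_transformation_linear[OF R] hharm_hpoly[OF p]])
  moreover have "laplacian (\<lambda>x. p (R x)) x = 0" for x
    unfolding laplacian_compose_orthogonal[OF R hharm_hpoly[OF p]]
    using p by (simp add: hharm_def)
  ultimately show ?thesis
    unfolding hharm_def by blast
qed

section \<open>Decomposition of homogeneous polynomials into harmonic ones\<close>

inductive decomposable :: "nat \<Rightarrow> ('a::euclidean_space \<Rightarrow> complex) \<Rightarrow> bool" where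
  decomposable_base: "hharm l h \<Longrightarrow> decomposable (2 * j + l) (\<lambda>x. of_real (x \<bullet> x) ^ j * h x)"
| decomposable_add: "decomposable k p \<Longrightarrow> decomposable k q \<Longrightarrow> decomposable k (\<lambda>x. p x + q x)"

lemma hpoly_normsq_power_mult:
  "hpoly l h \<Longrightarrow> hpoly (2 * j + l) (\<lambda>x. of_real (x \<bullet> x) ^ j * h x)"
proof (induction j)
  case (Suc j)
  from hpoly_mult[OF hpoly_normsq Suc.IH[OF Suc.prems]] show ?case by (simp add: mult_ac)
qed simp

lemma decomposable_hpoly: "decomposable k p \<Longrightarrow> hpoly k p"
  by (induction rule: decomposable.induct)
    (auto intro: hpoly_normsq_power_mult hharm_hpoly hpoly_add)

text \<open>Each step adds the positive factor of \<open>laplacian_normsq_mult\<close> at the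
  current degree. Positivity of c is the point: it can be divided out, which inverts the Laplacian
  on such terms.\<close>

lemma laplacian_normsq_power:
  assumes "hharm l (h :: 'a::euclidean_space \<Rightarrow> complex)"
  shows "\<exists>c>0. laplacian (\<lambda>x. of_real (x \<bullet> x) ^ Suc j * h x) = (\<lambda>x. of_real c * (of_real (x \<bullet> x) ^ j * h x))"
proof (induction j)
  case 0
  have "0 < 2 * real DIM('a) + 4 * real l" by (simp add: add_pos_nonneg)
  moreover have "laplacian (\<lambda>x. of_real (x \<bullet> x) ^ Suc 0 * h x) = (\<lambda>x. of_real (2 * real DIM('a) + 4 * real l) * (of_real (x \<bullet> x) ^ 0 * h x))"
    using laplacian_normsq_mult[OF hharm_hpoly[OF assms]] assms by (simp add: hharm_def)
  ultimately show ?case by blast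
next
  case (Suc j)
  then obtain c where c: "c > 0"
    "laplacian (\<lambda>x. of_real (x \<bullet> x) ^ Suc j * h x) = (\<lambda>x. of_real c * (of_real (x \<bullet> x) ^ j * h x))" by blast
  let ?c = "2 * real DIM('a) + 4 * real (2 * Suc j + l) + c"
  have "0 < ?c" using c(1) by (simp add: add_pos_nonneg add_nonneg_pos)
  moreover have "laplacian (\<lambda>x. of_real (x \<bullet> x) ^ Suc (Suc j) * h x) = (\<lambda>x. of_real ?c * (of_real (x \<bullet> x) ^ Suc j * h x))"
    using laplacian_normsq_mult[OF hpoly_normsq_power_mult[OF hharm_hpoly[OF assms], of "Suc j"]] c(2)
    by (simp add: algebra_simps)
  ultimately show ?case by blast
qed

text \<open>Term by term: raise the power of the squared norm by one and divide by the factor from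
  \<open>laplacian_normsq_power\<close>.\<close>

lemma decomposable_laplacian_surj:
  "decomposable k q \<Longrightarrow> \<exists>r. decomposable (k + 2) r \<and> laplacian r = q"
proof (induction rule: decomposable.induct)
  case (decomposable_base l h j)
  then obtain c where c: "c > 0"
    "laplacian (\<lambda>x. of_real (x \<bullet> x) ^ Suc j * h x) = (\<lambda>x. of_real c * (of_real (x \<bullet> x) ^ j * h x))"
    using laplacian_normsq_power by blast
  let ?h = "\<lambda>x. of_real (1/c) * h x"
  have h: "hharm l ?h" by (rule hharm_cmult[OF decomposable_base])
  have "laplacian (\<lambda>x. of_real (1/c) * (of_real (x \<bullet> x) ^ Suc j * h x)) = (\<lambda>x. of_real (x \<bullet> x) ^ j * h x)"
    using c laplacian_hpoly_cmult[OF hpoly_normsq_power_mult[OF hharm_hpoly[OF decomposable_base], of "Suc j"], of "of_real (1/c)"]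
    by simp
  moreover have "(\<lambda>x. of_real (1/c) * (of_real (x \<bullet> x) ^ Suc j * h x)) = (\<lambda>x. of_real (x \<bullet> x) ^ Suc j * ?h x)"
    by (simp add: mult_ac)
  ultimately have "laplacian (\<lambda>x. of_real (x \<bullet> x) ^ Suc j * ?h x) = (\<lambda>x. of_real (x \<bullet> x) ^ j * h x)"
    by simp
  moreover have "decomposable (2 * j + l + 2) (\<lambda>x. of_real (x \<bullet> x) ^ Suc j * ?h x)"
    using decomposable.decomposable_base[OF h, of "Suc j"] by (simp add: algebra_simps)
  ultimately show ?case by blast
next
  case (decomposable_add k p q)
  then obtain r s where "decomposable (k + 2) r" "laplacian r = p" "decomposable (k + 2) s" "laplacian s = q"
    by blast
  then show ?case
    using laplacian_hpoly_add[OF decomposable_hpoly decomposable_hpoly]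
    by (intro exI[of _ "\<lambda>x. r x + s x"]) (auto intro: decomposable.decomposable_add)
qed

text \<open>Induction in steps of two: the Laplacian of p decomposes, so it is also the Laplacian of
  some decomposable r of degree k, and p - r is harmonic.\<close>

lemma hpoly_decomposable: "hpoly k p \<Longrightarrow> decomposable k p"
proof (induction k arbitrary: p rule: less_induct)
  case (less k)
  show ?case
  proof (cases "k < 2")
    case True
    then have "hharm k p" using less.prems laplacian_hpoly_low by (auto simp: hharm_def)
    from decomposable_base[OF this, of 0] show ?thesis by simp
  next
    case False
    then have "decomposable (k - 2) (laplacian p)"
      using less.IH[of "k - 2"] hpoly_laplacian[OF less.prems] by simp
    moreover have "k - 2 + 2 = k" using False by simp
    ultimately obtain r where r: "decomposable k r" "laplacian r = laplacian p"
      using decomposable_laplacian_surj[of "k - 2"] by metis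
    then have "hharm k (\<lambda>x. p x - r x)"
      using less.prems decomposable_hpoly[OF r(1)]
      by (simp add: hharm_def hpoly_diff laplacian_hpoly_diff)
    from decomposable_add[OF decomposable_base[OF this, of 0, simplified] r(1)] show ?thesis
      by simp
  qed
qed


subsection \<open>Cauchy data of harmonic polynomials\<close>

definition drop_coord :: "'a::euclidean_space \<Rightarrow> 'a \<Rightarrow> 'a"
  where "drop_coord e x = x - (x \<bullet> e) *\<^sub>R e"

lemma linear_drop_coord: "linear (drop_coord e)"
  unfolding drop_coord_def by (rule linearI) (auto simp: algebra_simps)

lemma drop_coord_eq: "v \<bullet> e = 0 \<Longrightarrow> drop_coord e v = v"
  by (simp add: drop_coord_def)

lemma drop_coord_inner: "norm e = 1 \<Longrightarrow> drop_coord e v \<bullet> e = 0"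
  by (simp add: drop_coord_def inner_diff_left inner_same_Basis dot_square_norm)

lemma dd_tangential_zero:
  assumes "hpoly k p" "\<And>x. p (drop_coord e x) = 0" "b \<bullet> e = 0"
  shows "dd b p (drop_coord e x) = 0"
proof -
  have "dd b (\<lambda>x. p (drop_coord e x)) x = dd (drop_coord e b) p (drop_coord e x)"
    by (rule dd_compose_linear[OF linear_drop_coord hpoly_differentiable[OF assms(1)]])
  with assms show ?thesis by (simp add: drop_coord_eq)
qed

text \<open>Induction on the degree, applied to \<open>dd e p\<close>. Its values on the hyperplane
  vanish by assumption. Its normal derivative there is minus the sum of the tangential second
  derivatives, as p is harmonic, and these vanish because p does.\<close>

lemma hharm_cauchy_unique:
  assumes e: "e \<in> Basis"
  shows "hharm k p \<Longrightarrow> (\<And>x. p (drop_coord e x) = 0) \<Longrightarrow>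
    (\<And>x. dd e p (drop_coord e x) = 0) \<Longrightarrow> p x = 0"
proof (induction k arbitrary: p x)
  case 0
  have "p (0 *\<^sub>R x) = of_real 0 ^ 0 * p x" "p (0 *\<^sub>R drop_coord e x) = of_real 0 ^ 0 * p (drop_coord e x)"
    by (rule hpoly_homogeneous[OF hharm_hpoly[OF 0(1)]])+
  then show ?case using 0(2) by simp
next
  case (Suc k)
  note p = hharm_hpoly[OF Suc.prems(1)]
  have [simp]: "e \<bullet> e = 1" using e by simp
  let ?q = "dd e p"
  have q: "hharm k ?q" using hharm_dd[OF Suc.prems(1), of e] by simp
  have "dd e ?q (drop_coord e y) = 0" for y
  proof -
    have "(\<Sum>b\<in>Basis. dd b (dd b p) (drop_coord e y)) = 0"
      using Suc.prems(1) by (metis hharm_def laplacian_eq_dd)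
    moreover have "dd b (dd b p) (drop_coord e y) = 0" if "b \<in> Basis - {e}" for b
    proof -
      have "b \<bullet> e = 0" using that e by (auto simp: inner_Basis)
      then show ?thesis
        by (intro dd_tangential_zero[OF hpoly_dd[OF p]] dd_tangential_zero[OF p] Suc.prems) 
    qed
    ultimately show ?thesis
      using e by (simp add: sum.remove[of _ e])
  qed
  then have q0: "?q x = 0" for x
    using Suc.IH[OF q] Suc.prems(3) by blast
  \<comment> \<open>Since \<open>dd e p\<close> is zero everywhere, p is constant on the line in
    direction e that joins x to its foot on the hyperplane.\<close>
  define g where "g t = p (drop_coord e x + t *\<^sub>R e)" for t
  have "(g has_derivative (\<lambda>t. 0)) (at t)" for t
  proof -
    have "((\<lambda>t. drop_coord e x + t *\<^sub>R e) has_derivative (\<lambda>t. t *\<^sub>R e)) (at t)"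
      by (auto intro!: derivative_eq_intros)
    from has_derivative_compose[OF this has_derivative_dd[OF hpoly_differentiable[OF p]]]
    have "(g has_derivative (\<lambda>s. dd (s *\<^sub>R e) p (drop_coord e x + t *\<^sub>R e))) (at t)"
      unfolding g_def .
    moreover have "dd (s *\<^sub>R e) p z = 0" for s z
      using linear_scale[OF dd_linear[OF hpoly_differentiable[OF p]], of s e] q0 by simp
    ultimately show ?thesis by simp
  qed
  then have "g (x \<bullet> e) = g 0"
    using has_derivative_zero_constant[of UNIV g] by (metis UNIV_I convex_UNIV)
  then show ?case
    using Suc.prems(2) by (simp add: g_def drop_coord_def)
qed

subsection \<open>The measure on the sphere\<close>

lemma ball_lborel:
  "emeasure lborel (ball 0 1 :: 'a::euclidean_space set) \<noteq> 0"
  "emeasure lborel (ball 0 1 :: 'a set) \<noteq> \<infinity>"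
  "emeasure lborel (ball 0 1 :: 'a set) < \<infinity>"
proof -
  have "unit_ball_vol (real DIM('a)) \<noteq> 0"
    by (rule less_imp_neq[OF unit_ball_vol_pos, symmetric]) simp
  then show "emeasure lborel (ball 0 1 :: 'a set) \<noteq> 0"
    by (simp add: emeasure_ball ennreal_eq_0_iff not_le order_less_le)
qed (auto simp: emeasure_ball)

lemma nn_integral_lborel_translate:
  fixes f :: "'a::euclidean_space \<Rightarrow> ennreal"
  assumes "f \<in> borel_measurable borel"
  shows "(\<integral>\<^sup>+y. f (c + y) \<partial>lborel) = (\<integral>\<^sup>+y. f y \<partial>lborel)"
  by (subst (2) lborel_distr_plus[of c, symmetric]) (use assms in \<open>simp add: nn_integral_distr\<close>)

lemma orthogonal_transformation_borel:
  "orthogonal_transformation (R :: 'a::euclidean_space \<Rightarrow> 'a) \<Longrightarrow> R \<in> borel_measurable borel"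
  by (intro borel_measurable_continuous_onI linear_continuous_on linear_conv_bounded_linear[THEN iffD1]
      orthogonal_transformation_linear)

text \<open>Uniqueness of translation invariant measures, in the form of one double integral: both
  orders of integration of \<open>1\<^sub>A(R y + x) 1\<^sub>B(x)\<close>, with \<open>B\<close> the unit ball, are evaluated by translation.\<close>

lemma lborel_distr_orthogonal:
  fixes R :: "'a::euclidean_space \<Rightarrow> 'a"
  assumes R: "orthogonal_transformation R"
  shows "distr lborel borel R = lborel"
proof (rule measure_eqI)
  show "sets (distr lborel borel R) = sets lborel" by simp
  fix A assume "A \<in> sets (distr lborel borel R)"
  then have A [measurable]: "A \<in> sets borel" by simp
  note [measurable] = orthogonal_transformation_borel[OF R]
  let ?B = "ball 0 1 :: 'a set"
  have [measurable]: "?B \<in> sets borel" by simp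
  let ?S = "inv R"
  have S: "R (?S x) = x" for x
    using orthogonal_transformation_surj[OF R] by (simp add: surj_f_inv_f)
  interpret L: linear R using R by (rule orthogonal_transformation_linear)
  have "emeasure (distr lborel borel R) A * emeasure lborel ?B
      = (\<integral>\<^sup>+x. (\<integral>\<^sup>+y. indicator A (R y) \<partial>lborel) * indicator ?B x \<partial>lborel)"
  proof -
    have "emeasure (distr lborel borel R) A = (\<integral>\<^sup>+y. indicator A y \<partial>distr lborel borel R)"
      by simp
    also have "\<dots> = (\<integral>\<^sup>+y. indicator A (R y) \<partial>lborel)"
      by (rule nn_integral_distr) simp_all
    finally show ?thesis by (simp add: nn_integral_cmult_indicator)
  qed
  also have "\<dots> = (\<integral>\<^sup>+x. (\<integral>\<^sup>+y. indicator A (R y + x) * indicator ?B x \<partial>lborel) \<partial>lborel)"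
  proof (rule nn_integral_cong)
    fix x
    have "(\<integral>\<^sup>+y. indicator A (R y) \<partial>lborel) = (\<integral>\<^sup>+y. indicator A (R (?S x + y)) \<partial>lborel)"
      by (rule nn_integral_lborel_translate[of "\<lambda>y. indicator A (R y)" "?S x", symmetric]) simp
    also have "\<dots> = (\<integral>\<^sup>+y. indicator A (R y + x) \<partial>lborel)"
      by (simp add: L.add S add.commute)
    finally show "(\<integral>\<^sup>+y. indicator A (R y) \<partial>lborel) * indicator ?B x =
      (\<integral>\<^sup>+y. indicator A (R y + x) * indicator ?B x \<partial>lborel)"
      by (simp add: nn_integral_multc)
  qed
  also have "\<dots> = (\<integral>\<^sup>+y. (\<integral>\<^sup>+x. indicator A (R y + x) * indicator ?B x \<partial>lborel) \<partial>lborel)"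
    by (rule lborel_pair.Fubini') measurable
  also have "\<dots> = (\<integral>\<^sup>+y. (\<integral>\<^sup>+x. indicator A x * indicator ?B (x - R y) \<partial>lborel) \<partial>lborel)"
  proof (rule nn_integral_cong)
    fix y
    have "(\<integral>\<^sup>+x. indicator A (R y + x) * indicator ?B ((R y + x) - R y) \<partial>lborel) =
       (\<integral>\<^sup>+x. (indicator A x * indicator ?B (x - R y) :: ennreal) \<partial>lborel)"
      by (rule nn_integral_lborel_translate[of "\<lambda>x. indicator A x * indicator ?B (x - R y)" "R y"]) simp
    then show "(\<integral>\<^sup>+x. indicator A (R y + x) * indicator ?B x \<partial>lborel) =
       (\<integral>\<^sup>+x. (indicator A x * indicator ?B (x - R y) :: ennreal) \<partial>lborel)" by simp
  qed
  also have "\<dots> = (\<integral>\<^sup>+x. (\<integral>\<^sup>+y. indicator A x * indicator ?B (x - R y) \<partial>lborel) \<partial>lborel)"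
    by (rule lborel_pair.Fubini') measurable
  also have "\<dots> = (\<integral>\<^sup>+x. indicator A x * emeasure lborel ?B \<partial>lborel)"
  proof (rule nn_integral_cong)
    fix x
    have "indicator ?B (x - R y) = (indicator (ball (?S x) 1) y :: ennreal)" for y
    proof -
      have "norm (x - R y) = norm (?S x - y)"
        using orthogonal_transformation_norm[OF R, of "?S x - y"] by (simp add: L.diff S)
      then show ?thesis by (simp add: indicator_def dist_norm norm_minus_commute)
    qed
    then have "(\<integral>\<^sup>+y. indicator ?B (x - R y) \<partial>lborel) = emeasure lborel (ball (?S x) 1)"
      by simp
    also have "\<dots> = emeasure lborel ?B" by (simp add: emeasure_ball)
    moreover have "(\<lambda>y. indicator ?B (x - R y) :: ennreal) \<in> borel_measurable lborel"
      by measurable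
    ultimately show "(\<integral>\<^sup>+y. indicator A x * indicator ?B (x - R y) \<partial>lborel) = indicator A x * emeasure lborel ?B"
      by (subst nn_integral_cmult) auto
  qed
  also have "\<dots> = emeasure lborel A * emeasure lborel ?B"
    by (simp add: nn_integral_multc)
  finally have "emeasure (distr lborel borel R) A * emeasure lborel ?B = emeasure lborel A * emeasure lborel ?B" .
  moreover have "emeasure lborel ?B \<noteq> 0" "emeasure lborel ?B \<noteq> \<infinity>"
    by (rule ball_lborel)+
  ultimately show "emeasure (distr lborel borel R) A = emeasure lborel A"
    by (metis ennreal_mult_cancel_left infinity_ennreal_def mult.commute)
qed


section \<open>The measure on the sphere as a measure of cones\<close>

definition ball_measure :: "'a::euclidean_space measure"
  where "ball_measure = uniform_measure lborel (ball 0 1)"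

lemma prob_space_ball_measure: "prob_space (ball_measure :: 'a::euclidean_space measure)"
  unfolding ball_measure_def by (intro prob_space_uniform_measure ball_lborel)

lemma space_ball_measure [simp]: "space ball_measure = UNIV"
  and sets_ball_measure [simp, measurable_cong]: "sets ball_measure = sets borel"
  by (simp_all add: ball_measure_def)

lemma sgn_borel [measurable]: "(sgn :: 'a::euclidean_space \<Rightarrow> 'a) \<in> borel_measurable borel"
  unfolding sgn_div_norm by measurable

lemma space_sphere_measure [simp]: "space sphere_measure = sphere 0 1"
  by (simp add: sphere_measure_def space_restrict_space)

lemma sets_sphere_measure [measurable_cong]:
  "sets sphere_measure = sets (restrict_space borel (sphere 0 1))"
  by (simp add: sphere_measure_def sets_restrict_space)

lemma sets_sphere_measure_iff:
  "A \<in> sets (sphere_measure :: 'a::euclidean_space measure) \<longleftrightarrow> A \<subseteq> sphere 0 1 \<and> A \<in> sets borel"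
  by (simp add: sets_sphere_measure sets_restrict_space_iff)

lemma emeasure_sphere_measure:
  "A \<in> sets sphere_measure \<Longrightarrow> emeasure sphere_measure A = emeasure ball_measure (sgn -` A)"
  unfolding sets_sphere_measure_iff
  unfolding sphere_measure_def ball_measure_def
  by (subst emeasure_restrict_space) (auto simp: emeasure_distr)

lemma AE_ball_measure_nonzero: "AE x in (ball_measure :: 'a::euclidean_space measure). x \<noteq> 0"
  unfolding ball_measure_def
  by (rule AE_uniform_measureI) (use AE_lborel_singleton[of "0::'a"] in \<open>auto elim!: eventually_mono\<close>)

lemma prob_space_sphere_measure: "prob_space (sphere_measure :: 'a::euclidean_space measure)"
proof
  interpret B: prob_space "ball_measure :: 'a measure" by (rule prob_space_ball_measure)
  have "emeasure (sphere_measure :: 'a measure) (sphere 0 1) = emeasure ball_measure (sgn -` (sphere 0 1) :: 'a set)"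
    by (rule emeasure_sphere_measure) (simp add: sets_sphere_measure_iff)
  \<comment> \<open>As \<open>sgn 0 = 0\<close>, the origin is the only point that the radial
    projection sends off the sphere, and it is a null set.\<close>
  also have "(sgn -` (sphere 0 1) :: 'a set) = {x \<in> space ball_measure. x \<noteq> 0}"
    by (auto simp: norm_sgn)
  also have "emeasure ball_measure \<dots> = 1"
    by (rule B.emeasure_eq_1_AE) (auto simp: AE_ball_measure_nonzero)
  finally show "emeasure (sphere_measure :: 'a measure) (space sphere_measure) = 1" by simp
qed

interpretation sphere: prob_space "sphere_measure :: 'a::euclidean_space measure"
  by (rule prob_space_sphere_measure)

lemma orthogonal_transformation_sphere:
  "orthogonal_transformation R \<Longrightarrow> x \<in> sphere 0 1 \<Longrightarrow> R x \<in> sphere 0 1"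
  by (simp add: orthogonal_transformation_norm)

lemma orthogonal_transformation_sphere_measurable:
  assumes "orthogonal_transformation (R :: 'a::euclidean_space \<Rightarrow> 'a)"
  shows "R \<in> sphere_measure \<rightarrow>\<^sub>M sphere_measure"
proof -
  have "R \<in> restrict_space borel (sphere 0 1) \<rightarrow>\<^sub>M restrict_space borel (sphere 0 1)"
    using orthogonal_transformation_sphere[OF assms] orthogonal_transformation_borel[OF assms]
    by (intro measurable_restrict_space3) auto
  then show ?thesis
    using measurable_cong_sets[OF sets_sphere_measure sets_sphere_measure] by blast
qed

lemma sgn_orthogonal_transformation:
  "orthogonal_transformation R \<Longrightarrow> sgn (R x) = R (sgn x)"
  by (simp add: sgn_div_norm orthogonal_transformation_norm orthogonal_transformation_scaleR)

lemma distr_ball_measure_orthogonal: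
  assumes R: "orthogonal_transformation (R :: 'a::euclidean_space \<Rightarrow> 'a)" and A: "A \<in> sets borel"
  shows "emeasure ball_measure (R -` A) = emeasure ball_measure A"
proof -
  note [measurable] = orthogonal_transformation_borel[OF R] A
  have "R -` A \<in> sets borel" using measurable_sets[OF orthogonal_transformation_borel[OF R] A] by simp
  moreover have "ball 0 1 \<inter> R -` A = R -` (ball 0 1 \<inter> A)"
    by (auto simp: orthogonal_transformation_norm[OF R])
  moreover have "emeasure lborel (R -` (ball 0 1 \<inter> A)) = emeasure (distr lborel borel R) (ball 0 1 \<inter> A)"
    by (subst emeasure_distr) auto
  ultimately show ?thesis
    by (simp add: ball_measure_def emeasure_uniform_measure lborel_distr_orthogonal[OF R])
qed

lemma distr_sphere_measure_orthogonal:
  assumes R: "orthogonal_transformation (R :: 'a::euclidean_space \<Rightarrow> 'a)"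
  shows "distr sphere_measure sphere_measure R = sphere_measure"
proof (rule measure_eqI)
  fix A assume "A \<in> sets (distr sphere_measure sphere_measure R)"
  then have A: "A \<in> sets sphere_measure" by simp
  note M = orthogonal_transformation_sphere_measurable[OF R]
  have "emeasure (distr sphere_measure sphere_measure R) A = emeasure sphere_measure (R -` A \<inter> sphere 0 1)"
    by (simp add: emeasure_distr[OF M A])
  also have "\<dots> = emeasure ball_measure (sgn -` (R -` A \<inter> sphere 0 1))"
    using measurable_sets[OF M A] by (intro emeasure_sphere_measure) simp
  also have "sgn -` (R -` A \<inter> sphere 0 1) = R -` (sgn -` A)"
  proof -
    have "sgn x \<in> sphere 0 1" if "R (sgn x) \<in> A" for x
      using that A orthogonal_transformation_norm[OF R, of "sgn x"]
      by (auto simp: sets_sphere_measure_iff)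
    then show ?thesis by (auto simp: sgn_orthogonal_transformation[OF R])
  qed
  also have "emeasure ball_measure \<dots> = emeasure ball_measure (sgn -` A)"
    using A measurable_sets[OF sgn_borel, of A]
    by (intro distr_ball_measure_orthogonal[OF R]) (simp add: sets_sphere_measure_iff)
  also have "\<dots> = emeasure sphere_measure A"
    by (rule emeasure_sphere_measure[OF A, symmetric])
  finally show "emeasure (distr sphere_measure sphere_measure R) A = emeasure sphere_measure A" .
qed simp

lemma integral_sphere_orthogonal:
  fixes f :: "'a::euclidean_space \<Rightarrow> 'b::{banach, second_countable_topology}"
  assumes "orthogonal_transformation (R :: 'a \<Rightarrow> 'a)" "f \<in> borel_measurable sphere_measure"
  shows "(\<integral>x. f (R x) \<partial>sphere_measure) = (\<integral>x. f x \<partial>sphere_measure)"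
  using integral_distr[OF orthogonal_transformation_sphere_measurable[OF assms(1)] assms(2)]
    distr_sphere_measure_orthogonal[OF assms(1)] by simp

lemma continuous_sphere_measurable:
  fixes f :: "'a::euclidean_space \<Rightarrow> 'b::topological_space"
  shows "continuous_on (sphere 0 1) f \<Longrightarrow> f \<in> borel_measurable sphere_measure"
  using borel_measurable_continuous_on_restrict[of "sphere 0 1" f]
    measurable_cong_sets[OF sets_sphere_measure refl] by blast

lemma continuous_sphere_integrable:
  fixes f :: "'a::euclidean_space \<Rightarrow> 'b::{banach, second_countable_topology}"
  assumes "continuous_on (sphere 0 1) f"
  shows "integrable sphere_measure f"
proof -
  have "bounded (f ` sphere 0 1)"
    by (rule compact_imp_bounded[OF compact_continuous_image[OF assms]]) simp
  then obtain B where "\<forall>x\<in>sphere 0 1. norm (f x) \<le> B"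
    unfolding bounded_iff by auto
  then show ?thesis
    by (intro sphere.integrable_const_bound[of _ B] continuous_sphere_measurable assms AE_I2) auto
qed

text \<open>The cone over the set where f is nonzero is open in the ambient space, and its part in
  the ball is Lebesgue null, hence empty. A point x with f x nonzero would put x / 2 into
  it.\<close>

lemma continuous_sphere_AE_zero:
  fixes f :: "'a::euclidean_space \<Rightarrow> complex"
  assumes f: "continuous_on (sphere 0 1) f" and 0: "AE x in sphere_measure. f x = 0"
    and x: "x \<in> sphere 0 1"
  shows "f x = 0"
proof (rule ccontr)
  assume "f x \<noteq> 0"
  let ?A = "{x \<in> sphere 0 1. f x \<noteq> 0}"
  let ?U = "(- {0}) \<inter> (\<lambda>x. f (sgn x)) -` (- {0})"
  have s: "continuous_on (- {0}) (sgn :: 'a \<Rightarrow> 'a)"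
    unfolding sgn_div_norm by (auto intro!: continuous_intros)
  have c: "continuous_on (- {0}) (\<lambda>x. f (sgn x))"
    by (rule continuous_on_compose2[OF f s]) (auto simp: norm_sgn split: if_splits)
  have U: "open ?U"
    by (rule continuous_open_preimage[OF c]) auto
  have "?A \<in> sets sphere_measure"
    using measurable_sets[OF continuous_sphere_measurable[OF f], of "- {0}"]
    by (simp add: vimage_def Int_def conj_commute)
  moreover have A0: "emeasure sphere_measure ?A = 0"
    using 0 by (subst (asm) AE_iff_measurable[OF calculation]) auto
  ultimately have "emeasure ball_measure (sgn -` ?A) = 0"
    by (simp add: emeasure_sphere_measure)
  moreover have "?U = sgn -` ?A" by (auto simp: norm_sgn)
  ultimately have "emeasure ball_measure ?U = 0" by simp
  then have "emeasure lborel (ball 0 1 \<inter> ?U) = 0"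
    using U ball_lborel by (auto simp: ball_measure_def emeasure_uniform_measure ennreal_divide_eq_0_iff)
  then have "ball 0 1 \<inter> ?U \<in> null_sets lborel"
    using U by (intro null_setsI) auto
  then have "negligible (ball 0 1 \<inter> ?U)"
    using null_sets_completionI negligible_iff_null_sets by blast
  then have "ball 0 1 \<inter> ?U = {}"
    using open_not_negligible U by (metis open_Int open_ball)
  moreover have "(1/2) *\<^sub>R x \<in> ball 0 1 \<inter> ?U"
    using x \<open>f x \<noteq> 0\<close> by (auto simp: sgn_div_norm)
  ultimately show False by blast
qed

lemma continuous_sphere_integral_zero:
  fixes f :: "'a::euclidean_space \<Rightarrow> complex"
  assumes f: "continuous_on (sphere 0 1) f" and 0: "(\<integral>x. (cmod (f x))\<^sup>2 \<partial>sphere_measure) = 0"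
    and x: "x \<in> sphere 0 1"
  shows "f x = 0"
proof (rule continuous_sphere_AE_zero[OF f _ x])
  have "integrable sphere_measure (\<lambda>x. (cmod (f x))\<^sup>2)"
    by (intro continuous_sphere_integrable continuous_intros f)
  from integral_nonneg_eq_0_iff_AE[OF this] 0 show "AE x in sphere_measure. f x = 0" by simp
qed

subsection \<open>Square integrable functions\<close>

text \<open>Stated for an arbitrary measure and without conjugation, because it serves both the
  inner product on the sphere and the convolution integral over the group.\<close>

lemma cauchy_schwarz_integral:
  fixes f g :: "'x \<Rightarrow> complex"
  assumes f: "f \<in> borel_measurable M" "integrable M (\<lambda>x. (cmod (f x))\<^sup>2)"
    and g: "g \<in> borel_measurable M" "integrable M (\<lambda>x. (cmod (g x))\<^sup>2)"
  shows "integrable M (\<lambda>x. f x * g x)"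
    "cmod (\<integral>x. f x * g x \<partial>M) \<le> sqrt (\<integral>x. (cmod (f x))\<^sup>2 \<partial>M) * sqrt (\<integral>x. (cmod (g x))\<^sup>2 \<partial>M)"
proof -
  note [measurable] = f(1) g(1)
  show int: "integrable M (\<lambda>x. f x * g x)"
  proof (rule Bochner_Integration.integrable_bound)
    show "integrable M (\<lambda>x. (cmod (f x))\<^sup>2 + (cmod (g x))\<^sup>2)" using f g by simp
    have "a * b \<le> a\<^sup>2 + b\<^sup>2" for a b :: real
      using sum_squares_bound[of a b] sum_power2_ge_zero[of a b] by linarith
    then show "AE x in M. norm (f x * g x) \<le> norm ((cmod (f x))\<^sup>2 + (cmod (g x))\<^sup>2)"
      by (intro AE_I2) (simp add: norm_mult)
  qed simp
  then have int': "integrable M (\<lambda>x. cmod (f x) * cmod (g x))"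
    using integrable_norm[OF int] by (simp add: norm_mult)
  let ?I = "\<integral>x. cmod (f x) * cmod (g x) \<partial>M"
  have "ennreal (?I\<^sup>2) = (ennreal ?I)\<^sup>2"
    by (simp add: ennreal_power)
  also have "ennreal ?I = (\<integral>\<^sup>+x. ennreal (cmod (f x)) * ennreal (cmod (g x)) \<partial>M)"
    by (subst nn_integral_eq_integral[OF int', symmetric]) (auto simp: ennreal_mult)
  also have "\<dots>\<^sup>2 \<le> (\<integral>\<^sup>+x. (ennreal (cmod (f x)))\<^sup>2 \<partial>M) * (\<integral>\<^sup>+x. (ennreal (cmod (g x)))\<^sup>2 \<partial>M)"
    by (rule Cauchy_Schwarz_nn_integral) auto
  also have "\<dots> = ennreal ((\<integral>x. (cmod (f x))\<^sup>2 \<partial>M) * (\<integral>x. (cmod (g x))\<^sup>2 \<partial>M))"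
    using f g by (simp add: ennreal_power nn_integral_eq_integral ennreal_mult)
  finally have "?I\<^sup>2 \<le> (\<integral>x. (cmod (f x))\<^sup>2 \<partial>M) * (\<integral>x. (cmod (g x))\<^sup>2 \<partial>M)"
    by (simp add: mult_nonneg_nonneg)
  then have "?I \<le> sqrt (\<integral>x. (cmod (f x))\<^sup>2 \<partial>M) * sqrt (\<integral>x. (cmod (g x))\<^sup>2 \<partial>M)"
    unfolding real_sqrt_mult[symmetric] by (rule real_le_rsqrt)
  moreover have "cmod (\<integral>x. f x * g x \<partial>M) \<le> ?I"
    using integral_norm_bound[of M "\<lambda>x. f x * g x"] by (simp add: norm_mult)
  ultimately show "cmod (\<integral>x. f x * g x \<partial>M) \<le> sqrt (\<integral>x. (cmod (f x))\<^sup>2 \<partial>M) * sqrt (\<integral>x. (cmod (g x))\<^sup>2 \<partial>M)"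
    by linarith
qed

lemma cmod_add_sq_le: "(cmod (a + b))\<^sup>2 \<le> 2 * (cmod a)\<^sup>2 + 2 * (cmod b)\<^sup>2"
proof -
  have "(cmod (a + b))\<^sup>2 \<le> (cmod a + cmod b)\<^sup>2"
    by (intro power_mono norm_triangle_ineq) simp
  also have "\<dots> \<le> 2 * (cmod a)\<^sup>2 + 2 * (cmod b)\<^sup>2"
    using sum_squares_bound[of "cmod a" "cmod b"] by (simp add: power2_sum)
  finally show ?thesis .
qed

lemma sphere_L2_add:
  assumes "f \<in> sphere_L2" "g \<in> sphere_L2" shows "(\<lambda>x. f x + g x) \<in> sphere_L2"
proof -
  have [measurable]: "f \<in> borel_measurable sphere_measure" "g \<in> borel_measurable sphere_measure"
    using assms by (auto simp: sphere_L2_def)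
  have "integrable sphere_measure (\<lambda>x. (cmod (f x + g x))\<^sup>2)"
  proof (rule Bochner_Integration.integrable_bound)
    show "integrable sphere_measure (\<lambda>x. 2 * (cmod (f x))\<^sup>2 + 2 * (cmod (g x))\<^sup>2)"
      using assms by (auto simp: sphere_L2_def)
    show "AE x in sphere_measure. norm ((cmod (f x + g x))\<^sup>2) \<le> norm (2 * (cmod (f x))\<^sup>2 + 2 * (cmod (g x))\<^sup>2)"
      using cmod_add_sq_le by (intro AE_I2) auto
  qed simp
  then show ?thesis by (simp add: sphere_L2_def)
qed

lemma sphere_L2_cmult: "f \<in> sphere_L2 \<Longrightarrow> (\<lambda>x. c * f x) \<in> sphere_L2"
  unfolding sphere_L2_def by (auto simp: norm_mult power_mult_distrib)

lemma sphere_L2_diff: "f \<in> sphere_L2 \<Longrightarrow> g \<in> sphere_L2 \<Longrightarrow> (\<lambda>x. f x - g x) \<in> sphere_L2"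
  using sphere_L2_add[of f "\<lambda>x. (-1) * g x"] sphere_L2_cmult[of g "-1"] by simp

lemma sphere_L2_zero: "(\<lambda>x. 0) \<in> sphere_L2"
  by (simp add: sphere_L2_def)

lemma sphere_L2_sum: "(\<And>i. i \<in> A \<Longrightarrow> f i \<in> sphere_L2) \<Longrightarrow> (\<lambda>x. \<Sum>i\<in>A. f i x) \<in> sphere_L2"
  by (induction A rule: infinite_finite_induct) (auto intro: sphere_L2_zero sphere_L2_add)

lemma sphere_L2_continuous:
  assumes "continuous_on (sphere 0 1) f" shows "f \<in> sphere_L2"
  unfolding sphere_L2_def
  using assms by (auto intro!: continuous_sphere_measurable continuous_sphere_integrable continuous_intros)

lemma borel_measurable_cnj [measurable]: "cnj \<in> borel_measurable borel"
  by (intro borel_measurable_continuous_onI continuous_intros)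

lemma sphere_L2_cnj: "f \<in> sphere_L2 \<Longrightarrow> (\<lambda>x. cnj (f x)) \<in> sphere_L2"
  unfolding sphere_L2_def by auto

lemma sphere_L2_inner_integrable:
  "f \<in> sphere_L2 \<Longrightarrow> g \<in> sphere_L2 \<Longrightarrow> integrable sphere_measure (\<lambda>x. f x * cnj (g x))"
  using sphere_L2_cnj[of g] unfolding sphere_L2_def by (intro cauchy_schwarz_integral) auto

lemma L2_inner_cauchy_schwarz:
  "f \<in> sphere_L2 \<Longrightarrow> g \<in> sphere_L2 \<Longrightarrow> cmod (L2_inner f g) \<le> L2_norm f * L2_norm g"
  using cauchy_schwarz_integral(2)[of f sphere_measure "\<lambda>x. cnj (g x)"] sphere_L2_cnj[of g]
  unfolding sphere_L2_def L2_inner_def L2_norm_def by simp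

lemma L2_norm_nonneg: "0 \<le> L2_norm f"
  by (simp add: L2_norm_def)

lemma L2_norm_sq: "(L2_norm f)\<^sup>2 = (\<integral>x. (cmod (f x))\<^sup>2 \<partial>sphere_measure)"
  by (simp add: L2_norm_def)

lemma L2_inner_self: "L2_inner f f = of_real ((L2_norm f)\<^sup>2)"
  by (simp add: L2_inner_def L2_norm_sq flip: complex_norm_square of_real_power)

lemma L2_inner_add_left:
  "f \<in> sphere_L2 \<Longrightarrow> g \<in> sphere_L2 \<Longrightarrow> q \<in> sphere_L2 \<Longrightarrow>
    L2_inner (\<lambda>x. f x + g x) q = L2_inner f q + L2_inner g q"
  unfolding L2_inner_def
  by (simp add: distrib_right sphere_L2_inner_integrable)

lemma L2_inner_diff_left:
  "f \<in> sphere_L2 \<Longrightarrow> g \<in> sphere_L2 \<Longrightarrow> q \<in> sphere_L2 \<Longrightarrow>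
    L2_inner (\<lambda>x. f x - g x) q = L2_inner f q - L2_inner g q"
  unfolding L2_inner_def
  by (simp add: left_diff_distrib sphere_L2_inner_integrable)

lemma L2_inner_cmult_left: "L2_inner (\<lambda>x. c * f x) q = c * L2_inner f q"
  unfolding L2_inner_def by (simp add: mult.assoc)

lemma L2_inner_sum_left:
  "(\<And>i. i \<in> A \<Longrightarrow> f i \<in> sphere_L2) \<Longrightarrow> q \<in> sphere_L2 \<Longrightarrow>
    L2_inner (\<lambda>x. \<Sum>i\<in>A. f i x) q = (\<Sum>i\<in>A. L2_inner (f i) q)"
  unfolding L2_inner_def
  by (simp add: sum_distrib_right sphere_L2_inner_integrable)

lemma L2_inner_cnj: "L2_inner g f = cnj (L2_inner f g)"
  unfolding L2_inner_def by (subst Bochner_Integration.integral_cnj[symmetric]) (simp add: mult.commute)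

lemma L2_inner_cong:
  "(\<And>x. x \<in> sphere 0 1 \<Longrightarrow> f x = f' x) \<Longrightarrow> (\<And>x. x \<in> sphere 0 1 \<Longrightarrow> g x = g' x) \<Longrightarrow>
    L2_inner f g = L2_inner f' g'"
  unfolding L2_inner_def by (intro Bochner_Integration.integral_cong) auto

lemma L2_norm_cong:
  "(\<And>x. x \<in> sphere 0 1 \<Longrightarrow> f x = f' x) \<Longrightarrow> L2_norm f = L2_norm f'"
  unfolding L2_norm_def by (intro arg_cong[where f = sqrt] Bochner_Integration.integral_cong) auto

lemma sphere_L2_cong:
  assumes "\<And>x. x \<in> sphere 0 1 \<Longrightarrow> f x = f' x"
  shows "f \<in> sphere_L2 \<longleftrightarrow> f' \<in> sphere_L2"
proof -
  have "f \<in> borel_measurable sphere_measure \<longleftrightarrow> f' \<in> borel_measurable sphere_measure"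
    by (rule measurable_cong) (simp add: assms)
  moreover have "integrable sphere_measure (\<lambda>x. (cmod (f x))\<^sup>2) \<longleftrightarrow> integrable sphere_measure (\<lambda>x. (cmod (f' x))\<^sup>2)"
    by (rule Bochner_Integration.integrable_cong) (auto simp: assms)
  ultimately show ?thesis by (simp add: sphere_L2_def)
qed

lemma L2_norm_sq_add_orthogonal:
  assumes "f \<in> sphere_L2" "g \<in> sphere_L2" "L2_inner f g = 0"
  shows "(L2_norm (\<lambda>x. f x + g x))\<^sup>2 = (L2_norm f)\<^sup>2 + (L2_norm g)\<^sup>2"
proof -
  have s: "(\<lambda>x. f x + g x) \<in> sphere_L2" using assms by (intro sphere_L2_add)
  have "L2_inner q (\<lambda>x. f x + g x) = L2_inner q f + L2_inner q g" if "q \<in> sphere_L2" for q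
    using L2_inner_add_left[OF assms(1,2) that]
    by (subst (1 2 3) L2_inner_cnj) simp
  moreover have "L2_inner g f = 0" using assms(3) L2_inner_cnj[of g f] by simp
  ultimately have "L2_inner (\<lambda>x. f x + g x) (\<lambda>x. f x + g x) = L2_inner f f + L2_inner g g"
    using assms s by (simp add: L2_inner_add_left)
  then show ?thesis unfolding L2_inner_self by (metis of_real_add of_real_eq_iff)
qed

subsection \<open>Density of polynomials\<close>

text \<open>The squared norm is what dominated convergence delivers, and it replaces the triangle
  inequality by \<open>L2_norm_sq_add_le\<close>; this is the source of the quarters of \<epsilon>
  below.\<close>

definition approximable :: "('a::euclidean_space \<Rightarrow> complex) \<Rightarrow> bool"
  where "approximable f \<longleftrightarrow> f \<in> sphere_L2 \<and>
    (\<forall>\<epsilon>>0. \<exists>g. continuous_on (sphere 0 1) g \<and> (L2_norm (\<lambda>x. f x - g x))\<^sup>2 < \<epsilon>)"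

lemma sphere_L2_D:
  "f \<in> sphere_L2 \<Longrightarrow> f \<in> borel_measurable sphere_measure"
  "f \<in> sphere_L2 \<Longrightarrow> integrable sphere_measure (\<lambda>x. (cmod (f x))\<^sup>2)"
  by (auto simp: sphere_L2_def)

lemma L2_norm_sq_add_le:
  assumes "f \<in> sphere_L2" "g \<in> sphere_L2"
  shows "(L2_norm (\<lambda>x. f x + g x))\<^sup>2 \<le> 2 * (L2_norm f)\<^sup>2 + 2 * (L2_norm g)\<^sup>2"
proof -
  note i = assms[THEN sphere_L2_D(2)] sphere_L2_D(2)[OF sphere_L2_add[OF assms]]
  have "(\<integral>x. (cmod (f x + g x))\<^sup>2 \<partial>sphere_measure) \<le> (\<integral>x. 2 * (cmod (f x))\<^sup>2 + 2 * (cmod (g x))\<^sup>2 \<partial>sphere_measure)"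
    using i by (intro integral_mono cmod_add_sq_le) auto
  then show ?thesis using i by (simp add: L2_norm_sq)
qed

lemma approximable_continuous:
  assumes "continuous_on (sphere 0 1) f" shows "approximable f"
  unfolding approximable_def using assms
  by (auto intro!: sphere_L2_continuous exI[of _ f] simp: L2_norm_def)

lemma approximable_limit:
  assumes f: "f \<in> sphere_L2"
    and h: "\<And>\<epsilon>. \<epsilon> > 0 \<Longrightarrow> \<exists>h. approximable h \<and> (L2_norm (\<lambda>x. f x - h x))\<^sup>2 < \<epsilon>"
  shows "approximable f"
  unfolding approximable_def
proof (intro conjI f allI impI)
  fix \<epsilon> :: real assume "\<epsilon> > 0"
  then obtain h where h: "approximable h" "(L2_norm (\<lambda>x. f x - h x))\<^sup>2 < \<epsilon> / 4"
    using h[of "\<epsilon> / 4"] by auto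
  have "\<epsilon> / 4 > 0" using \<open>\<epsilon> > 0\<close> by simp
  with h(1) obtain g where g: "continuous_on (sphere 0 1) g" "(L2_norm (\<lambda>x. h x - g x))\<^sup>2 < \<epsilon> / 4"
    unfolding approximable_def by meson
  have "(\<lambda>x. f x - h x) \<in> sphere_L2" "(\<lambda>x. h x - g x) \<in> sphere_L2"
    using f h g by (auto simp: approximable_def intro: sphere_L2_diff sphere_L2_continuous)
  from L2_norm_sq_add_le[OF this] g(2) h(2) have "(L2_norm (\<lambda>x. f x - g x))\<^sup>2 < \<epsilon>" by simp
  with g(1) show "\<exists>g. continuous_on (sphere 0 1) g \<and> (L2_norm (\<lambda>x. f x - g x))\<^sup>2 < \<epsilon>" by blast
qed

lemma approximable_add:
  assumes "approximable f" "approximable g" shows "approximable (\<lambda>x. f x + g x)"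
  unfolding approximable_def
proof (intro conjI allI impI)
  show "(\<lambda>x. f x + g x) \<in> sphere_L2" using assms by (auto simp: approximable_def intro: sphere_L2_add)
  fix \<epsilon> :: real assume "\<epsilon> > 0"
  then have "\<epsilon> / 4 > 0" by simp
  with assms obtain u v where u: "continuous_on (sphere 0 1) u" "(L2_norm (\<lambda>x. f x - u x))\<^sup>2 < \<epsilon> / 4"
    and v: "continuous_on (sphere 0 1) v" "(L2_norm (\<lambda>x. g x - v x))\<^sup>2 < \<epsilon> / 4"
    unfolding approximable_def by meson
  have "(\<lambda>x. f x - u x) \<in> sphere_L2" "(\<lambda>x. g x - v x) \<in> sphere_L2"
    using assms u v by (auto simp: approximable_def intro: sphere_L2_diff sphere_L2_continuous)
  from L2_norm_sq_add_le[OF this] u(2) v(2)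
  have "(L2_norm (\<lambda>x. (f x + g x) - (u x + v x)))\<^sup>2 < \<epsilon>" by (simp add: algebra_simps)
  moreover have "continuous_on (sphere 0 1) (\<lambda>x. u x + v x)" using u v by (intro continuous_intros)
  ultimately show "\<exists>h. continuous_on (sphere 0 1) h \<and> (L2_norm (\<lambda>x. (f x + g x) - h x))\<^sup>2 < \<epsilon>" by blast
qed

lemma L2_norm_sq_cmult: "(L2_norm (\<lambda>x. c * f x))\<^sup>2 = (cmod c)\<^sup>2 * (L2_norm f)\<^sup>2"
  by (simp add: L2_norm_sq norm_mult power_mult_distrib)

lemma approximable_cmult:
  assumes "approximable f" shows "approximable (\<lambda>x. c * f x)"
  unfolding approximable_def
proof (intro conjI allI impI)
  show "(\<lambda>x. c * f x) \<in> sphere_L2" using assms by (auto simp: approximable_def intro: sphere_L2_cmult)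
  fix \<epsilon> :: real assume "\<epsilon> > 0"
  then have "\<epsilon> / ((cmod c)\<^sup>2 + 1) > 0" by (simp add: add_nonneg_pos)
  with assms obtain u where u: "continuous_on (sphere 0 1) u" "(L2_norm (\<lambda>x. f x - u x))\<^sup>2 < \<epsilon> / ((cmod c)\<^sup>2 + 1)"
    unfolding approximable_def by meson
  have "(L2_norm (\<lambda>x. c * f x - c * u x))\<^sup>2 = (cmod c)\<^sup>2 * (L2_norm (\<lambda>x. f x - u x))\<^sup>2"
    using L2_norm_sq_cmult[of c "\<lambda>x. f x - u x"] by (simp add: right_diff_distrib)
  also have "\<dots> \<le> ((cmod c)\<^sup>2 + 1) * (L2_norm (\<lambda>x. f x - u x))\<^sup>2"
    by (intro mult_right_mono) auto
  also have "\<dots> < \<epsilon>"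
    using u(2) by (simp add: pos_less_divide_eq add_nonneg_pos mult.commute)
  finally show "\<exists>h. continuous_on (sphere 0 1) h \<and> (L2_norm (\<lambda>x. c * f x - h x))\<^sup>2 < \<epsilon>"
    using u(1) by (intro exI[of _ "\<lambda>x. c * u x"]) (auto intro: continuous_intros)
qed

lemma approximable_zero: "approximable (\<lambda>x. 0)"
  by (intro approximable_continuous continuous_intros)

lemma approximable_sum:
  "(\<And>i. i \<in> A \<Longrightarrow> approximable (f i)) \<Longrightarrow> approximable (\<lambda>x. \<Sum>i\<in>A. f i x)"
  by (induction A rule: infinite_finite_induct) (auto intro: approximable_add approximable_zero)

text \<open>The common core of the passages to closed sets, to disjoint unions and to limits of
  simple functions: each is a pointwise limit whose squared error has an integrable
  majorant.\<close>

lemma approximable_dominated: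
  assumes f: "f \<in> sphere_L2" and F: "\<And>n::nat. approximable (F n)"
    and w: "integrable sphere_measure w" "\<And>n x. x \<in> sphere 0 1 \<Longrightarrow> (cmod (f x - F n x))\<^sup>2 \<le> w x"
    and lim: "\<And>x. x \<in> sphere 0 1 \<Longrightarrow> (\<lambda>n. F n x) \<longlonglongrightarrow> f x"
  shows "approximable f"
proof (rule approximable_limit[OF f])
  fix \<epsilon> :: real assume "\<epsilon> > 0"
  have [measurable]: "f \<in> borel_measurable sphere_measure" "F n \<in> borel_measurable sphere_measure" for n
    using f F by (auto simp: approximable_def sphere_L2_def)
  have "(\<lambda>n. \<integral>x. (cmod (f x - F n x))\<^sup>2 \<partial>sphere_measure) \<longlonglongrightarrow> (\<integral>x. 0 \<partial>(sphere_measure :: 'a measure))"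
  proof (rule integral_dominated_convergence[OF _ _ w(1)])
    show "AE x in sphere_measure. (\<lambda>n. (cmod (f x - F n x))\<^sup>2) \<longlonglongrightarrow> 0"
    proof (rule AE_I2)
      fix x :: 'a assume "x \<in> space sphere_measure"
      then have "(\<lambda>n. F n x) \<longlonglongrightarrow> f x" by (intro lim) simp
      then have "(\<lambda>n. (cmod (f x - F n x))\<^sup>2) \<longlonglongrightarrow> (cmod (f x - f x))\<^sup>2"
        by (intro tendsto_power tendsto_norm tendsto_diff tendsto_const)
      then show "(\<lambda>n. (cmod (f x - F n x))\<^sup>2) \<longlonglongrightarrow> 0" by simp
    qed
    show "AE x in sphere_measure. norm ((cmod (f x - F n x))\<^sup>2) \<le> w x" for n
      using w(2) by (intro AE_I2) simp
  qed auto
  then have "(\<lambda>n. (L2_norm (\<lambda>x. f x - F n x))\<^sup>2) \<longlonglongrightarrow> 0" by (simp add: L2_norm_sq)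
  from eventually_happens'[OF sequentially_bot order_tendstoD(2)[OF this \<open>\<epsilon> > 0\<close>]]
  obtain n where "(L2_norm (\<lambda>x. f x - F n x))\<^sup>2 < \<epsilon>"
    by blast
  with F show "\<exists>h. approximable h \<and> (L2_norm (\<lambda>x. f x - h x))\<^sup>2 < \<epsilon>" by blast
qed

lemma sphere_L2_indicator:
  assumes "A \<in> sets borel"
  shows "(indicator A :: 'a::euclidean_space \<Rightarrow> complex) \<in> sphere_L2"
proof -
  have [measurable]: "A \<in> sets borel" by fact
  have "(indicator A :: 'a \<Rightarrow> complex) \<in> borel_measurable sphere_measure"
    using measurable_cong_sets[OF sets_sphere_measure refl, of "borel :: complex measure"]
    by (auto intro!: measurable_restrict_space1)
  moreover have "integrable (sphere_measure :: 'a measure) (\<lambda>x. (cmod (indicator A x))\<^sup>2)"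
  proof (rule sphere.integrable_const_bound[of _ 1])
    show "AE x in sphere_measure. norm ((cmod (indicator A x))\<^sup>2) \<le> 1"
      by (intro AE_I2) (simp add: indicator_def)
  qed (use calculation in measurable)
  ultimately show ?thesis by (simp add: sphere_L2_def)
qed

lemma approximable_indicator_closed:
  assumes A: "closed (A :: 'a::euclidean_space set)"
  shows "approximable (indicator A)"
proof (cases "A = {}")
  \<comment> \<open>The distance \<open>infdist\<close> to the empty set is 0 by convention, so the
    approximants used below would be constantly 1.\<close>
  case True
  have "(indicator {} :: 'a \<Rightarrow> complex) = (\<lambda>x. 0)" by (simp add: fun_eq_iff)
  then show ?thesis using True approximable_zero by metis
next
  case False
  \<comment> \<open>Continuous cut-offs: equal to 1 on A and eventually 0 at any point off A, which
    has positive distance from the closed set.\<close>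
  define F where "F n x = complex_of_real (max 0 (1 - real n * infdist x A))" for n x
  show ?thesis
  proof (rule approximable_dominated[where F = F and w = "\<lambda>x. 1"])
    show "indicator A \<in> sphere_L2" using A by (intro sphere_L2_indicator) auto
    show "approximable (F n)" for n
      unfolding F_def by (intro approximable_continuous continuous_intros continuous_on_infdist)
    fix x :: 'a
    show "(cmod (indicator A x - F n x))\<^sup>2 \<le> 1" for n
    proof -
      have "0 \<le> real n * infdist x A" by (simp add: infdist_nonneg)
      then have "\<bar>indicator A x - max 0 (1 - real n * infdist x A)\<bar> \<le> 1"
        by (auto simp: indicator_def)
      moreover have "indicator A x - F n x = of_real (indicator A x - max 0 (1 - real n * infdist x A))"
        by (auto simp: F_def indicator_def)
      ultimately show ?thesis by (simp only: norm_of_real power2_abs abs_square_le_1)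
    qed
    show "(\<lambda>n. F n x) \<longlonglongrightarrow> indicator A x"
    proof (cases "x \<in> A")
      case True
      then show ?thesis by (simp add: F_def)
    next
      case False
      then have pos: "infdist x A > 0"
        using in_closed_iff_infdist_zero[OF A \<open>A \<noteq> {}\<close>] infdist_nonneg[of x A] by (metis order_le_less)
      obtain N :: nat where N: "1 / infdist x A < real N" using reals_Archimedean2 by blast
      have "F n x = 0" if "n \<ge> N" for n
      proof -
        have "1 / infdist x A < real n" using N that by (meson less_le_trans of_nat_le_iff)
        then have "1 < real n * infdist x A" using pos by (simp add: pos_divide_less_eq)
        then show ?thesis by (simp add: F_def)
      qed
      then have "\<forall>\<^sub>F n in sequentially. F n x = 0" by (auto simp: eventually_sequentially)
      then show ?thesis using False by (simp add: tendsto_eventually)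
    qed
  qed auto
qed

text \<open>Closed sets form a generator stable under intersection, so Dynkin induction applies, and
  complements and disjoint unions are all that remain.\<close>

lemma approximable_indicator:
  assumes "A \<in> sets borel"
  shows "approximable (indicator A :: 'a::euclidean_space \<Rightarrow> complex)"
proof -
  have A: "A \<in> sigma_sets UNIV (Collect closed)"
    using assms by (simp add: borel_eq_closed)
  show ?thesis
  proof (rule sigma_sets_induct_disjoint[of "Collect closed" UNIV A "\<lambda>A. approximable (indicator A :: 'a \<Rightarrow> complex)"])
    show "Int_stable (Collect closed :: 'a set set)" "Collect closed \<subseteq> Pow (UNIV :: 'a set)" "A \<in> sigma_sets UNIV (Collect closed)"
      using A by (auto simp: Int_stable_def)
  next
    fix A :: "'a set" assume "A \<in> Collect closed"
    then show "approximable (indicator A)" by (simp add: approximable_indicator_closed)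
  next
    show "approximable (indicator {})" using approximable_indicator_closed[of "{}"] by simp
  next
    fix A :: "'a set" assume 5: "approximable (indicator A)"
    have "approximable (\<lambda>x. 1 + (-1) * indicator A x)"
      by (intro approximable_add approximable_cmult 5 approximable_continuous continuous_intros)
    moreover have "(\<lambda>x. 1 + (-1) * indicator A x) = (indicator (UNIV - A) :: 'a \<Rightarrow> complex)"
      by (auto simp: indicator_def fun_eq_iff)
    ultimately show "approximable (indicator (UNIV - A))" by simp
  next
    fix A :: "nat \<Rightarrow> 'a set"
    assume 6: "disjoint_family A" "range A \<subseteq> sigma_sets UNIV (Collect closed)" "\<And>i. approximable (indicator (A i))"
    have A: "A i \<in> sets borel" for i using 6(2) by (auto simp: borel_eq_closed)
    define F where "F n x = (\<Sum>i<n. indicator (A i) x :: complex)" for n x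
    have F: "F n x = indicator (\<Union>i<n. A i) x" for n x
      unfolding F_def using 6(1)
      by (subst indicator_UN_disjoint) (auto simp: disjoint_family_on_def)
    show "approximable (indicator (\<Union>(range A)))"
    proof (rule approximable_dominated[where F = F and w = "\<lambda>x. 1"])
      show "indicator (\<Union>(range A)) \<in> sphere_L2" using A by (intro sphere_L2_indicator) auto
      show "approximable (F n)" for n unfolding F_def by (intro approximable_sum 6(3))
      fix x :: 'a
      show "(cmod (indicator (\<Union>(range A)) x - F n x))\<^sup>2 \<le> 1" for n
        unfolding F by (auto simp: indicator_def)
      show "(\<lambda>n. F n x) \<longlonglongrightarrow> indicator (\<Union>(range A)) x"
        unfolding F by (rule LIMSEQ_indicator_UN)
    qed auto
  qed
qed

lemma approximable_simple_function:
  assumes "simple_function sphere_measure (f :: 'a::euclidean_space \<Rightarrow> complex)"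
  shows "approximable f"
proof -
  let ?A = "\<lambda>y. f -` {y} \<inter> sphere 0 1"
  have fin: "finite (f ` sphere 0 1)" and A: "?A y \<in> sets borel" for y
  proof -
    show "finite (f ` sphere 0 1)" using simple_functionD(1)[OF assms] by simp
    show "?A y \<in> sets borel"
      using simple_functionD(2)[OF assms, of "{y}"] by (simp add: sets_sphere_measure_iff)
  qed
  have g: "approximable (\<lambda>x. \<Sum>y\<in>f ` sphere 0 1. y * indicator (?A y) x)"
    by (intro approximable_sum approximable_cmult approximable_indicator A)
  have eq: "f x = (\<Sum>y\<in>f ` sphere 0 1. y * indicator (?A y) x)" if "x \<in> sphere 0 1" for x
  proof -
    have "(\<Sum>y\<in>f ` sphere 0 1. y * indicator (?A y) x) = (\<Sum>y\<in>f ` sphere 0 1. if y = f x then y else 0)"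
      using that by (intro sum.cong) (auto simp: indicator_def)
    also have "\<dots> = f x" using that fin by (subst sum.delta) auto
    finally show ?thesis by simp
  qed
  show ?thesis
  proof (rule approximable_limit)
    show "f \<in> sphere_L2"
      using g sphere_L2_cong[of f "\<lambda>x. \<Sum>y\<in>f ` sphere 0 1. y * indicator (?A y) x"] eq
      unfolding approximable_def by blast
    have "L2_norm (\<lambda>x. f x - (\<Sum>y\<in>f ` sphere 0 1. y * indicator (?A y) x)) = L2_norm (\<lambda>x::'a. 0)"
      by (rule L2_norm_cong) (metis eq diff_self)
    then show "\<exists>h. approximable h \<and> (L2_norm (\<lambda>x. f x - h x))\<^sup>2 < \<epsilon>" if "\<epsilon> > 0" for \<epsilon>
      using g that by (intro exI[of _ "\<lambda>x. \<Sum>y\<in>f ` sphere 0 1. y * indicator (?A y) x"]) (simp add: L2_norm_def)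
  qed
qed

lemma sphere_L2_approximable:
  assumes "f \<in> sphere_L2" shows "approximable f"
proof -
  obtain F where F: "\<And>i. simple_function sphere_measure (F i)"
    "\<And>x. x \<in> sphere 0 1 \<Longrightarrow> (\<lambda>i. F i x) \<longlonglongrightarrow> f x"
    "\<And>i x. x \<in> sphere 0 1 \<Longrightarrow> dist (F i x) 0 \<le> 2 * dist (f x) 0"
    using borel_measurable_implies_sequence_metric[OF sphere_L2_D(1)[OF assms], of 0]
    unfolding space_sphere_measure by metis
  show ?thesis
  proof (rule approximable_dominated[OF assms])
    show "approximable (F n)" for n using F(1) by (rule approximable_simple_function)
    \<comment> \<open>The simple functions satisfy |F n x| \<le> 2 |f x|, so the error is at most 3
      |f x|.\<close>
    show "integrable sphere_measure (\<lambda>x. 9 * (cmod (f x))\<^sup>2)" using sphere_L2_D(2)[OF assms] by simp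
    show "(cmod (f x - F n x))\<^sup>2 \<le> 9 * (cmod (f x))\<^sup>2" if "x \<in> sphere 0 1" for n x
    proof -
      have "cmod (f x - F n x) \<le> 3 * cmod (f x)"
        using F(3)[OF that, of n] norm_triangle_ineq4[of "f x" "F n x"] by simp
      from power_mono[OF this, of 2] show ?thesis by (simp add: power_mult_distrib)
    qed
  qed (rule F(2))
qed

section \<open>Stone-Weierstrass on the sphere\<close>

inductive cpoly :: "('a::euclidean_space \<Rightarrow> complex) \<Rightarrow> bool" where
  cpoly_hpoly: "hpoly k p \<Longrightarrow> cpoly p"
| cpoly_add: "cpoly p \<Longrightarrow> cpoly q \<Longrightarrow> cpoly (\<lambda>x. p x + q x)"

lemma cpoly_mult:
  assumes "cpoly p" "cpoly q" shows "cpoly (\<lambda>x. p x * q x)"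
  using assms(1)
proof (induction rule: cpoly.induct)
  case (cpoly_hpoly k p)
  show ?case using assms(2)
  proof (induction rule: cpoly.induct)
    case (cpoly_hpoly l q)
    with \<open>hpoly k p\<close> show ?case by (blast intro: cpoly.cpoly_hpoly hpoly_mult)
  next
    case (cpoly_add q r)
    from cpoly.cpoly_add[OF cpoly_add(3,4)] show ?case by (simp add: distrib_left)
  qed
next
  case (cpoly_add p r)
  from cpoly.cpoly_add[OF cpoly_add(3,4)] show ?case by (simp add: distrib_right)
qed

lemma cpoly_continuous: "cpoly p \<Longrightarrow> continuous_on S p"
proof (induction rule: cpoly.induct)
  case (cpoly_hpoly k p)
  then show ?case by (rule hpoly_continuous)
next
  case (cpoly_add p q)
  show ?case by (rule continuous_on_add[OF cpoly_add(3,4)])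
qed

text \<open>The theorem of Stone and Weierstrass concerns real functions, so the algebra consists of
  the real g whose complex version is a polynomial. The coordinates separate points.\<close>

lemma cpoly_dense_real:
  fixes f :: "'a::euclidean_space \<Rightarrow> real"
  assumes "continuous_on (sphere 0 1) f" "\<epsilon> > 0"
  shows "\<exists>g. cpoly (\<lambda>x. of_real (g x)) \<and> (\<forall>x\<in>sphere 0 1. \<bar>f x - g x\<bar> < \<epsilon>)"
proof (rule Stone_Weierstrass_HOL[where P = "\<lambda>g. cpoly (\<lambda>x. of_real (g x))", OF _ _ _ _ _ _ assms])
  fix c :: real show "cpoly (\<lambda>x. of_real c)" by (rule cpoly_hpoly[OF hpoly_const])
next
  fix g :: "'a \<Rightarrow> real" assume "cpoly (\<lambda>x. of_real (g x))"
  from continuous_on_Re[OF cpoly_continuous[OF this]] show "continuous_on (sphere 0 1) g" by simp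
next
  fix x y :: 'a assume "x \<in> sphere 0 1 \<and> y \<in> sphere 0 1 \<and> x \<noteq> y"
  then obtain b where b: "b \<in> Basis" "x \<bullet> b \<noteq> y \<bullet> b" using euclidean_eqI by metis
  have "cpoly (\<lambda>x. complex_of_real (x \<bullet> b))"
    using cpoly_hpoly[OF hpoly_coord[OF hpoly_const[of 1] b(1)]] by simp
  with b(2) show "\<exists>f. cpoly (\<lambda>x. complex_of_real (f x)) \<and> f x \<noteq> f y"
    by (intro exI[of _ "\<lambda>x. x \<bullet> b"]) auto
next
  fix f g :: "'a \<Rightarrow> real" assume "cpoly (\<lambda>x. of_real (f x)) \<and> cpoly (\<lambda>x. of_real (g x))"
  then show "cpoly (\<lambda>x. of_real (f x + g x))" "cpoly (\<lambda>x. of_real (f x * g x))"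
    using cpoly_add[of "\<lambda>x. of_real (f x)" "\<lambda>x. of_real (g x)"] cpoly_mult[of "\<lambda>x. of_real (f x)" "\<lambda>x. of_real (g x)"] by simp_all
qed simp

lemma cpoly_dense:
  assumes "f \<in> sphere_L2" "\<epsilon> > 0"
  shows "\<exists>p. cpoly p \<and> (L2_norm (\<lambda>x. f x - p x))\<^sup>2 < \<epsilon>"
proof -
  have "\<epsilon> / 4 > 0" using assms by simp
  then obtain g where g: "continuous_on (sphere 0 1) g" "(L2_norm (\<lambda>x. f x - g x))\<^sup>2 < \<epsilon> / 4"
    using sphere_L2_approximable[OF assms(1)] unfolding approximable_def by meson
  \<comment> \<open>Real and imaginary part contribute \<epsilon> / 17 each to the squared error,
    and \<epsilon> / 2 + 4 \<epsilon> / 17 < \<epsilon>.\<close>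
  let ?e = "sqrt (\<epsilon> / 17)"
  have e: "?e > 0" using assms by simp
  obtain r where r: "cpoly (\<lambda>x. complex_of_real (r x))" "\<And>x. x \<in> sphere 0 1 \<Longrightarrow> \<bar>Re (g x) - r x\<bar> < ?e"
    using cpoly_dense_real[OF continuous_on_Re[OF g(1)] e] by blast
  obtain s where s: "cpoly (\<lambda>x. complex_of_real (s x))" "\<And>x. x \<in> sphere 0 1 \<Longrightarrow> \<bar>Im (g x) - s x\<bar> < ?e"
    using cpoly_dense_real[OF continuous_on_Im[OF g(1)] e] by blast
  let ?p = "\<lambda>x. of_real (r x) + \<i> * of_real (s x)"
  have p: "cpoly ?p"
    by (intro cpoly_add cpoly_mult[OF cpoly_hpoly[OF hpoly_const]] r s)
  note L = sphere_L2_diff[OF sphere_L2_continuous[OF g(1)] sphere_L2_continuous[OF cpoly_continuous[OF p]]]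
  have "(L2_norm (\<lambda>x. g x - ?p x))\<^sup>2 \<le> (\<integral>x. \<epsilon> / 17 + \<epsilon> / 17 \<partial>(sphere_measure :: 'a measure))"
    unfolding L2_norm_sq
  proof (rule integral_mono)
    fix x :: 'a assume "x \<in> space sphere_measure"
    then have x: "x \<in> sphere 0 1" by simp
    have sq: "a\<^sup>2 \<le> \<epsilon> / 17" if "\<bar>a\<bar> < ?e" for a
      using power_mono[of "\<bar>a\<bar>" ?e 2] that assms by simp
    have "(cmod (g x - ?p x))\<^sup>2 = (Re (g x) - r x)\<^sup>2 + (Im (g x) - s x)\<^sup>2"
      by (simp add: cmod_power2)
    also have "\<dots> \<le> \<epsilon> / 17 + \<epsilon> / 17"
      by (intro add_mono sq r s x)
    finally show "(cmod (g x - ?p x))\<^sup>2 \<le> \<epsilon> / 17 + \<epsilon> / 17" .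
  qed (use sphere_L2_D(2)[OF L] in auto)
  also have "\<dots> = 2 * (\<epsilon> / 17)" using sphere.prob_space[where 'a = 'a] by simp
  finally have "(L2_norm (\<lambda>x. g x - ?p x))\<^sup>2 \<le> 2 * (\<epsilon> / 17)" .
  moreover have "(L2_norm (\<lambda>x. (f x - g x) + (g x - ?p x)))\<^sup>2 \<le> 2 * (L2_norm (\<lambda>x. f x - g x))\<^sup>2 + 2 * (L2_norm (\<lambda>x. g x - ?p x))\<^sup>2"
    by (intro L2_norm_sq_add_le sphere_L2_diff[OF assms(1) sphere_L2_continuous[OF g(1)]] L)
  moreover have "(\<lambda>x. (f x - g x) + (g x - ?p x)) = (\<lambda>x. f x - ?p x)" by auto
  ultimately have "(L2_norm (\<lambda>x. f x - ?p x))\<^sup>2 \<le> 2 * (L2_norm (\<lambda>x. f x - g x))\<^sup>2 + 2 * (2 * (\<epsilon> / 17))"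
    by simp
  then have "(L2_norm (\<lambda>x. f x - ?p x))\<^sup>2 < \<epsilon>"
    using g(2) assms(2) by linarith
  with p show ?thesis by blast
qed

subsection \<open>Functions of class \<open>C\<^sup>k\<close>\<close>

declare Ck_on.simps(2) [simp del]

lemma Ck_on_Suc_dd:
  "Ck_on (Suc k) f S \<longleftrightarrow> f differentiable_on S \<and> (\<forall>b\<in>Basis. Ck_on k (dd b f) S)"
  by (simp add: dd_def Ck_on.simps(2))

lemma differentiable_on_openD: "f differentiable_on S \<Longrightarrow> open S \<Longrightarrow> x \<in> S \<Longrightarrow> f differentiable (at x)"
  by (metis differentiable_on_eq_differentiable_at)

lemma differentiable_on_openI: "open S \<Longrightarrow> (\<And>x. x \<in> S \<Longrightarrow> f differentiable (at x)) \<Longrightarrow> f differentiable_on S"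
  by (metis differentiable_on_eq_differentiable_at)

lemma Ck_on_SucD: "Ck_on (Suc k) (f :: 'a::euclidean_space \<Rightarrow> complex) S \<Longrightarrow> open S \<Longrightarrow> x \<in> S \<Longrightarrow> f differentiable (at x)"
  by (rule differentiable_on_openD[of f S]) (simp_all add: Ck_on_Suc_dd)

lemma Ck_on_Suc_ddD: "Ck_on (Suc k) f S \<Longrightarrow> b \<in> Basis \<Longrightarrow> Ck_on k (dd b f) S"
  by (simp add: Ck_on_Suc_dd)

lemma Ck_on_continuous: "Ck_on k f S \<Longrightarrow> continuous_on S f"
  by (cases k) (auto simp: Ck_on.simps(2) intro: differentiable_imp_continuous_on)

lemma Ck_on_cong:
  fixes f g :: "'a::euclidean_space \<Rightarrow> complex"
  assumes S: "open S"
  shows "(\<And>x. x \<in> S \<Longrightarrow> f x = g x) \<Longrightarrow> Ck_on k f S \<Longrightarrow> Ck_on k g S"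
proof (induction k arbitrary: f g)
  case 0
  then show ?case using continuous_on_cong[of S S f g] by simp
next
  case (Suc k)
  have "g differentiable (at x)" if "x \<in> S" for x
  proof -
    have "(f has_derivative (\<lambda>u. dd u f x)) (at x)"
      by (rule has_derivative_dd[OF Ck_on_SucD[OF Suc.prems(2) S that]])
    from has_derivative_transform_within_open[OF this S that Suc.prems(1)] show ?thesis
      by (rule differentiableI)
  qed
  then have "g differentiable_on S" by (rule differentiable_on_openI[OF S])
  moreover have "Ck_on k (dd b g) S" if "b \<in> Basis" for b
    by (rule Suc.IH[OF dd_transform_open[OF S _ Suc.prems(1)] Ck_on_Suc_ddD[OF Suc.prems(2) that]])
  ultimately show ?case by (simp add: Ck_on_Suc_dd)
qed

lemma Ck_on_lower: "Ck_on (Suc k) f S \<Longrightarrow> Ck_on k (f :: 'a::euclidean_space \<Rightarrow> complex) S"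
proof (induction k arbitrary: f)
  case 0
  then show ?case using Ck_on_continuous[of "Suc 0" f S] by simp
next
  case (Suc k)
  then show ?case unfolding Ck_on_Suc_dd[of "Suc k"] Ck_on_Suc_dd[of k] by blast
qed

lemma Ck_on_const: "Ck_on k (\<lambda>x. c :: complex) S"
  by (induction k arbitrary: c) (auto simp: Ck_on_Suc_dd)

lemma Ck_on_add:
  fixes f g :: "'a::euclidean_space \<Rightarrow> complex"
  assumes S: "open S"
  shows "Ck_on k f S \<Longrightarrow> Ck_on k g S \<Longrightarrow> Ck_on k (\<lambda>x. f x + g x) S"
proof (induction k arbitrary: f g)
  case 0
  then show ?case by (simp add: continuous_on_add)
next
  case (Suc k)
  note d = Ck_on_SucD[OF Suc.prems(1) S] Ck_on_SucD[OF Suc.prems(2) S]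
  have "Ck_on k (dd b (\<lambda>x. f x + g x)) S" if "b \<in> Basis" for b
    by (rule Ck_on_cong[OF S _ Suc.IH[of "dd b f" "dd b g"]])
      (use Suc.prems that in \<open>auto simp: Ck_on_Suc_dd dd_add[OF d]\<close>)
  then show ?case
    by (auto simp: Ck_on_Suc_dd intro!: differentiable_on_openI[OF S] differentiable_add d)
qed

lemma Ck_on_mult:
  fixes f g :: "'a::euclidean_space \<Rightarrow> complex"
  assumes S: "open S"
  shows "Ck_on k f S \<Longrightarrow> Ck_on k g S \<Longrightarrow> Ck_on k (\<lambda>x. f x * g x) S"
proof (induction k arbitrary: f g)
  case 0
  then show ?case by (simp add: continuous_on_mult)
next
  case (Suc k)
  note d = Ck_on_SucD[OF Suc.prems(1) S] Ck_on_SucD[OF Suc.prems(2) S]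
  have "Ck_on k (dd b (\<lambda>x. f x * g x)) S" if "b \<in> Basis" for b
  proof (rule Ck_on_cong[OF S])
    show "Ck_on k (\<lambda>x. f x * dd b g x + dd b f x * g x) S"
      using Suc.prems that
      by (intro Ck_on_add[OF S] Suc.IH Ck_on_lower[OF Suc.prems(1)] Ck_on_lower[OF Suc.prems(2)])
        (auto simp: Ck_on_Suc_dd)
  qed (simp add: dd_mult[OF d])
  then show ?case
    by (auto simp: Ck_on_Suc_dd intro!: differentiable_on_openI[OF S] differentiable_mult d)
qed

lemma Ck_on_cnj:
  fixes f :: "'a::euclidean_space \<Rightarrow> complex"
  assumes S: "open S"
  shows "Ck_on k f S \<Longrightarrow> Ck_on k (\<lambda>x. cnj (f x)) S"
proof (induction k arbitrary: f)
  case 0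
  then show ?case by (simp add: continuous_on_cnj)
next
  case (Suc k)
  note d = Ck_on_SucD[OF Suc.prems S]
  have "(\<lambda>x. cnj (f x)) differentiable (at x)" if "x \<in> S" for x
    using has_derivative_cnj[OF has_derivative_dd[OF d[OF that]]] by (rule differentiableI)
  then have "(\<lambda>x. cnj (f x)) differentiable_on S" by (rule differentiable_on_openI[OF S])
  moreover have "Ck_on k (dd b (\<lambda>x. cnj (f x))) S" if "b \<in> Basis" for b
    by (rule Ck_on_cong[OF S _ Suc.IH[of "dd b f"]])
      (use Suc.prems that in \<open>auto simp: Ck_on_Suc_dd dd_cnj[OF d]\<close>)
  ultimately show ?case by (simp add: Ck_on_Suc_dd)
qed

lemma Ck_on_power:
  fixes f :: "'a::euclidean_space \<Rightarrow> complex"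
  assumes "open S" "Ck_on k f S"
  shows "Ck_on k (\<lambda>x. f x ^ n) S"
  by (induction n) (auto intro: Ck_on_const Ck_on_mult assms)

lemma Ck_on_hpoly: "hpoly l p \<Longrightarrow> Ck_on k p S"
proof (induction k arbitrary: l p)
  case 0
  then show ?case by (simp add: hpoly_continuous)
next
  case (Suc k)
  then show ?case
    using hpoly_dd hpoly_differentiable
    by (simp add: Ck_on_Suc_dd differentiable_on_def)
      (blast intro: differentiable_at_withinI hpoly_dd)
qed

lemma Ck_on_diff:
  fixes f g :: "'a::euclidean_space \<Rightarrow> complex"
  assumes "open S" "Ck_on k f S" "Ck_on k g S"
  shows "Ck_on k (\<lambda>x. f x - g x) S"
  using Ck_on_add[OF assms(1,2) Ck_on_mult[OF assms(1) Ck_on_const[of k "-1"] assms(3)]] by simp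

lemma open_Compl0 [simp]: "open (- {0 :: 'a::euclidean_space})"
  by (rule open_Compl[OF closed_singleton])

lemma inverse_norm_has_derivative:
  fixes x :: "'a::euclidean_space"
  assumes "x \<noteq> 0"
  shows "((\<lambda>x. complex_of_real (inverse (norm x))) has_derivative
    (\<lambda>u. - (of_real (x \<bullet> u) * of_real (inverse (norm x)) ^ 3))) (at x)"
proof -
  have "((\<lambda>x. complex_of_real (inverse (norm x))) has_derivative
    (\<lambda>u. of_real (- (inverse (norm x) * (u \<bullet> sgn x) * inverse (norm x))))) (at x)"
    using assms by (intro has_derivative_of_real Deriv.has_derivative_inverse has_derivative_norm) auto
  moreover have "complex_of_real (- (inverse (norm x) * (u \<bullet> sgn x) * inverse (norm x))) =
     - (of_real (x \<bullet> u) * of_real (inverse (norm x)) ^ 3)" for u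
    by (simp add: sgn_div_norm power3_eq_cube divide_inverse inner_commute)
  ultimately show ?thesis by simp
qed

text \<open>The derivative of 1 / |x| in direction b is - (x \<bullet> b) / |x|^3, a coordinate
  times a power of the function itself, so every order of smoothness yields the next.\<close>

lemma Ck_on_inverse_norm: "Ck_on k (\<lambda>x::'a::euclidean_space. complex_of_real (inverse (norm x))) (- {0})"
proof (induction k)
  case 0
  show ?case by (auto intro!: continuous_intros)
next
  case (Suc k)
  let ?f = "\<lambda>x::'a. complex_of_real (inverse (norm x))"
  have "?f differentiable_on (- {0})"
    using inverse_norm_has_derivative by (intro differentiable_on_openI) (auto intro: differentiableI)
  moreover have "Ck_on k (dd b ?f) (- {0})" if "b \<in> Basis" for b
  proof (rule Ck_on_cong)
    have "Ck_on k (\<lambda>x::'a. complex_of_real (x \<bullet> b) * 1) (- {0})"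
      by (rule Ck_on_hpoly[OF hpoly_coord[OF hpoly_const[of 1] that]])
    then show "Ck_on k (\<lambda>x. (-1) * ((of_real (x \<bullet> b) * 1) * ?f x ^ 3)) (- {0})"
      by (intro Ck_on_mult Ck_on_power Suc Ck_on_const) auto
    show "(-1) * ((of_real (x \<bullet> b) * 1) * ?f x ^ 3) = dd b ?f x" if "x \<in> - {0}" for x
      using that by (subst dd_eqI[OF inverse_norm_has_derivative]) auto
  qed simp
  ultimately show ?case by (simp add: Ck_on_Suc_dd)
qed

lemma hpoly_sgn: "hpoly k p \<Longrightarrow> p (sgn y) = of_real (inverse (norm y)) ^ k * p y"
  by (simp add: sgn_div_norm hpoly_homogeneous del: of_real_inverse)

lemma smooth_on_sphere_hpoly: 
  assumes "hpoly k p" shows "smooth_on_sphere p"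
  unfolding smooth_on_sphere_def hpoly_sgn[OF assms]
  by (intro allI Ck_on_mult Ck_on_power Ck_on_inverse_norm Ck_on_hpoly[OF assms]) auto


subsection \<open>Infinitesimal rotations\<close>

text \<open>For an orthonormal pair, the rotation by the angle t in the plane of u and v. Written as
  the identity plus a correction in the plane, it needs no completion of u, v to a basis.\<close>

definition rot :: "'a::euclidean_space \<Rightarrow> 'a \<Rightarrow> real \<Rightarrow> 'a \<Rightarrow> 'a"
  where "rot u v t x = x + ((cos t - 1) * (x \<bullet> u) - sin t * (x \<bullet> v)) *\<^sub>R u
     + ((cos t - 1) * (x \<bullet> v) + sin t * (x \<bullet> u)) *\<^sub>R v"

text \<open>The generator of the flow \<open>rot u v\<close>; it is tangent to every sphere about
  the origin.\<close>

definition skew :: "'a::euclidean_space \<Rightarrow> 'a \<Rightarrow> 'a \<Rightarrow> 'a"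
  where "skew u v x = (x \<bullet> u) *\<^sub>R v - (x \<bullet> v) *\<^sub>R u"

definition orthonormal_pair :: "'a::euclidean_space \<Rightarrow> 'a \<Rightarrow> bool"
  where "orthonormal_pair u v \<longleftrightarrow> norm u = 1 \<and> norm v = 1 \<and> u \<bullet> v = 0"

lemma orthonormal_pairD:
  assumes "orthonormal_pair u v"
  shows "u \<bullet> u = 1" "v \<bullet> v = 1" "u \<bullet> v = 0" "v \<bullet> u = 0"
  using assms by (auto simp: orthonormal_pair_def dot_square_norm inner_commute)

lemma rot_inner:
  assumes "orthonormal_pair u v"
  shows "rot u v t x \<bullet> u = cos t * (x \<bullet> u) - sin t * (x \<bullet> v)"
    "rot u v t x \<bullet> v = cos t * (x \<bullet> v) + sin t * (x \<bullet> u)"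
  using orthonormal_pairD[OF assms] by (auto simp: rot_def inner_simps algebra_simps)

lemma rot_alt:
  assumes "orthonormal_pair u v"
  shows "rot u v t x = x + (rot u v t x \<bullet> u - x \<bullet> u) *\<^sub>R u + (rot u v t x \<bullet> v - x \<bullet> v) *\<^sub>R v"
  unfolding rot_inner[OF assms] by (simp add: rot_def algebra_simps)

text \<open>By \<open>rot_alt\<close> a rotated point is determined by its components along u and v,
  and for these the claim is the addition theorem of sine and cosine.\<close>

lemma rot_add:
  assumes "orthonormal_pair u v"
  shows "rot u v s (rot u v t x) = rot u v (s + t) x"
proof -
  let ?z = "rot u v t x"
  have "rot u v s ?z = ?z + (rot u v s ?z \<bullet> u - ?z \<bullet> u) *\<^sub>R u + (rot u v s ?z \<bullet> v - ?z \<bullet> v) *\<^sub>R v"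
    by (rule rot_alt[OF assms])
  moreover have "?z = x + (?z \<bullet> u - x \<bullet> u) *\<^sub>R u + (?z \<bullet> v - x \<bullet> v) *\<^sub>R v"
    by (rule rot_alt[OF assms])
  moreover have "w = x + (a - x \<bullet> u) *\<^sub>R u + (c - x \<bullet> v) *\<^sub>R v"
    if "w = z + (a - b) *\<^sub>R u + (c - d) *\<^sub>R v" "z = x + (b - x \<bullet> u) *\<^sub>R u + (d - x \<bullet> v) *\<^sub>R v" for w z a b c d
    unfolding that by (simp add: algebra_simps)
  ultimately have "rot u v s ?z = x + (rot u v s ?z \<bullet> u - x \<bullet> u) *\<^sub>R u + (rot u v s ?z \<bullet> v - x \<bullet> v) *\<^sub>R v"
    by blast
  also have "rot u v s ?z \<bullet> u = rot u v (s + t) x \<bullet> u"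
    unfolding rot_inner[OF assms] cos_add sin_add by (simp add: algebra_simps)
  also have "rot u v s ?z \<bullet> v = rot u v (s + t) x \<bullet> v"
    unfolding rot_inner[OF assms] cos_add sin_add by (simp add: algebra_simps)
  finally show ?thesis using rot_alt[OF assms, of "s + t" x] by simp
qed

lemma rot_0 [simp]: "rot u v 0 x = x"
  by (simp add: rot_def)

lemma orthogonal_transformation_rot:
  assumes "orthonormal_pair u v"
  shows "orthogonal_transformation (rot u v t)"
  unfolding orthogonal_transformation
proof (intro conjI allI)
  show "linear (rot u v t)"
    by (rule linearI) (auto simp: rot_def inner_simps algebra_simps)
  fix x
  have "rot u v t x \<bullet> rot u v t x = x \<bullet> x"
  proof -
    define a where "a = (cos t - 1) * (x \<bullet> u) - sin t * (x \<bullet> v)"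
    define b where "b = (cos t - 1) * (x \<bullet> v) + sin t * (x \<bullet> u)"
    have "rot u v t x \<bullet> rot u v t x = x \<bullet> x + 2 * a * (x \<bullet> u) + 2 * b * (x \<bullet> v) + a\<^sup>2 + b\<^sup>2"
    proof -
      have "rot u v t x = x + a *\<^sub>R u + b *\<^sub>R v" by (simp add: rot_def a_def b_def)
      then show ?thesis
        using orthonormal_pairD[OF assms]
        by (simp add: inner_add_left inner_add_right algebra_simps power2_eq_square inner_commute[of u x] inner_commute[of v x])
    qed
    also have "2 * a * (x \<bullet> u) + 2 * b * (x \<bullet> v) = 2 * (cos t - 1) * ((x \<bullet> u)\<^sup>2 + (x \<bullet> v)\<^sup>2)"
      by (simp add: a_def b_def algebra_simps power2_eq_square)
    moreover have "a\<^sup>2 + b\<^sup>2 = ((cos t)\<^sup>2 + (sin t)\<^sup>2 + 1 - 2 * cos t) * ((x \<bullet> u)\<^sup>2 + (x \<bullet> v)\<^sup>2)"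
      by (simp only: a_def b_def) algebra
    moreover have "\<dots> = (2 - 2 * cos t) * ((x \<bullet> u)\<^sup>2 + (x \<bullet> v)\<^sup>2)"
      by simp
    ultimately show ?thesis
      by (simp add: algebra_simps)
  qed
  then show "norm (rot u v t x) = norm x" by (simp add: norm_eq_sqrt_inner)
qed

lemma rot_has_derivative:
  assumes "orthonormal_pair u v"
  shows "((\<lambda>t. rot u v t x) has_derivative (\<lambda>s. s *\<^sub>R skew u v (rot u v t x))) (at t)"
proof -
  have "((\<lambda>t. rot u v t x) has_derivative (\<lambda>s. (- sin t * s * (x \<bullet> u) - cos t * s * (x \<bullet> v)) *\<^sub>R u +
     (- sin t * s * (x \<bullet> v) + cos t * s * (x \<bullet> u)) *\<^sub>R v)) (at t)"
    unfolding rot_def by (auto intro!: derivative_eq_intros simp: algebra_simps)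
  moreover have "(- sin t * s * (x \<bullet> u) - cos t * s * (x \<bullet> v)) *\<^sub>R u +
     (- sin t * s * (x \<bullet> v) + cos t * s * (x \<bullet> u)) *\<^sub>R v = s *\<^sub>R skew u v (rot u v t x)" for s
    unfolding skew_def rot_inner[OF assms] by (simp add: algebra_simps)
  ultimately show ?thesis by simp
qed

definition rotd :: "'a::euclidean_space \<Rightarrow> 'a \<Rightarrow> ('a \<Rightarrow> complex) \<Rightarrow> 'a \<Rightarrow> complex"
  where "rotd u v f = (\<lambda>x. dd (skew u v x) f x)"

lemma rotd_eq:
  assumes "f differentiable (at x)"
  shows "rotd u v f x = of_real (x \<bullet> u) * dd v f x - of_real (x \<bullet> v) * dd u f x"
proof -
  interpret L: linear "\<lambda>u. dd u f x" by (rule dd_linear[OF assms])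
  show ?thesis
    by (simp add: rotd_def skew_def L.diff L.scale scaleR_conv_of_real)
qed

lemma rotd_expand:
  assumes "f differentiable (at x)"
  shows "rotd u v f x = (\<Sum>b\<in>Basis. of_real (skew u v x \<bullet> b) * dd b f x)"
  unfolding rotd_def by (rule dd_expand[OF assms])

lemma Ck_on_rotd:
  assumes f: "Ck_on (Suc k) f S" and S: "open S" and uv: "u \<in> Basis" "v \<in> Basis"
  shows "Ck_on k (rotd u v f) S"
proof (rule Ck_on_cong[OF S])
  have "Ck_on k (\<lambda>x. (of_real (x \<bullet> b) * 1) :: complex) S" if "b \<in> Basis" for b
    by (rule Ck_on_hpoly[OF hpoly_coord[OF hpoly_const[of 1] that]])
  then show "Ck_on k (\<lambda>x. (of_real (x \<bullet> u) * 1) * dd v f x - (of_real (x \<bullet> v) * 1) * dd u f x) S"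
    using f uv by (intro Ck_on_diff[OF S] Ck_on_mult[OF S]) (auto simp: Ck_on_Suc_ddD Ck_on_const)
  show "(of_real (x \<bullet> u) * 1) * dd v f x - (of_real (x \<bullet> v) * 1) * dd u f x = rotd u v f x" if "x \<in> S" for x
    using rotd_eq[OF Ck_on_SucD[OF f S that]] by simp
qed

text \<open>Rotations preserve the measure, so every difference quotient of F along the flow has
  integral zero; dominated convergence passes to the derivative.\<close>

lemma integral_rotd_zero:
  fixes F :: "'a::euclidean_space \<Rightarrow> complex"
  assumes uv: "orthonormal_pair u v" and F: "Ck_on 1 F (- {0})"
  shows "(\<integral>x. rotd u v F x \<partial>sphere_measure) = 0"
proof -
  have D: "F differentiable (at x)" if "x \<noteq> 0" for x
    using F that by (intro Ck_on_SucD[of 0 F "- {0}"]) auto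
  have C: "continuous_on (- {0}) (dd b F)" if "b \<in> Basis" for b
    using Ck_on_Suc_ddD[of 0 F "- {0}" b] F that by simp
  have cF: "continuous_on (sphere 0 1) F"
    by (rule continuous_on_subset[OF Ck_on_continuous[OF F]]) auto
  have "continuous_on (sphere 0 1) (\<lambda>x. \<Sum>b\<in>Basis. of_real (skew u v x \<bullet> b) * dd b F x)"
    unfolding skew_def
    by (intro continuous_intros continuous_on_subset[OF C]) auto
  then have cD: "continuous_on (sphere 0 1) (rotd u v F)"
    by (rule continuous_on_eq) (auto intro!: rotd_expand[symmetric] D)
  have "bounded (rotd u v F ` sphere 0 1)"
    by (rule compact_imp_bounded[OF compact_continuous_image[OF cD]]) simp
  then obtain B where B: "\<forall>x\<in>sphere 0 1. cmod (rotd u v F x) \<le> B"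
    unfolding bounded_iff by auto
  note O = orthogonal_transformation_rot[OF uv]
  define h where "h n = inverse (real (Suc n))" for n
  have h0: "h n > 0" for n by (simp add: h_def)
  have hlim: "filterlim h (at 0) sequentially"
    unfolding h_def by (intro filterlim_atI LIMSEQ_inverse_real_of_nat) auto
  define \<phi> where "\<phi> n x = (F (rot u v (h n) x) - F x) / of_real (h n)" for n x
  have g: "((\<lambda>t. F (rot u v t x)) has_derivative (\<lambda>s. s *\<^sub>R rotd u v F (rot u v t x))) (at t)"
    if x: "x \<in> sphere 0 1" for x t
  proof -
    have nz: "rot u v t x \<noteq> 0" using orthogonal_transformation_sphere[OF O x, of t] by auto
    from has_derivative_compose[OF rot_has_derivative[OF uv] has_derivative_dd[OF D[OF nz]]]
    have "((\<lambda>t. F (rot u v t x)) has_derivative (\<lambda>s. dd (s *\<^sub>R skew u v (rot u v t x)) F (rot u v t x))) (at t)" .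
    moreover have "dd (s *\<^sub>R w) F (rot u v t x) = s *\<^sub>R dd w F (rot u v t x)" for s w
      by (rule linear_scale[OF dd_linear[OF D[OF nz]]])
    ultimately show ?thesis by (simp add: rotd_def)
  qed
  \<comment> \<open>The mean value inequality in t: rotated points stay on the sphere, where B
    bounds the derivative, so the quotients are dominated by a constant.\<close>
  have bound: "cmod (\<phi> n x) \<le> B" if x: "x \<in> sphere 0 1" for n x
  proof -
    have "norm (F (rot u v (h n) x) - F (rot u v 0 x)) \<le> B * norm (h n - 0)"
    proof (rule differentiable_bound[of UNIV])
      show "((\<lambda>t. F (rot u v t x)) has_derivative (\<lambda>s. s *\<^sub>R rotd u v F (rot u v t x))) (at t within UNIV)" for t
        using g[OF x] by simp
      show "onorm (\<lambda>s. s *\<^sub>R rotd u v F (rot u v t x)) \<le> B" for t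
      proof (rule onorm_le)
        fix s :: real
        have "norm (s *\<^sub>R rotd u v F (rot u v t x)) = \<bar>s\<bar> * cmod (rotd u v F (rot u v t x))" by simp
        also have "\<dots> \<le> \<bar>s\<bar> * B"
          using B orthogonal_transformation_sphere[OF O x] by (intro mult_left_mono) auto
        finally show "norm (s *\<^sub>R rotd u v F (rot u v t x)) \<le> B * norm s" by (simp add: mult.commute)
      qed
    qed auto
    then show ?thesis
      using h0[of n] by (simp add: \<phi>_def norm_divide divide_le_eq)
  qed
  have lim: "(\<lambda>n. \<phi> n x) \<longlonglongrightarrow> rotd u v F x" if x: "x \<in> sphere 0 1" for x
  proof -
    let ?G = "rotd u v F x" and ?g = "\<lambda>t. F (rot u v t x)"
    have "(\<lambda>t. norm (?g (0 + t) - ?g 0 - t *\<^sub>R ?G) / norm t) \<midarrow>0\<rightarrow> 0"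
      using g[OF x, of 0] by (simp add: has_derivative_at)
    from filterlim_compose[OF this hlim]
    have "(\<lambda>n. norm (?g (h n) - ?g 0 - h n *\<^sub>R ?G) / norm (h n)) \<longlonglongrightarrow> 0" by simp
    moreover have "norm (?g (h n) - ?g 0 - h n *\<^sub>R ?G) / norm (h n) = norm (\<phi> n x - ?G)" for n
    proof -
      have "\<phi> n x - ?G = (?g (h n) - ?g 0 - h n *\<^sub>R ?G) / of_real (h n)"
        using h0[of n] by (simp add: \<phi>_def diff_divide_distrib scaleR_conv_of_real)
      then show ?thesis by (simp add: norm_divide)
    qed
    ultimately have "(\<lambda>n. norm (\<phi> n x - ?G)) \<longlonglongrightarrow> 0" by simp
    then show ?thesis using tendsto_norm_zero_iff LIM_zero_iff by blast
  qed
  have cR: "continuous_on (sphere 0 1) (\<lambda>x. F (rot u v t x))" for t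
  proof (rule continuous_on_compose2[OF cF])
    show "continuous_on (sphere 0 1) (rot u v t)"
      by (rule linear_continuous_on[OF linear_conv_bounded_linear[THEN iffD1, OF orthogonal_transformation_linear[OF O]]])
    show "rot u v t ` sphere 0 1 \<subseteq> sphere 0 1"
      by (intro image_subsetI orthogonal_transformation_sphere[OF O])
  qed
  have c\<phi>: "continuous_on (sphere 0 1) (\<phi> n)" for n
    unfolding \<phi>_def using h0[of n] by (intro continuous_intros cR cF) auto
  have int0: "(\<integral>x. \<phi> n x \<partial>sphere_measure) = 0" for n
    using integral_sphere_orthogonal[OF O continuous_sphere_measurable[OF cF], of "h n"]
    by (simp add: \<phi>_def continuous_sphere_integrable cR cF)
  have "(\<lambda>n. \<integral>x. \<phi> n x \<partial>sphere_measure) \<longlonglongrightarrow> (\<integral>x. rotd u v F x \<partial>sphere_measure)"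
  proof (rule integral_dominated_convergence[where w = "\<lambda>x. B"])
    show "rotd u v F \<in> borel_measurable sphere_measure" by (rule continuous_sphere_measurable[OF cD])
    show "\<phi> n \<in> borel_measurable sphere_measure" for n by (rule continuous_sphere_measurable[OF c\<phi>])
  qed (use lim bound in auto)
  then show ?thesis by (simp add: int0 LIMSEQ_const_iff)
qed

lemma rotd_mult:
  assumes "f differentiable (at x)" "g differentiable (at x)"
  shows "rotd u v (\<lambda>x. f x * g x) x = f x * rotd u v g x + rotd u v f x * g x"
  unfolding rotd_def by (rule dd_mult[OF assms])

lemma rotd_self: "f differentiable (at x) \<Longrightarrow> rotd u u f x = 0"
  by (simp add: rotd_eq)

lemma Ck_on_sphere_continuous: "Ck_on k f (- {0}) \<Longrightarrow> continuous_on (sphere 0 1) f"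
  by (rule continuous_on_subset[OF Ck_on_continuous]) auto

text \<open>The product rule and \<open>integral_rotd_zero\<close> for f g; the sphere has no
  boundary.\<close>

lemma integral_rotd_by_parts:
  fixes f g :: "'a::euclidean_space \<Rightarrow> complex"
  assumes uv: "u \<in> Basis" "v \<in> Basis" and f: "Ck_on 1 f (- {0})" and g: "Ck_on 1 g (- {0})"
  shows "(\<integral>x. f x * rotd u v g x \<partial>sphere_measure) = - (\<integral>x. rotd u v f x * g x \<partial>sphere_measure)"
proof -
  have D: "f differentiable (at x)" "g differentiable (at x)" if "x \<in> sphere 0 1" for x
    using f g that by (auto intro!: Ck_on_SucD[of 0 _ "- {0}"])
  have c: "continuous_on (sphere 0 1) (\<lambda>x. f x * rotd u v g x)" "continuous_on (sphere 0 1) (\<lambda>x. rotd u v f x * g x)"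
    by (intro continuous_on_mult Ck_on_sphere_continuous[OF f] Ck_on_sphere_continuous[OF g]
        Ck_on_sphere_continuous[OF Ck_on_rotd[OF f[unfolded One_nat_def] open_Compl0 uv]]
        Ck_on_sphere_continuous[OF Ck_on_rotd[OF g[unfolded One_nat_def] open_Compl0 uv]])+
  show ?thesis
  proof (cases "u = v")
    \<comment> \<open>The pair is not orthonormal here, but \<open>skew u u\<close> is zero and both
      sides vanish.\<close>
    case True
    have "(\<integral>x. f x * rotd u v g x \<partial>sphere_measure) = (\<integral>x. 0 \<partial>(sphere_measure :: 'a measure))"
      "(\<integral>x. rotd u v f x * g x \<partial>sphere_measure) = (\<integral>x. 0 \<partial>(sphere_measure :: 'a measure))"
      by (rule Bochner_Integration.integral_cong; use D in \<open>simp add: True rotd_self\<close>)+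
    then show ?thesis by simp
  next
    case False
    then have "orthonormal_pair u v" using uv by (simp add: orthonormal_pair_def inner_Basis)
    then have "0 = (\<integral>x. rotd u v (\<lambda>x. f x * g x) x \<partial>sphere_measure)"
      using integral_rotd_zero[OF _ Ck_on_mult[OF open_Compl0 f g]] by simp
    also have "\<dots> = (\<integral>x. f x * rotd u v g x + rotd u v f x * g x \<partial>sphere_measure)"
      using D by (intro Bochner_Integration.integral_cong) (auto simp: rotd_mult)
    also have "\<dots> = (\<integral>x. f x * rotd u v g x \<partial>sphere_measure) + (\<integral>x. rotd u v f x * g x \<partial>sphere_measure)"
      using c by (intro Bochner_Integration.integral_add continuous_sphere_integrable)
    finally show ?thesis by (simp add: eq_neg_iff_add_eq_0)
  qed
qed

text \<open>Every coordinate plane is counted twice, so on functions homogeneous of degree \<open>0\<close> this is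
  twice \<open>|x|\<^sup>2\<close> times the Laplacian.\<close>

definition rot_laplacian :: "('a::euclidean_space \<Rightarrow> complex) \<Rightarrow> 'a \<Rightarrow> complex"
  where "rot_laplacian f x = (\<Sum>u\<in>Basis. \<Sum>v\<in>Basis. rotd u v (rotd u v f) x)"

text \<open>Two integrations by parts in each plane, whose signs cancel. The pairing is bilinear;
  test functions are conjugated beforehand.\<close>

lemma integral_rot_laplacian:
  fixes f g :: "'a::euclidean_space \<Rightarrow> complex"
  assumes f: "Ck_on 2 f (- {0})" and g: "Ck_on 2 g (- {0})"
  shows "(\<integral>x. f x * rot_laplacian g x \<partial>sphere_measure) = (\<integral>x. rot_laplacian f x * g x \<partial>sphere_measure)"
proof -
  have f': "Ck_on 1 f (- {0})" and g': "Ck_on 1 g (- {0})"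
    using Ck_on_lower[of 1] f g by (auto simp: numeral_2_eq_2)
  have d: "Ck_on 1 (rotd u v f) (- {0})" "Ck_on 1 (rotd u v g) (- {0})" if "u \<in> Basis" "v \<in> Basis" for u v
    using Ck_on_rotd[of 1 f "- {0}" u v] Ck_on_rotd[of 1 g "- {0}" u v] f g that
    by (auto simp: numeral_2_eq_2)
  have d2: "Ck_on 0 (rotd u v (rotd u v f)) (- {0})" "Ck_on 0 (rotd u v (rotd u v g)) (- {0})" if "u \<in> Basis" "v \<in> Basis" for u v
    using d[OF that] Ck_on_rotd[of 0 _ "- {0}" u v] that by (auto simp del: Ck_on.simps)
  note i = continuous_sphere_integrable[OF continuous_on_mult[OF Ck_on_sphere_continuous[OF f] Ck_on_sphere_continuous[OF d2(2)]]]
    continuous_sphere_integrable[OF continuous_on_mult[OF Ck_on_sphere_continuous[OF d2(1)] Ck_on_sphere_continuous[OF g]]]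
  have "(\<integral>x. f x * rot_laplacian g x \<partial>sphere_measure) =
     (\<Sum>u\<in>Basis. \<Sum>v\<in>Basis. \<integral>x. f x * rotd u v (rotd u v g) x \<partial>sphere_measure)"
    unfolding rot_laplacian_def sum_distrib_left using i(1)
    by (subst Bochner_Integration.integral_sum; (intro sum.cong refl)?)
      (auto intro!: Bochner_Integration.integrable_sum Bochner_Integration.integral_sum)
  also have "\<dots> = (\<Sum>u\<in>Basis. \<Sum>v\<in>Basis. \<integral>x. rotd u v (rotd u v f) x * g x \<partial>sphere_measure)"
  proof (intro sum.cong refl)
    fix u v :: 'a assume uv: "u \<in> Basis" "v \<in> Basis"
    show "(\<integral>x. f x * rotd u v (rotd u v g) x \<partial>sphere_measure) = (\<integral>x. rotd u v (rotd u v f) x * g x \<partial>sphere_measure)"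
      using integral_rotd_by_parts[OF uv f' d(2)[OF uv]] integral_rotd_by_parts[OF uv d(1)[OF uv] g'] by simp
  qed
  also have "\<dots> = (\<integral>x. rot_laplacian f x * g x \<partial>sphere_measure)"
    unfolding rot_laplacian_def sum_distrib_right using i(2)
    by (subst Bochner_Integration.integral_sum; (intro sum.cong refl)?)
      (auto intro!: Bochner_Integration.integrable_sum Bochner_Integration.integral_sum[symmetric])
  finally show ?thesis .
qed

subsection \<open>The Laplace--Beltrami operator on polynomials\<close>

text \<open>The splitting of the Laplacian in polar coordinates: up to the factor 2, the angular
  part is the squared norm times the Laplacian, minus (dimension - 1) times the radial derivative,
  minus the Hessian in the radial direction.\<close>

lemma rot_laplacian_eq:
  fixes F :: "'a::euclidean_space \<Rightarrow> complex"
  assumes S: "open S" and x: "x \<in> S" and F: "Ck_on 2 F S"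
  shows "rot_laplacian F x = 2 * (of_real (x \<bullet> x) * laplacian F x + (1 - of_nat DIM('a)) * dd x F x
    - (\<Sum>u\<in>Basis. \<Sum>v\<in>Basis. of_real (x \<bullet> u) * (of_real (x \<bullet> v) * dd v (dd u F) x)))"
proof -
  have F1: "Ck_on (Suc 1) F S" using F by (simp add: numeral_2_eq_2)
  have d: "F differentiable (at y)" if "y \<in> S" for y
    by (rule Ck_on_SucD[OF F1 S that])
  have d2: "dd b F differentiable (at x)" if "b \<in> Basis" for b
    using Ck_on_Suc_ddD[OF F1 that] by (intro Ck_on_SucD[OF _ S x, of 0]) simp
  let ?Q = "\<lambda>u v. of_real (x \<bullet> u) * (of_real (x \<bullet> v) * dd v (dd u F) x)"
  have rr: "rotd u v (rotd u v F) x =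
     (of_real (x \<bullet> u) * (of_real (v \<bullet> u) * dd v F x) + of_real (x \<bullet> u) ^ 2 * dd v (dd v F) x
       - of_real (x \<bullet> u) * dd u F x - ?Q u v)
   + (of_real (x \<bullet> v) * (of_real (u \<bullet> v) * dd u F x) + of_real (x \<bullet> v) ^ 2 * dd u (dd u F) x
       - of_real (x \<bullet> v) * dd v F x - ?Q v u)"
    if uv: "u \<in> Basis" "v \<in> Basis" for u v
  proof -
    let ?G = "\<lambda>y. of_real (y \<bullet> u) * dd v F y - of_real (y \<bullet> v) * dd u F y"
    have G: "dd w (rotd u v F) x = (of_real (w \<bullet> u) * dd v F x + of_real (x \<bullet> u) * dd w (dd v F) x)
        - (of_real (w \<bullet> v) * dd u F x + of_real (x \<bullet> v) * dd w (dd u F) x)" for w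
    proof -
      have "dd w (rotd u v F) x = dd w ?G x"
        by (rule dd_transform_open[OF S x]) (rule rotd_eq[OF d])
      also have "\<dots> = dd w (\<lambda>y. of_real (y \<bullet> u) * dd v F y) x - dd w (\<lambda>y. of_real (y \<bullet> v) * dd u F y) x"
        using uv by (intro dd_diff differentiable_mult differentiable_coord d2)
      finally show ?thesis using dd_coord_mult[OF d2] uv by simp
    qed
    have "rotd u v F differentiable (at x)"
    proof -
      have "Ck_on 1 (rotd u v F) S" by (rule Ck_on_rotd[OF F1 S uv])
      then show ?thesis by (intro Ck_on_SucD[OF _ S x, of 0]) simp
    qed
    then have "rotd u v (rotd u v F) x = of_real (x \<bullet> u) * dd v (rotd u v F) x - of_real (x \<bullet> v) * dd u (rotd u v F) x"
      by (rule rotd_eq)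
    then show ?thesis
      unfolding G using uv by (simp add: algebra_simps power2_eq_square)
  qed
  let ?T = "\<lambda>u v. of_real (x \<bullet> u) * (of_real (v \<bullet> u) * dd v F x) + of_real (x \<bullet> u) ^ 2 * dd v (dd v F) x
       - of_real (x \<bullet> u) * dd u F x - ?Q u v"
  have T: "(\<Sum>u\<in>Basis. \<Sum>v\<in>Basis. ?T u v) = of_real (x \<bullet> x) * laplacian F x + (1 - of_nat DIM('a)) * dd x F x
      - (\<Sum>u\<in>Basis. \<Sum>v\<in>Basis. ?Q u v)"
  proof -
    have E: "dd x F x = (\<Sum>u\<in>Basis. of_real (x \<bullet> u) * dd u F x)"
      by (rule dd_expand[OF d[OF x]])
    have 1: "(\<Sum>v\<in>Basis. of_real (x \<bullet> u) * (of_real (v \<bullet> u) * dd v F x)) = of_real (x \<bullet> u) * dd u F x"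
      if "u \<in> Basis" for u
    proof -
      have "(\<Sum>v\<in>Basis. of_real (x \<bullet> u) * (of_real (v \<bullet> u) * dd v F x)) =
         (\<Sum>v\<in>Basis. if v = u then of_real (x \<bullet> u) * dd u F x else 0)"
        by (intro sum.cong refl) (simp add: inner_Basis that)
      then show ?thesis using that by simp
    qed
    have 2: "(\<Sum>u\<in>Basis. \<Sum>v\<in>Basis. of_real (x \<bullet> u) ^ 2 * dd v (dd v F) x) = of_real (x \<bullet> x) * laplacian F x"
      unfolding euclidean_inner[of x x] by (simp add: laplacian_eq_dd sum_product power2_eq_square)
    have "(\<Sum>u\<in>Basis. \<Sum>v\<in>Basis. ?T u v) =
        (\<Sum>u\<in>Basis. \<Sum>v\<in>Basis. of_real (x \<bullet> u) * (of_real (v \<bullet> u) * dd v F x))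
      + (\<Sum>u\<in>Basis. \<Sum>v\<in>Basis. of_real (x \<bullet> u) ^ 2 * dd v (dd v F) x)
      - (\<Sum>u\<in>Basis. \<Sum>v\<in>(Basis :: 'a set). of_real (x \<bullet> u) * dd u F x) - (\<Sum>u\<in>Basis. \<Sum>v\<in>Basis. ?Q u v)"
      by (simp only: sum.distrib sum_subtractf)
    also have "(\<Sum>u\<in>Basis. \<Sum>v\<in>Basis. of_real (x \<bullet> u) * (of_real (v \<bullet> u) * dd v F x)) = dd x F x"
      unfolding E by (intro sum.cong refl 1)
    also have "(\<Sum>u\<in>Basis. \<Sum>v\<in>(Basis :: 'a set). of_real (x \<bullet> u) * dd u F x) = of_nat DIM('a) * dd x F x"
      unfolding E by (simp add: sum_distrib_left)
    finally show ?thesis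
      unfolding 2 by (simp add: algebra_simps)
  qed
  \<comment> \<open>Each square of an angular derivative is ?T plus ?T with u and v exchanged, so
    the full double sum is twice the sum of ?T.\<close>
  have "rot_laplacian F x = (\<Sum>u\<in>Basis. \<Sum>v\<in>Basis. ?T u v + ?T v u)"
    unfolding rot_laplacian_def by (intro sum.cong refl rr)
  also have "\<dots> = (\<Sum>u\<in>Basis. \<Sum>v\<in>Basis. ?T u v) + (\<Sum>v\<in>Basis. \<Sum>u\<in>Basis. ?T v u)"
    by (subst (2) sum.swap) (simp only: sum.distrib)
  finally show ?thesis unfolding T by simp
qed

text \<open>Euler's identity evaluates the radial derivative to k p and the radial Hessian to k (k -
  1) p. With dimension n, (1 - n) k - k (k - 1) = - k (k + n - 2).\<close>

lemma rot_laplacian_hharm: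
  fixes p :: "'a::euclidean_space \<Rightarrow> complex"
  assumes "hharm k p"
  shows "rot_laplacian p x = - 2 * of_real (real k * (real k + real DIM('a) - 2)) * p x"
proof -
  note p = hharm_hpoly[OF assms]
  have L: "laplacian p x = 0" using assms by (simp add: hharm_def)
  have E: "dd x p x = of_nat k * p x" by (rule hpoly_euler[OF p])
  have "(\<Sum>v\<in>Basis. of_real (x \<bullet> v) * dd v (dd u p) x) = of_nat (k - 1) * dd u p x" for u
    using dd_expand[of "dd u p" x x, OF hpoly_differentiable[OF hpoly_dd[OF p]]] hpoly_euler[OF hpoly_dd[OF p, of u], of x]
    by simp
  then have "(\<Sum>u\<in>Basis. \<Sum>v\<in>Basis. of_real (x \<bullet> u) * (of_real (x \<bullet> v) * dd v (dd u p) x)) =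
      of_nat (k - 1) * (\<Sum>u\<in>Basis. of_real (x \<bullet> u) * dd u p x)"
    by (simp add: sum_distrib_left[symmetric]) (simp add: sum_distrib_left mult_ac)
  also have "(\<Sum>u\<in>Basis. of_real (x \<bullet> u) * dd u p x) = of_nat k * p x"
    using dd_expand[OF hpoly_differentiable[OF p], of x x] E by simp
  finally have Q: "(\<Sum>u\<in>Basis. \<Sum>v\<in>Basis. of_real (x \<bullet> u) * (of_real (x \<bullet> v) * dd v (dd u p) x)) =
      of_nat (k - 1) * (of_nat k * p x)" .
  show ?thesis
    unfolding rot_laplacian_eq[OF open_UNIV UNIV_I Ck_on_hpoly[OF p]] L E Q
    by (cases k) (simp_all add: algebra_simps)
qed

text \<open>The extension is constant on rays, so its radial derivative vanishes off the origin.
  Differentiating this identity radially once more removes the Hessian term as well.\<close>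

lemma rot_laplacian_homogeneous_0:
  fixes \<phi> :: "'a::euclidean_space \<Rightarrow> complex"
  assumes \<phi>: "Ck_on 2 (\<lambda>y. \<phi> (sgn y)) (- {0})" and x: "x \<in> sphere 0 1"
  shows "rot_laplacian (\<lambda>y. \<phi> (sgn y)) x = 2 * laplacian (\<lambda>y. \<phi> (sgn y)) x"
proof -
  let ?F = "\<lambda>y. \<phi> (sgn y)" and ?S = "- {0 :: 'a}"
  have xS: "x \<in> ?S" and xx: "x \<bullet> x = 1" using x by (auto simp: dot_square_norm)
  have F1: "Ck_on (Suc 1) ?F ?S" using \<phi> by (simp add: numeral_2_eq_2)
  have d: "?F differentiable (at y)" if "y \<in> ?S" for y
    by (rule Ck_on_SucD[OF F1 open_Compl0 that])
  have d2: "dd b ?F differentiable (at y)" if "b \<in> Basis" "y \<in> ?S" for b y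
    using Ck_on_Suc_ddD[OF F1 that(1)] by (intro Ck_on_SucD[OF _ open_Compl0 that(2), of 0]) simp
  have E: "dd y ?F y = 0" if "y \<in> ?S" for y
  proof -
    have "((\<lambda>t::real. t *\<^sub>R y) has_derivative (\<lambda>t. t *\<^sub>R y)) (at 1)"
      by (auto intro!: derivative_eq_intros)
    moreover have "(?F has_derivative (\<lambda>u. dd u ?F y)) (at (1 *\<^sub>R y))"
      using has_derivative_dd[OF d[OF that]] by simp
    ultimately have "((\<lambda>t. ?F (t *\<^sub>R y)) has_derivative (\<lambda>t. dd (t *\<^sub>R y) ?F y)) (at (1::real))"
      by (rule has_derivative_compose)
    moreover have "((\<lambda>t. ?F (t *\<^sub>R y)) has_derivative (\<lambda>t. 0)) (at (1::real))"
      by (rule has_derivative_transform_within_open[of "\<lambda>t. ?F y" _ _ _ "{0<..}"])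
        (auto simp: sgn_scaleR)
    ultimately have "(\<lambda>t::real. dd (t *\<^sub>R y) ?F y) = (\<lambda>t. 0)" by (rule has_derivative_unique)
    from fun_cong[OF this, of 1] show ?thesis by simp
  qed
  \<comment> \<open>The radial derivative of the function y \<mapsto> \<open>dd y ?F y\<close>,
    which is zero near x, expanded by the product rule.\<close>
  have "0 = dd x (\<lambda>y. 0) x" by simp
  also have "\<dots> = dd x (\<lambda>y. \<Sum>u\<in>Basis. of_real (y \<bullet> u) * dd u ?F y) x"
    by (rule dd_transform_open[OF open_Compl0 xS]) (use E dd_expand[OF d] in auto)
  also have "\<dots> = (\<Sum>u\<in>Basis. dd x (\<lambda>y. of_real (y \<bullet> u) * dd u ?F y) x)"
    using d2 xS by (intro dd_sum) (auto intro!: differentiable_mult differentiable_coord)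
  also have "\<dots> = (\<Sum>u\<in>Basis. of_real (x \<bullet> u) * dd u ?F x + of_real (x \<bullet> u) * dd x (dd u ?F) x)"
    using d2 xS by (intro sum.cong) (auto simp: dd_coord_mult)
  also have "\<dots> = dd x ?F x + (\<Sum>u\<in>Basis. \<Sum>v\<in>Basis. of_real (x \<bullet> u) * (of_real (x \<bullet> v) * dd v (dd u ?F) x))"
    using d2 xS by (simp add: sum.distrib dd_expand[OF d, of x x] sum_distrib_left[symmetric] dd_expand[of "dd _ ?F" x x])
  finally have "(\<Sum>u\<in>Basis. \<Sum>v\<in>Basis. of_real (x \<bullet> u) * (of_real (x \<bullet> v) * dd v (dd u ?F) x)) = 0"
    using E[OF xS] by simp
  then show ?thesis
    using rot_laplacian_eq[OF open_Compl0 xS \<phi>] E[OF xS] xx by simp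
qed

text \<open>The field \<open>skew u v\<close> is orthogonal to x, so derivatives along it do not see
  radial functions.\<close>

lemma rotd_inverse_norm:
  assumes "x \<noteq> 0"
  shows "rotd u v (\<lambda>x. complex_of_real (inverse (norm x)) ^ k) x = 0"
proof -
  let ?f = "\<lambda>x. complex_of_real (inverse (norm x))"
  have d: "?f differentiable (at x)"
    using inverse_norm_has_derivative[OF assms] by (rule differentiableI)
  have "x \<bullet> skew u v x = 0" by (simp add: skew_def inner_diff_right)
  then have 0: "rotd u v ?f x = 0"
    unfolding rotd_def by (subst dd_eqI[OF inverse_norm_has_derivative[OF assms]]) simp
  have "(\<lambda>x. ?f x ^ k) differentiable (at x) \<and> rotd u v (\<lambda>x. ?f x ^ k) x = 0"
    by (induction k) (use d 0 in \<open>auto simp: rotd_mult rotd_def[of u v "\<lambda>x. 1"] intro!: differentiable_mult\<close>)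
  then show ?thesis ..
qed

text \<open>The extension of degree 0 differs from p by the radial factor |y|^-k, which angular
  derivatives ignore. Hence both have the same \<open>rot_laplacian\<close> on the sphere: for p it
  comes from Euler's identity, for the extension it is twice the Laplacian.\<close>

lemma laplace_beltrami_hharm:
  fixes p :: "'a::euclidean_space \<Rightarrow> complex"
  assumes "hharm k p" and x: "x \<in> sphere 0 1"
  shows "laplace_beltrami p x = of_real (real k * (real k + real DIM('a) - 2)) * p x"
proof -
  note p = hharm_hpoly[OF assms(1)]
  let ?f = "\<lambda>x::'a. complex_of_real (inverse (norm x)) ^ k"
  have eq: "(\<lambda>y. p (sgn y)) = (\<lambda>y. ?f y * p y)" using hpoly_sgn[OF p] by blast
  have smooth: "Ck_on 2 (\<lambda>y. p (sgn y)) (- {0})"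
    using smooth_on_sphere_hpoly[OF p] by (simp add: smooth_on_sphere_def)
  have f: "Ck_on 2 ?f (- {0})"
    by (intro Ck_on_power Ck_on_inverse_norm open_Compl0)
  have df: "?f differentiable (at y)" if "y \<noteq> 0" for y
    using Ck_on_SucD[of 1 ?f "- {0}" y] f that by (simp add: numeral_2_eq_2)
  have R: "rotd u v (\<lambda>y. ?f y * g y) y = ?f y * rotd u v g y"
    if "y \<noteq> 0" "g differentiable (at y)" for u v g and y :: 'a
    using rotd_mult[OF df[OF that(1)] that(2)] rotd_inverse_norm[OF that(1)] by simp
  have "rotd u v (rotd u v (\<lambda>y. ?f y * p y)) x = rotd u v (rotd u v p) x" if uv: "u \<in> Basis" "v \<in> Basis" for u v
  proof -
    have "rotd u v (rotd u v (\<lambda>y. ?f y * p y)) x = rotd u v (\<lambda>y. ?f y * rotd u v p y) x"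
      unfolding rotd_def[of u v "rotd u v (\<lambda>y. ?f y * p y)"] rotd_def[of u v "\<lambda>y. ?f y * rotd u v p y"]
      using x R hpoly_differentiable[OF p] by (intro dd_transform_open[of "- {0}"]) auto
    also have "Ck_on 1 (rotd u v p) UNIV"
      using Ck_on_hpoly[OF p] uv by (intro Ck_on_rotd) auto
    then have "rotd u v (\<lambda>y. ?f y * rotd u v p y) x = ?f x * rotd u v (rotd u v p) x"
      using x Ck_on_SucD[of 0 "rotd u v p" UNIV x] by (intro R) auto
    finally show ?thesis using x by simp
  qed
  then have "rot_laplacian (\<lambda>y. p (sgn y)) x = rot_laplacian p x"
    unfolding eq rot_laplacian_def by (intro sum.cong) auto
  with rot_laplacian_homogeneous_0[of p, OF smooth x] rot_laplacian_hharm[OF assms(1), of x]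
  have "2 * laplacian (\<lambda>y. p (sgn y)) x = - 2 * of_real (real k * (real k + real DIM('a) - 2)) * p x"
    by metis
  moreover have "- l = a * b" if "2 * l = - 2 * a * b" for l a b :: complex
    using that by simp
  ultimately show ?thesis
    unfolding laplace_beltrami_def by blast
qed

lemma laplacian_cnj:
  assumes "Ck_on 2 F S" "open S" "x \<in> S"
  shows "laplacian (\<lambda>x. cnj (F x)) x = cnj (laplacian F x)"
proof -
  have F1: "Ck_on (Suc 1) F S" using assms by (simp add: numeral_2_eq_2)
  have "dd b (dd b (\<lambda>x. cnj (F x))) x = cnj (dd b (dd b F) x)" if "b \<in> Basis" for b
  proof -
    have "dd b (dd b (\<lambda>x. cnj (F x))) x = dd b (\<lambda>x. cnj (dd b F x)) x"
      by (rule dd_transform_open[OF assms(2,3)]) (rule dd_cnj[OF Ck_on_SucD[OF F1 assms(2)]])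
    also have "\<dots> = cnj (dd b (dd b F) x)"
      using Ck_on_Suc_ddD[OF F1 that] by (intro dd_cnj Ck_on_SucD[OF _ assms(2,3), of 0]) simp
    finally show ?thesis .
  qed
  then show ?thesis by (simp add: laplacian_eq_dd)
qed

text \<open>Symmetry of \<open>rot_laplacian\<close> moves the operator from the test function to p.
  There p can keep its extension of degree k, as only derivatives along spheres occur. The test
  function is extended with degree 0, where \<open>rot_laplacian\<close> is twice the Laplacian;
  hence the factor - 1/2.\<close>

lemma laplace_beltrami_L2_hharm:
  fixes p :: "'a::euclidean_space \<Rightarrow> complex"
  assumes "hharm k p"
  shows "laplace_beltrami_L2 p (\<lambda>x. of_real (real k * (real k + real DIM('a) - 2)) * p x)"
  unfolding laplace_beltrami_L2_def
proof (intro conjI allI impI)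
  note p = hharm_hpoly[OF assms]
  let ?l = "complex_of_real (real k * (real k + real DIM('a) - 2))"
  show p2: "p \<in> sphere_L2" by (rule sphere_L2_continuous[OF hpoly_continuous[OF p]])
  then show "(\<lambda>x. ?l * p x) \<in> sphere_L2" by (rule sphere_L2_cmult)
  fix \<phi> :: "'a \<Rightarrow> complex" assume "smooth_on_sphere \<phi>"
  then have \<phi>: "Ck_on 2 (\<lambda>y. \<phi> (sgn y)) (- {0})" by (simp add: smooth_on_sphere_def)
  let ?\<psi> = "\<lambda>y. cnj (\<phi> (sgn y))"
  have \<psi>: "Ck_on 2 ?\<psi> (- {0})" by (rule Ck_on_cnj[OF open_Compl0 \<phi>])
  have 1: "p x * cnj (laplace_beltrami \<phi> x) = - (1/2) * (p x * rot_laplacian ?\<psi> x)" if x: "x \<in> sphere 0 1" for x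
  proof -
    have "rot_laplacian ?\<psi> x = 2 * laplacian ?\<psi> x"
      by (rule rot_laplacian_homogeneous_0[OF \<psi> x])
    also have "laplacian ?\<psi> x = cnj (laplacian (\<lambda>y. \<phi> (sgn y)) x)"
      using x by (intro laplacian_cnj[OF \<phi> open_Compl0]) auto
    finally show ?thesis by (simp add: laplace_beltrami_def)
  qed
  have 2: "- (1/2) * (rot_laplacian p x * ?\<psi> x) = ?l * p x * cnj (\<phi> x)" if "x \<in> sphere 0 1" for x
    using that unfolding rot_laplacian_hharm[OF assms] by (simp add: sgn_div_norm)
  have "L2_inner p (laplace_beltrami \<phi>) = (\<integral>x. - (1/2) * (p x * rot_laplacian ?\<psi> x) \<partial>sphere_measure)"
    unfolding L2_inner_def using 1 by (intro Bochner_Integration.integral_cong) auto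
  also have "\<dots> = - (1/2) * (\<integral>x. p x * rot_laplacian ?\<psi> x \<partial>sphere_measure)"
    by (rule integral_mult_right_zero)
  also have "\<dots> = - (1/2) * (\<integral>x. rot_laplacian p x * ?\<psi> x \<partial>sphere_measure)"
    by (subst integral_rot_laplacian[OF Ck_on_hpoly[OF p] \<psi>]) simp
  also have "\<dots> = (\<integral>x. - (1/2) * (rot_laplacian p x * ?\<psi> x) \<partial>sphere_measure)"
    by (rule integral_mult_right_zero[symmetric])
  also have "\<dots> = L2_inner (\<lambda>x. ?l * p x) \<phi>"
    unfolding L2_inner_def using 2 by (intro Bochner_Integration.integral_cong) auto
  finally show "L2_inner p (laplace_beltrami \<phi>) = L2_inner (\<lambda>x. ?l * p x) \<phi>" .
qed

subsection \<open>Spans of functions\<close>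

text \<open>The vector space \<open>cfun\<close> adds functions by the \<open>+\<close> of function
  algebras; the rules here restate span facts for sums written pointwise.\<close>

lemma cfun_span_plus: "f \<in> cfun.span S \<Longrightarrow> g \<in> cfun.span S \<Longrightarrow> (\<lambda>x. f x + g x) \<in> cfun.span S"
  using cfun.span_add[of f S g] by (simp add: plus_fun_def)

lemma cfun_span_zero: "(\<lambda>x. 0) \<in> cfun.span S"
  using cfun.span_zero[of S] by (simp add: zero_fun_def)

lemma cfun_span_sum: "(\<And>i. i \<in> A \<Longrightarrow> f i \<in> cfun.span S) \<Longrightarrow> (\<lambda>x. \<Sum>i\<in>A. f i x) \<in> cfun.span S"
  by (induction A rule: infinite_finite_induct) (auto intro: cfun_span_plus cfun_span_zero)

lemma cfun_span_induct:
  assumes "f \<in> cfun.span S" "P (\<lambda>x. 0)" "\<And>g. g \<in> S \<Longrightarrow> P g"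
    "\<And>f g. P f \<Longrightarrow> P g \<Longrightarrow> P (\<lambda>x. f x + g x)" "\<And>c f. P f \<Longrightarrow> P (\<lambda>x. c * f x)"
  shows "P f"
proof (rule cfun.span_induct_alt[OF assms(1)])
  show "P 0" using assms(2) by (simp add: zero_fun_def)
  fix c :: complex and x y :: "'a \<Rightarrow> complex" assume "x \<in> S" "P y"
  then show "P ((\<lambda>xa. c * x xa) + y)"
    using assms(4)[OF assms(5)[OF assms(3)]] by (simp add: plus_fun_def)
qed

lemma cfun_sum_apply: "(\<Sum>i\<in>A. f i) x = (\<Sum>i\<in>A. f i x :: complex)"
  by (induction A rule: infinite_finite_induct) (auto simp: plus_fun_def zero_fun_def)

lemma cfun_span_finite_explicit:
  "finite S \<Longrightarrow> f \<in> cfun.span S \<Longrightarrow> \<exists>u. f = (\<lambda>x. \<Sum>g\<in>S. u g * g x)"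
  by (auto simp: cfun.span_finite fun_eq_iff cfun_sum_apply)

lemma cfun_span_image:
  assumes f: "f \<in> cfun.span S" and T0: "T (\<lambda>x. 0) = (\<lambda>x. 0)"
    and T: "\<And>f g. T (\<lambda>x. f x + g x) = (\<lambda>x. T f x + T g x)" "\<And>c f. T (\<lambda>x. c * f x) = (\<lambda>x. c * T f x)"
    and S: "\<And>g. g \<in> S \<Longrightarrow> T g \<in> cfun.span S'"
  shows "T f \<in> cfun.span S'"
  by (rule cfun_span_induct[OF f, of "\<lambda>f. T f \<in> cfun.span S'"])
    (auto simp: T0 T S cfun_span_zero intro: cfun_span_plus cfun.span_scale)


subsection \<open>The dimension of the space of harmonic polynomials\<close>

text \<open>Exponents are lists along a fixed list of coordinates, so that monomials of given degree
  are counted by lists of given length and sum.\<close>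

fun monl :: "'a::euclidean_space list \<Rightarrow> nat list \<Rightarrow> 'a \<Rightarrow> complex" where
  "monl (b # bs) (a # as) x = of_real (x \<bullet> b) ^ a * monl bs as x"
| "monl _ _ x = 1"

definition expo :: "nat \<Rightarrow> nat \<Rightarrow> nat list set"
  where "expo n k = {as. length as = n \<and> sum_list as = k}"

lemma card_expo: "card (expo n k) = (k + n - 1) choose k"
  unfolding expo_def by (rule card_length_sum_list)

lemma finite_expo: "finite (expo n k)"
proof (rule finite_subset)
  show "expo n k \<subseteq> {as. set as \<subseteq> {..k} \<and> length as = n}"
    using member_le_sum_list by (auto simp: expo_def)
  show "finite {as. set as \<subseteq> {..k} \<and> length as = n}" by (rule finite_lists_length_eq) simp
qed

lemma monl_coord:
  "b \<in> set bs \<Longrightarrow> length as = length bs \<Longrightarrow>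
    \<exists>as'. length as' = length bs \<and> sum_list as' = Suc (sum_list as) \<and>
      (\<lambda>x. of_real (x \<bullet> b) * monl bs as x) = monl bs as'"
proof (induction bs arbitrary: as)
  case (Cons c bs)
  then obtain a as0 where as: "as = a # as0" "length as0 = length bs" by (cases as) auto
  show ?case
  proof (cases "b = c")
    case True
    then show ?thesis
      using as by (intro exI[of _ "Suc a # as0"]) (auto simp: mult_ac)
  next
    case False
    then obtain as1 where as1: "length as1 = length bs" "sum_list as1 = Suc (sum_list as0)"
        "(\<lambda>x. of_real (x \<bullet> b) * monl bs as0 x) = monl bs as1"
      using Cons as by auto
    have "of_real (x \<bullet> b) * monl (c # bs) as x = monl (c # bs) (a # as1) x" for x
      using fun_cong[OF as1(3), of x] as by (simp add: mult_ac)
    then show ?thesis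
      using as as1 by (intro exI[of _ "a # as1"]) auto
  qed
qed simp

definition mspan :: "'a::euclidean_space list \<Rightarrow> nat \<Rightarrow> ('a \<Rightarrow> complex) set"
  where "mspan bs k = cfun.span (monl bs ` expo (length bs) k)"

lemma mspan_coord:
  assumes "f \<in> mspan bs k" "b \<in> set bs"
  shows "(\<lambda>x. of_real (x \<bullet> b) * f x) \<in> mspan bs (Suc k)"
  unfolding mspan_def
proof (rule cfun_span_image[of f "monl bs ` expo (length bs) k" "\<lambda>f x. of_real (x \<bullet> b) * f x"])
  fix g assume "g \<in> monl bs ` expo (length bs) k"
  then obtain as where as: "g = monl bs as" "length as = length bs" "sum_list as = k"
    by (auto simp: expo_def)
  obtain as' where "length as' = length bs" "sum_list as' = Suc k" "(\<lambda>x. of_real (x \<bullet> b) * monl bs as x) = monl bs as'"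
    using monl_coord[OF assms(2) as(2)] as(3) by auto
  then show "(\<lambda>x. of_real (x \<bullet> b) * g x) \<in> cfun.span (monl bs ` expo (length bs) (Suc k))"
    unfolding as(1) by (intro cfun.span_base) (auto simp: expo_def)
qed (use assms(1) in \<open>auto simp: mspan_def algebra_simps\<close>)

text \<open>A factor \<open>x \<bullet> e\<close> vanishes on the hyperplane and every other
  coordinate is unchanged, so only monomials in the remaining coordinates survive.\<close>

lemma hpoly_drop_coord_mspan:
  assumes bs: "set bs = Basis - {e}" and e: "e \<in> Basis"
  shows "hpoly k p \<Longrightarrow> (\<lambda>x. p (drop_coord e x)) \<in> mspan bs k"
proof (induction rule: hpoly.induct)
  case (hpoly_const c)
  let ?as = "replicate (length bs) (0::nat)"
  have 1: "monl bs ?as = (\<lambda>x. 1)"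
    by (induction bs) (auto simp: fun_eq_iff)
  have "?as \<in> expo (length bs) 0" by (simp add: expo_def)
  then have "monl bs ?as \<in> mspan bs 0"
    unfolding mspan_def by (intro cfun.span_base imageI)
  from cfun.span_scale[OF this[unfolded mspan_def], of c] show ?case
    by (simp add: 1 mspan_def)
next
  case (hpoly_coord k p b)
  show ?case
  proof (cases "b = e")
    case True
    have "drop_coord e x \<bullet> e = 0" for x using e by (intro drop_coord_inner) simp
    then show ?thesis by (simp add: True mspan_def cfun_span_zero)
  next
    case False
    then have "b \<in> set bs" using bs hpoly_coord(2) by simp
    moreover have "drop_coord e x \<bullet> b = x \<bullet> b" for x
      using False e hpoly_coord(2) by (simp add: drop_coord_def inner_diff_left inner_Basis)
    ultimately show ?thesis using mspan_coord[OF hpoly_coord(3)] by simp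
  qed
next
  case (hpoly_add k p q)
  then show ?case unfolding mspan_def by (intro cfun_span_plus)
qed

text \<open>Both data in one function: the first summand does not involve the coordinate along e and
  the second is linear in it, so neither cancels the other. This embeds harmonic polynomials
  linearly into a span of explicit monomials.\<close>

definition cauchy_data :: "'a::euclidean_space \<Rightarrow> ('a \<Rightarrow> complex) \<Rightarrow> 'a \<Rightarrow> complex"
  where "cauchy_data e p = (\<lambda>x. p (drop_coord e x) + of_real (x \<bullet> e) * dd e p (drop_coord e x))"

lemma cauchy_data_inj:
  assumes e: "e \<in> Basis" and p: "hharm k p" and 0: "cauchy_data e p = (\<lambda>x. 0)"
  shows "p = (\<lambda>x. 0)"
proof -
  have [simp]: "e \<bullet> e = 1" using e by simp
  have "norm e = 1" using e by simp
  note di = drop_coord_inner[OF this]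
  have *: "p (drop_coord e x) + of_real (x \<bullet> e) * dd e p (drop_coord e x) = 0" for x
    using fun_cong[OF 0, of x] by (simp add: cauchy_data_def)
  \<comment> \<open>On the hyperplane the second summand drops out. One unit above it that summand
    has coefficient one, and the first is already known to vanish.\<close>
  have 1: "p (drop_coord e x) = 0" for x
    using *[of "drop_coord e x"] by (simp add: di drop_coord_eq)
  have 2: "dd e p (drop_coord e x) = 0" for x
  proof -
    have "drop_coord e (drop_coord e x + e) = drop_coord e x"
      using di by (simp add: drop_coord_def inner_diff_left inner_add_left)
    moreover have "(drop_coord e x + e) \<bullet> e = 1" by (simp add: inner_add_left di)
    ultimately show ?thesis using *[of "drop_coord e x + e"] 1 by simp
  qed
  show ?thesis using hharm_cauchy_unique[OF e p 1 2] by blast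
qed

text \<open>The two binomials count the monomials of degrees k and k - 1 in one variable less than
  the dimension: the first for the values, the second for the normal derivative.\<close>

lemma cauchy_data_span:
  assumes e: "e \<in> (Basis :: 'a::euclidean_space set)"
  shows "\<exists>S. finite S \<and> card S \<le> ((k + DIM('a) - 2) choose k) + ((k - 1 + DIM('a) - 2) choose (k - 1)) \<and>
    (\<forall>p. hpoly k p \<longrightarrow> cauchy_data e p \<in> cfun.span S)"
proof -
  obtain bs where bs: "set bs = Basis - {e}" "distinct bs"
    using finite_distinct_list[of "Basis - {e}"] by auto
  then have len: "length bs = DIM('a) - 1" using e by (metis distinct_card card_Diff_singleton)
  let ?A = "monl bs ` expo (length bs) k" and ?B = "monl bs ` expo (length bs) (k - 1)"
  let ?B' = "(\<lambda>f x. of_real (x \<bullet> e) * f x) ` ?B"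
  have n: "j + length bs - 1 = j + DIM('a) - 2" for j
    using len DIM_positive[where 'a = 'a] by arith
  have "card ?A \<le> (k + DIM('a) - 2) choose k"
    using card_image_le[OF finite_expo, of "monl bs" "length bs" k] unfolding card_expo n .
  moreover have "card ?B' \<le> (k - 1 + DIM('a) - 2) choose (k - 1)"
    using card_image_le[OF finite_imageI[OF finite_expo], of "\<lambda>f x. of_real (x \<bullet> e) * f x" "monl bs" "length bs" "k - 1"]
      card_image_le[OF finite_expo, of "monl bs" "length bs" "k - 1"] unfolding card_expo n by linarith
  ultimately have "card (?A \<union> ?B') \<le> ((k + DIM('a) - 2) choose k) + ((k - 1 + DIM('a) - 2) choose (k - 1))"
    using card_Un_le[of ?A ?B'] by linarith
  moreover have "cauchy_data e p \<in> cfun.span (?A \<union> ?B')" if p: "hpoly k p" for p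
    unfolding cauchy_data_def
  proof (rule cfun_span_plus)
    have "(\<lambda>x. p (drop_coord e x)) \<in> cfun.span ?A"
      using hpoly_drop_coord_mspan[OF bs(1) e p] by (simp add: mspan_def)
    then show "(\<lambda>x. p (drop_coord e x)) \<in> cfun.span (?A \<union> ?B')"
      using cfun.span_mono[of ?A "?A \<union> ?B'"] by blast
    have "(\<lambda>x. dd e p (drop_coord e x)) \<in> cfun.span ?B"
      using hpoly_drop_coord_mspan[OF bs(1) e hpoly_dd[OF p]] by (simp add: mspan_def)
    then show "(\<lambda>x. of_real (x \<bullet> e) * dd e p (drop_coord e x)) \<in> cfun.span (?A \<union> ?B')"
      by (rule cfun_span_image[where T = "\<lambda>f x. of_real (x \<bullet> e) * f x"])
        (auto simp: algebra_simps intro!: cfun.span_base)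
  qed
  ultimately show ?thesis
    by (intro exI[of _ "?A \<union> ?B'"]) (simp add: finite_expo)
qed

lemma hharm_sum: "(\<And>i. i \<in> A \<Longrightarrow> hharm k (f i)) \<Longrightarrow> hharm k (\<lambda>x. \<Sum>i\<in>A. f i x)"
  by (induction A rule: infinite_finite_induct) (auto intro: hharm_add hharm_zero)

lemma cauchy_data_sum:
  assumes "finite A" "\<And>i. i \<in> A \<Longrightarrow> hpoly k (f i)"
  shows "cauchy_data e (\<lambda>x. \<Sum>i\<in>A. c i * f i x) = (\<lambda>x. \<Sum>i\<in>A. c i * cauchy_data e (f i) x)"
proof -
  have d: "f i differentiable (at x)" if "i \<in> A" for i x
    using hpoly_differentiable assms(2)[OF that] by blast
  have "dd e (\<lambda>x. \<Sum>i\<in>A. c i * f i x) x = (\<Sum>i\<in>A. c i * dd e (f i) x)" for x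
    using assms(1) d by (subst dd_sum) (auto simp: dd_cmult intro!: differentiable_mult)
  then show ?thesis
    by (auto simp: cauchy_data_def sum.distrib sum_distrib_left algebra_simps)
qed

text \<open>A basis is first obtained without any bound on its size. \<open>cauchy_data\<close> maps
  it injectively onto an independent set inside a finite span, and this bounds its
  cardinality.\<close>

lemma hharm_spanning_set:
  "\<exists>I. finite I \<and> card I \<le> ((k + DIM('a) - 2) choose k) + ((k - 1 + DIM('a) - 2) choose (k - 1)) \<and>
    (\<forall>p\<in>I. hharm k p) \<and> (\<forall>p::'a::euclidean_space \<Rightarrow> complex. hharm k p \<longrightarrow> p \<in> cfun.span I)"
proof -
  obtain e :: 'a where e: "e \<in> Basis" using nonempty_Basis by blast
  obtain S where S: "finite S" "card S \<le> ((k + DIM('a) - 2) choose k) + ((k - 1 + DIM('a) - 2) choose (k - 1))"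
    "\<And>p. hpoly k p \<Longrightarrow> cauchy_data e p \<in> cfun.span S"
    using cauchy_data_span[OF e] by blast
  obtain I :: "('a \<Rightarrow> complex) set"
    where I: "I \<subseteq> Collect (hharm k)" "cfun.independent I" "Collect (hharm k) \<subseteq> cfun.span I"
    by (rule cfun.basis_exists[of "Collect (hharm k :: ('a \<Rightarrow> complex) \<Rightarrow> bool)"], rule that, assumption+)
  let ?T = "cauchy_data e"
  have hh: "hharm k p" if "p \<in> I" for p using I(1) that by auto
  have inj: "inj_on ?T I"
  proof (rule inj_onI)
    fix p q assume pq: "p \<in> I" "q \<in> I" "?T p = ?T q"
    have D: "dd e (\<lambda>x. p x - q x) x = dd e p x - dd e q x" for x
      using fun_cong[OF dd_hpoly_diff[OF hharm_hpoly[OF hh[OF pq(1)]] hharm_hpoly[OF hh[OF pq(2)]], of e], of x] .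
    then have "?T (\<lambda>x. p x - q x) x = ?T p x - ?T q x" for x
      unfolding cauchy_data_def D by (simp add: algebra_simps)
    then have "?T (\<lambda>x. p x - q x) = (\<lambda>x. 0)" using pq(3) by auto
    then have "(\<lambda>x. p x - q x) = (\<lambda>x. 0)"
      using cauchy_data_inj[OF e hharm_diff[OF hh[OF pq(1)] hh[OF pq(2)]]] by blast
    then have "p x - q x = 0" for x by (rule fun_cong)
    then show "p = q" by auto
  qed
  have "cfun.independent (?T ` I)"
    unfolding cfun.dependent_explicit
  proof (rule notI, elim exE conjE)
    fix t u assume t: "finite t" "t \<subseteq> ?T ` I" "(\<Sum>v\<in>t. (\<lambda>x. u v * v x)) = 0" "\<exists>v\<in>t. u v \<noteq> 0"
    obtain t' where t': "t' \<subseteq> I" "t = ?T ` t'" using t(2) subset_imageE by metis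
    have inj': "inj_on ?T t'" using inj t'(1) inj_on_subset by blast
    have fin: "finite t'" using t(1) t'(2) inj' finite_image_iff by blast
    let ?p = "\<lambda>x. \<Sum>p\<in>t'. u (?T p) * p x"
    have "?T ?p = (\<lambda>x. \<Sum>p\<in>t'. u (?T p) * ?T p x)"
      using fin t'(1) hh by (intro cauchy_data_sum) (auto intro: hharm_hpoly)
    also have "\<dots> = (\<lambda>x. 0)"
    proof
      fix x
      have "(\<Sum>p\<in>t'. u (?T p) * ?T p x) = (\<Sum>v\<in>t. u v * v x)"
        unfolding t'(2) sum.reindex[OF inj'] by (simp only: o_def)
      also have "\<dots> = 0" using fun_cong[OF t(3), of x] by (simp add: cfun_sum_apply)
      finally show "(\<Sum>p\<in>t'. u (?T p) * ?T p x) = 0" .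
    qed
    finally have T0: "?T ?p = (\<lambda>x. 0)" .
    have "hharm k ?p"
      by (intro hharm_sum hharm_cmult hh) (use t'(1) in blast)
    from cauchy_data_inj[OF e this T0] have "?p = (\<lambda>x. 0)" .
    then have "(\<Sum>p\<in>t'. (\<lambda>x. u (?T p) * p x)) = 0"
      by (auto simp: fun_eq_iff cfun_sum_apply)
    moreover have "\<exists>p\<in>t'. u (?T p) \<noteq> 0" using t(4) t'(2) by auto
    ultimately have "cfun.dependent I"
      unfolding cfun.dependent_explicit using fin t'(1)
      by (intro exI[of _ t'] exI[of _ "\<lambda>p. u (?T p)"]) auto
    then show False using I(2) by simp
  qed
  moreover have "?T ` I \<subseteq> cfun.span S" using S(3) hh hharm_hpoly by blast
  ultimately have "finite (?T ` I) \<and> card (?T ` I) \<le> card S"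
    using cfun.independent_span_bound[OF S(1)] by blast
  then have "finite I" "card I \<le> card S"
    using finite_image_iff[OF inj] card_image[OF inj] by simp_all
  then show ?thesis
    using S(2) I hh by (intro exI[of _ I]) auto
qed


subsection \<open>Orthonormal bases\<close>

text \<open>For such functions norm zero means equal to the zero function, so orthogonalization can
  work with equality of functions instead of equality almost everywhere.\<close>

definition sphere_fun :: "('a::euclidean_space \<Rightarrow> complex) \<Rightarrow> bool"
  where "sphere_fun f \<longleftrightarrow> continuous_on (sphere 0 1) f \<and> (\<forall>x. x \<notin> sphere 0 1 \<longrightarrow> f x = 0)"

lemma sphere_fun_L2: "sphere_fun f \<Longrightarrow> f \<in> sphere_L2"
  by (simp add: sphere_fun_def sphere_L2_continuous)

lemma sphere_fun_zero: "sphere_fun (\<lambda>x. 0)"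
  by (simp add: sphere_fun_def)

lemma sphere_fun_add: "sphere_fun f \<Longrightarrow> sphere_fun g \<Longrightarrow> sphere_fun (\<lambda>x. f x + g x)"
  by (auto simp: sphere_fun_def intro: continuous_on_add)

lemma sphere_fun_diff: "sphere_fun f \<Longrightarrow> sphere_fun g \<Longrightarrow> sphere_fun (\<lambda>x. f x - g x)"
  by (auto simp: sphere_fun_def intro: continuous_on_diff)

lemma sphere_fun_cmult: "sphere_fun f \<Longrightarrow> sphere_fun (\<lambda>x. c * f x)"
  by (auto simp: sphere_fun_def intro: continuous_on_mult continuous_on_const)

lemma sphere_fun_sum: "(\<And>i. i \<in> A \<Longrightarrow> sphere_fun (f i)) \<Longrightarrow> sphere_fun (\<lambda>x. \<Sum>i\<in>A. f i x)"
  by (induction A rule: infinite_finite_induct) (auto intro: sphere_fun_add sphere_fun_zero)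

lemma sphere_fun_norm_zero:
  assumes "sphere_fun f" "L2_norm f = 0" shows "f = (\<lambda>x. 0)"
proof
  fix x show "f x = 0"
    using assms continuous_sphere_integral_zero[of f x] L2_norm_sq[of f] by (auto simp: sphere_fun_def)
qed

definition orthonormal :: "('a::euclidean_space \<Rightarrow> complex) set \<Rightarrow> bool"
  where "orthonormal E \<longleftrightarrow> finite E \<and> (\<forall>e\<in>E. sphere_fun e) \<and>
    (\<forall>e\<in>E. \<forall>e'\<in>E. L2_inner e e' = (if e = e' then 1 else 0))"

lemma orthonormal_coeff:
  assumes E: "orthonormal E" and e: "e \<in> E"
  shows "L2_inner (\<lambda>x. \<Sum>e\<in>E. u e * e x) e = u e"
proof -
  have "L2_inner (\<lambda>x. \<Sum>e\<in>E. u e * e x) e = (\<Sum>e'\<in>E. L2_inner (\<lambda>x. u e' * e' x) e)"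
    using E e by (intro L2_inner_sum_left sphere_L2_cmult) (auto simp: orthonormal_def sphere_fun_L2)
  also have "\<dots> = (\<Sum>e'\<in>E. if e' = e then u e' else 0)"
    using E e by (intro sum.cong) (auto simp: L2_inner_cmult_left orthonormal_def)
  also have "\<dots> = u e" using E e by (simp add: orthonormal_def)
  finally show ?thesis .
qed

lemma orthonormal_expand:
  assumes E: "orthonormal E" and f: "f \<in> cfun.span E"
  shows "f = (\<lambda>x. \<Sum>e\<in>E. L2_inner f e * e x)"
proof -
  obtain u where u: "f = (\<lambda>x. \<Sum>e\<in>E. u e * e x)"
    using cfun_span_finite_explicit[OF _ f] E by (auto simp: orthonormal_def)
  have "L2_inner f e = u e" if "e \<in> E" for e
    unfolding u by (rule orthonormal_coeff[OF E that])
  then have "(\<lambda>x. \<Sum>e\<in>E. L2_inner f e * e x) = (\<lambda>x. \<Sum>e\<in>E. u e * e x)"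
    by (intro ext sum.cong) auto
  then show ?thesis using u by simp
qed

lemma orthonormal_independent:
  assumes E: "orthonormal E" shows "cfun.independent E"
  unfolding cfun.dependent_explicit
proof (rule notI, elim exE conjE bexE)
  fix t u v assume t: "finite t" "t \<subseteq> E" "(\<Sum>v\<in>t. (\<lambda>x. u v * v x)) = 0" and v: "v \<in> t" "u v \<noteq> 0"
  have "orthonormal t" using E t(1,2) by (simp add: orthonormal_def subset_iff)
  moreover have "(\<lambda>x. \<Sum>e\<in>t. u e * e x) = (\<lambda>x. 0)"
    using t(3) by (auto simp: fun_eq_iff cfun_sum_apply)
  ultimately have "u v = L2_inner (\<lambda>x. 0) v"
    using orthonormal_coeff[of t v u] v(1) by simp
  then show False using v(2) by (simp add: L2_inner_def)
qed

lemma gram_schmidt: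
  assumes "finite B" "\<And>f. f \<in> B \<Longrightarrow> sphere_fun f"
  shows "\<exists>E. orthonormal E \<and> cfun.span E = cfun.span B"
  using assms
proof (induction B rule: finite_induct)
  case empty
  show ?case by (intro exI[of _ "{}"]) (simp add: orthonormal_def)
next
  case (insert f B)
  then obtain E where E: "orthonormal E" "cfun.span E = cfun.span B" by auto
  define g where "g = (\<lambda>x. f x - (\<Sum>e\<in>E. L2_inner f e * e x))"
  have f: "sphere_fun f" using insert by simp
  have P: "sphere_fun (\<lambda>x. \<Sum>e\<in>E. L2_inner f e * e x)"
    using E by (intro sphere_fun_sum sphere_fun_cmult) (auto simp: orthonormal_def)
  have g: "sphere_fun g" unfolding g_def by (rule sphere_fun_diff[OF f P])
  have PE: "(\<lambda>x. \<Sum>e\<in>E. L2_inner f e * e x) \<in> cfun.span E"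
    by (intro cfun_span_sum cfun.span_scale cfun.span_base)
  have orth: "L2_inner g e = 0" if "e \<in> E" for e
    using E(1) that unfolding g_def
    by (subst L2_inner_diff_left[OF sphere_fun_L2[OF f] sphere_fun_L2[OF P]])
      (auto simp: orthonormal_coeff sphere_fun_L2 orthonormal_def[of E])
  show ?case
  proof (cases "L2_norm g = 0")
    \<comment> \<open>A remainder of norm zero vanishes identically, so f adds nothing to the
      span.\<close>
    case True
    then have "f = (\<lambda>x. \<Sum>e\<in>E. L2_inner f e * e x)"
      using sphere_fun_norm_zero[OF g] by (auto simp: g_def fun_eq_iff)
    then have "f \<in> cfun.span B"
      using PE unfolding E(2) by (rule ssubst[of f _ "\<lambda>h. h \<in> cfun.span B"])
    then have "cfun.span (insert f B) = cfun.span B"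
      by (rule cfun.span_redundant)
    then show ?thesis using E by auto
  next
    case False
    define e0 where "e0 = (\<lambda>x. of_real (1 / L2_norm g) * g x)"
    have e0: "sphere_fun e0" unfolding e0_def by (rule sphere_fun_cmult[OF g])
    have n0: "L2_inner e0 e0 = 1"
    proof -
      have "(L2_norm e0)\<^sup>2 = 1"
        unfolding e0_def L2_norm_sq_cmult using False by (simp add: norm_divide power_divide)
      then show ?thesis by (simp add: L2_inner_self)
    qed
    have o: "L2_inner e0 e = 0" "L2_inner e e0 = 0" if "e \<in> E" for e
    proof -
      show 1: "L2_inner e0 e = 0" unfolding e0_def L2_inner_cmult_left using orth[OF that] by simp
      show "L2_inner e e0 = 0" using 1 L2_inner_cnj[of e e0] by simp
    qed
    have "orthonormal (insert e0 E)"
      using E(1) e0 n0 o by (auto simp: orthonormal_def)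
    moreover have "cfun.span (insert e0 E) = cfun.span (insert f B)"
    proof (rule cfun.span_eq[THEN iffD2], rule conjI)
      have fB: "f \<in> cfun.span (insert f B)" by (intro cfun.span_base) simp
      have EB: "cfun.span E \<subseteq> cfun.span (insert f B)"
        unfolding E(2) by (rule cfun.span_mono) auto
      have "(\<lambda>x. f x + (-1) * (\<Sum>e\<in>E. L2_inner f e * e x)) \<in> cfun.span (insert f B)"
        using fB EB PE by (intro cfun_span_plus cfun.span_scale) auto
      then have "g \<in> cfun.span (insert f B)" by (simp add: g_def)
      then have "e0 \<in> cfun.span (insert f B)" unfolding e0_def by (rule cfun.span_scale)
      then show "insert e0 E \<subseteq> cfun.span (insert f B)"
        using EB cfun.span_superset[of E] by auto
      have e0E: "e0 \<in> cfun.span (insert e0 E)" by (intro cfun.span_base) simp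
      have EE: "cfun.span E \<subseteq> cfun.span (insert e0 E)"
        by (rule cfun.span_mono) auto
      have "(\<lambda>x. of_real (L2_norm g) * e0 x + (\<Sum>e\<in>E. L2_inner f e * e x)) \<in> cfun.span (insert e0 E)"
        using e0E EE PE by (intro cfun_span_plus cfun.span_scale) auto
      moreover have "(\<lambda>x. of_real (L2_norm g) * e0 x + (\<Sum>e\<in>E. L2_inner f e * e x)) = f"
        using False by (simp add: e0_def g_def)
      ultimately have "f \<in> cfun.span (insert e0 E)" by simp
      then show "insert f B \<subseteq> cfun.span (insert e0 E)"
        using EE E(2) cfun.span_superset[of B] by auto
    qed
    ultimately show ?thesis by blast
  qed
qed

subsection \<open>Spherical harmonics are restrictions of harmonic polynomials\<close>

definition sphere_restrict :: "('a::euclidean_space \<Rightarrow> complex) \<Rightarrow> 'a \<Rightarrow> complex"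
  where "sphere_restrict p = (\<lambda>x. if x \<in> sphere 0 1 then p x else 0)"

lemma sphere_restrict_eq: "x \<in> sphere 0 1 \<Longrightarrow> sphere_restrict p x = p x"
  by (simp add: sphere_restrict_def)

lemma sphere_fun_restrict:
  assumes "hpoly k p" shows "sphere_fun (sphere_restrict p)"
  unfolding sphere_fun_def
proof (intro conjI allI impI)
  show "continuous_on (sphere 0 1) (sphere_restrict p)"
    by (rule continuous_on_eq[OF hpoly_continuous[OF assms]]) (rule sphere_restrict_eq[symmetric])
qed (simp add: sphere_restrict_def)

lemma DIM_option: "DIM(real ^ ('d::finite option)) = Suc CARD('d)"
  by (simp add: UNIV_option_conv card_image)

lemma lb_eigenvalue_strict_mono: "0 < d \<Longrightarrow> k < l \<Longrightarrow> lb_eigenvalue d k < lb_eigenvalue d l"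
  unfolding lb_eigenvalue_def by (intro mult_strict_mono) auto

lemma lb_eigenvalue_inj: "0 < d \<Longrightarrow> lb_eigenvalue d k = lb_eigenvalue d l \<Longrightarrow> k = l"
  using lb_eigenvalue_strict_mono[of d k l] lb_eigenvalue_strict_mono[of d l k] by linarith

lemma lb_eigenvalue_nonneg: "0 < d \<Longrightarrow> 0 \<le> lb_eigenvalue d k"
  using lb_eigenvalue_strict_mono[of d 0 k] by (cases k) (auto simp: lb_eigenvalue_def)

lemma lb_eigenvalue_DIM:
  "lb_eigenvalue CARD('d) k = real k * (real k + real DIM(real ^ ('d::finite option)) - 2)"
  unfolding DIM_option by (simp add: lb_eigenvalue_def)

lemma L2_inner_cmult_right: "L2_inner f (\<lambda>x. c * q x) = cnj c * L2_inner f q"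
  using L2_inner_cmult_left[of c q f] L2_inner_cnj[of f "\<lambda>x. c * q x"] L2_inner_cnj[of f q] by simp

lemma L2_inner_sum_right:
  assumes "\<And>i. i \<in> A \<Longrightarrow> f i \<in> sphere_L2" "q \<in> sphere_L2"
  shows "L2_inner q (\<lambda>x. \<Sum>i\<in>A. f i x) = (\<Sum>i\<in>A. L2_inner q (f i))"
proof -
  have "L2_inner q (\<lambda>x. \<Sum>i\<in>A. f i x) = cnj (\<Sum>i\<in>A. L2_inner (f i) q)"
    using L2_inner_sum_left[of A f q] assms L2_inner_cnj[of q "\<lambda>x. \<Sum>i\<in>A. f i x"] by simp
  also have "\<dots> = (\<Sum>i\<in>A. L2_inner q (f i))"
    unfolding cnj_sum by (intro sum.cong refl L2_inner_cnj[symmetric])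
  finally show ?thesis .
qed

lemma laplace_beltrami_L2_cong:
  assumes "laplace_beltrami_L2 f u" "\<And>x. x \<in> sphere 0 1 \<Longrightarrow> f x = f' x" "\<And>x. x \<in> sphere 0 1 \<Longrightarrow> u x = u' x"
  shows "laplace_beltrami_L2 f' u'"
proof -
  have "L2_inner f' q = L2_inner f q" "L2_inner u' q = L2_inner u q" for q
    using assms(2,3) by (intro L2_inner_cong; simp)+
  then show ?thesis
    using assms(1) sphere_L2_cong[of f f'] sphere_L2_cong[of u u'] assms(2,3)
    unfolding laplace_beltrami_L2_def by metis
qed

lemma sphere_restrict_in_harmonics:
  fixes p :: "real ^ ('d::finite option) \<Rightarrow> complex"
  assumes "hharm k p" shows "sphere_restrict p \<in> harmonics k"
  unfolding harmonics_def mem_Collect_eq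
proof (intro conjI)
  have "sphere_fun (sphere_restrict p)" by (rule sphere_fun_restrict[OF hharm_hpoly[OF assms]])
  then show "continuous_on (sphere 0 1) (sphere_restrict p)" "\<forall>x. x \<notin> sphere 0 1 \<longrightarrow> sphere_restrict p x = 0"
    by (auto simp: sphere_fun_def)
  show "laplace_beltrami_L2 (sphere_restrict p) (\<lambda>x. of_real (lb_eigenvalue CARD('d) k) * sphere_restrict p x)"
    by (rule laplace_beltrami_L2_cong[OF laplace_beltrami_L2_hharm[OF assms]])
      (simp_all only: sphere_restrict_eq lb_eigenvalue_DIM)
qed

lemma harmonics_sphere_fun: "f \<in> harmonics k \<Longrightarrow> sphere_fun f"
  by (auto simp: harmonics_def sphere_fun_def)

lemma harmonics_L2: "f \<in> harmonics k \<Longrightarrow> f \<in> sphere_L2"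
  by (rule sphere_fun_L2[OF harmonics_sphere_fun])

lemma hharm_L2: "hharm k p \<Longrightarrow> p \<in> sphere_L2"
  by (rule sphere_L2_continuous[OF hpoly_continuous[OF hharm_hpoly]])

text \<open>Only q has to be smooth: it is the test function in the weak eigenvalue equation of f.
  Comparing the two distinct eigenvalues gives zero.\<close>

lemma harmonics_orth_hharm:
  fixes f :: "real ^ ('d::finite option) \<Rightarrow> complex"
  assumes f: "f \<in> harmonics k" and q: "hharm l q" and kl: "k \<noteq> l"
  shows "L2_inner f q = 0"
proof -
  have "L2_inner f (laplace_beltrami q) = L2_inner (\<lambda>x. of_real (lb_eigenvalue CARD('d) k) * f x) q"
    using f smooth_on_sphere_hpoly[OF hharm_hpoly[OF q]] by (simp add: harmonics_def laplace_beltrami_L2_def)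
  also have "\<dots> = of_real (lb_eigenvalue CARD('d) k) * L2_inner f q"
    by (rule L2_inner_cmult_left)
  also have "L2_inner f (laplace_beltrami q) = L2_inner f (\<lambda>x. of_real (lb_eigenvalue CARD('d) l) * q x)"
    unfolding lb_eigenvalue_DIM by (rule L2_inner_cong) (auto simp: laplace_beltrami_hharm[OF q])
  also have "\<dots> = of_real (lb_eigenvalue CARD('d) l) * L2_inner f q"
    by (simp add: L2_inner_cmult_right)
  finally show ?thesis using lb_eigenvalue_inj[of "CARD('d)" k l] kl by auto
qed

text \<open>Equality is demanded on the sphere only, where the powers of the norm become 1. The
  family is total and zero beyond N, so that sums of different lengths can be added.\<close>

definition harmonic_sum :: "('a::euclidean_space \<Rightarrow> complex) \<Rightarrow> bool"
  where "harmonic_sum p \<longleftrightarrow> (\<exists>N q. (\<forall>l. hharm l (q l)) \<and> (\<forall>l>N. q l = (\<lambda>x. 0)) \<and>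
    (\<forall>x\<in>sphere 0 1. p x = (\<Sum>l\<le>N. q l x)))"

lemma harmonic_sum_add:
  assumes "harmonic_sum p" "harmonic_sum p'"
  shows "harmonic_sum (\<lambda>x. p x + p' x)"
proof -
  obtain N q N' q' where q: "\<forall>l. hharm l (q l)" "\<forall>l>N. q l = (\<lambda>x. 0)" "\<forall>x\<in>sphere 0 1. p x = (\<Sum>l\<le>N. q l x)"
    and q': "\<forall>l. hharm l (q' l)" "\<forall>l>N'. q' l = (\<lambda>x. 0)" "\<forall>x\<in>sphere 0 1. p' x = (\<Sum>l\<le>N'. q' l x)"
    using assms unfolding harmonic_sum_def by blast
  let ?M = "max N N'"
  have e: "(\<Sum>l\<le>K. r l x) = (\<Sum>l\<le>?M. r l x)"
    if "K \<le> ?M" "\<forall>l>K. r l = (\<lambda>x. 0)" for x K and r :: "nat \<Rightarrow> 'a \<Rightarrow> complex"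
    using that by (intro sum.mono_neutral_left) (auto simp: not_le)
  have "p x + p' x = (\<Sum>l\<le>?M. q l x + q' l x)" if "x \<in> sphere 0 1" for x
    using q(3) q'(3) that e[of N q x] e[of N' q' x] q(2) q'(2) by (simp add: sum.distrib)
  moreover have "\<forall>l. hharm l (\<lambda>x. q l x + q' l x)" using q(1) q'(1) hharm_add by blast
  moreover have "\<forall>l>?M. (\<lambda>x. q l x + q' l x) = (\<lambda>x. 0)" using q(2) q'(2) by simp
  ultimately show ?thesis
    unfolding harmonic_sum_def by (intro exI[of _ ?M] exI[of _ "\<lambda>l x. q l x + q' l x"]) blast
qed

lemma decomposable_harmonic_sum: "decomposable k p \<Longrightarrow> harmonic_sum p"
proof (induction rule: decomposable.induct)
  case (decomposable_base l h j)
  let ?q = "\<lambda>i. if i = l then h else (\<lambda>x. 0)"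
  have "of_real (x \<bullet> x) ^ j * h x = (\<Sum>i\<le>l. ?q i x)" if "x \<in> sphere 0 1" for x
  proof -
    have "(\<Sum>i\<le>l. ?q i x) = (\<Sum>i\<le>l. if i = l then h x else 0)" by (intro sum.cong) auto
    also have "\<dots> = h x" by simp
    finally show ?thesis using that by (simp add: dot_square_norm)
  qed
  moreover have "\<forall>i. hharm i (?q i)" using decomposable_base by (simp add: hharm_zero)
  ultimately show ?case unfolding harmonic_sum_def by (intro exI[of _ l] exI[of _ ?q]) simp
next
  case (decomposable_add k p p')
  show ?case by (rule harmonic_sum_add[OF decomposable_add(3,4)])
qed

lemma cpoly_harmonic_sum: "cpoly p \<Longrightarrow> harmonic_sum p"
proof (induction rule: cpoly.induct)
  case (cpoly_hpoly k p)
  then show ?case by (rule decomposable_harmonic_sum[OF hpoly_decomposable])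
next
  case (cpoly_add p p')
  show ?case by (rule harmonic_sum_add[OF cpoly_add(3,4)])
qed

lemma harmonic_sum_dense:
  assumes "f \<in> sphere_L2" "\<epsilon> > 0"
  shows "\<exists>N q. (\<forall>l. hharm l (q l)) \<and> (\<forall>l>N. q l = (\<lambda>x. 0)) \<and> (L2_norm (\<lambda>x. f x - (\<Sum>l\<le>N. q l x)))\<^sup>2 < \<epsilon>"
proof -
  obtain p where p: "cpoly p" "(L2_norm (\<lambda>x. f x - p x))\<^sup>2 < \<epsilon>"
    using cpoly_dense[OF assms] by blast
  obtain N q where q: "\<forall>l. hharm l (q l)" "\<forall>l>N. q l = (\<lambda>x. 0)" "\<forall>x\<in>sphere 0 1. p x = (\<Sum>l\<le>N. q l x)"
    using cpoly_harmonic_sum[OF p(1)] unfolding harmonic_sum_def by blast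
  have "L2_norm (\<lambda>x. f x - p x) = L2_norm (\<lambda>x. f x - (\<Sum>l\<le>N. q l x))"
    by (rule L2_norm_cong) (use q(3) in simp)
  with p(2) q show ?thesis by (intro exI[of _ N] exI[of _ q]) simp
qed

text \<open>By Pythagoras the norm of f is at most its distance to any finite sum of harmonic
  polynomials, and these are dense.\<close>

lemma orthogonal_to_all_zero:
  assumes f: "f \<in> sphere_L2" and 0: "\<And>l q. hharm l q \<Longrightarrow> L2_inner f q = 0"
  shows "L2_norm f = 0"
proof -
  have "(L2_norm f)\<^sup>2 < \<epsilon>" if "\<epsilon> > 0" for \<epsilon>
  proof -
    obtain N q where q: "\<forall>l. hharm l (q l)" "(L2_norm (\<lambda>x. f x - (\<Sum>l\<le>N. q l x)))\<^sup>2 < \<epsilon>"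
      using harmonic_sum_dense[OF f \<open>\<epsilon> > 0\<close>] by blast
    let ?g = "\<lambda>x. (-1) * (\<Sum>l\<le>N. q l x)"
    have s: "(\<lambda>x. \<Sum>l\<le>N. q l x) \<in> sphere_L2"
      by (intro sphere_L2_sum hharm_L2[OF q(1)[rule_format]])
    have "L2_inner f (\<lambda>x. \<Sum>l\<le>N. q l x) = (\<Sum>l\<le>N. L2_inner f (q l))"
      by (intro L2_inner_sum_right f hharm_L2[OF q(1)[rule_format]])
    also have "\<dots> = 0" by (intro sum.neutral ballI 0[OF q(1)[rule_format]])
    finally have "L2_inner f ?g = 0" unfolding L2_inner_cmult_right by simp
    from L2_norm_sq_add_orthogonal[OF f sphere_L2_cmult[OF s] this] q(2)
    have "(L2_norm f)\<^sup>2 + (L2_norm ?g)\<^sup>2 < \<epsilon>" by simp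
    then show ?thesis using zero_le_power2[of "L2_norm ?g"] by linarith
  qed
  \<comment> \<open>If the squared norm were positive, it could serve as \<epsilon> and would be
    smaller than itself.\<close>
  from this[of "(L2_norm f)\<^sup>2"] show ?thesis by (cases "L2_norm f = 0") auto
qed

lemma sphere_restrict_add: "sphere_restrict (\<lambda>x. p x + q x) = (\<lambda>x. sphere_restrict p x + sphere_restrict q x)"
  and sphere_restrict_cmult: "sphere_restrict (\<lambda>x. c * p x) = (\<lambda>x. c * sphere_restrict p x)"
  and sphere_restrict_zero: "sphere_restrict (\<lambda>x. 0) = (\<lambda>x. 0)"
  by (auto simp: sphere_restrict_def)

text \<open>Restriction is linear and carries a spanning set to a spanning set. The orthonormal
  basis is independent, hence not larger, and inherits the bound on the cardinality.\<close>

lemma sphere_restrict_basis: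
  "\<exists>E. orthonormal E \<and> cfun.span E = sphere_restrict ` Collect (hharm k :: ('a::euclidean_space \<Rightarrow> complex) \<Rightarrow> bool) \<and>
    card E \<le> ((k + DIM('a) - 2) choose k) + ((k - 1 + DIM('a) - 2) choose (k - 1))"
proof -
  obtain I :: "('a \<Rightarrow> complex) set" where I: "finite I" "card I \<le> ((k + DIM('a) - 2) choose k) + ((k - 1 + DIM('a) - 2) choose (k - 1))"
    "\<forall>p\<in>I. hharm k p" "\<forall>p. hharm k p \<longrightarrow> p \<in> cfun.span I"
    using hharm_spanning_set[of k] by metis
  let ?B = "sphere_restrict ` I"
  have "sphere_fun f" if "f \<in> ?B" for f
    using that I(3) by (auto intro: sphere_fun_restrict hharm_hpoly)
  then obtain E where E: "orthonormal E" "cfun.span E = cfun.span ?B"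
    using gram_schmidt[of ?B] I(1) by blast
  have "cfun.span ?B = sphere_restrict ` Collect (hharm k)"
  proof (intro equalityI subsetI)
    fix f :: "'a \<Rightarrow> complex" assume "f \<in> cfun.span ?B"
    then show "f \<in> sphere_restrict ` Collect (hharm k)"
    proof (rule cfun_span_induct)
      show "(\<lambda>x. 0) \<in> sphere_restrict ` Collect (hharm k)"
        by (rule image_eqI[of _ _ "\<lambda>x. 0"]) (simp_all add: sphere_restrict_zero hharm_zero)
    next
      fix g assume "g \<in> ?B" then show "g \<in> sphere_restrict ` Collect (hharm k)" using I(3) by auto
    next
      fix f g :: "'a \<Rightarrow> complex"
      assume "f \<in> sphere_restrict ` Collect (hharm k)" "g \<in> sphere_restrict ` Collect (hharm k)"
      then obtain p q where "f = sphere_restrict p" "g = sphere_restrict q" "hharm k p" "hharm k q" by auto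
      then show "(\<lambda>x. f x + g x) \<in> sphere_restrict ` Collect (hharm k)"
        by (intro image_eqI[of _ _ "\<lambda>x. p x + q x"]) (simp_all add: sphere_restrict_add hharm_add)
    next
      fix c and f :: "'a \<Rightarrow> complex"
      assume "f \<in> sphere_restrict ` Collect (hharm k)"
      then obtain p where "f = sphere_restrict p" "hharm k p" by auto
      then show "(\<lambda>x. c * f x) \<in> sphere_restrict ` Collect (hharm k)"
        by (intro image_eqI[of _ _ "\<lambda>x. c * p x"]) (simp_all add: sphere_restrict_cmult hharm_cmult)
    qed
  next
    fix f :: "'a \<Rightarrow> complex" assume "f \<in> sphere_restrict ` Collect (hharm k)"
    then obtain p where p: "f = sphere_restrict p" "p \<in> cfun.span I" using I(4) by auto
    show "f \<in> cfun.span ?B"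
      unfolding p(1)
      by (rule cfun_span_image[OF p(2)])
        (auto simp: sphere_restrict_zero sphere_restrict_add sphere_restrict_cmult intro: cfun.span_base)
  qed
  moreover have "card E \<le> card ?B"
    using cfun.independent_span_bound[OF _ orthonormal_independent[OF E(1)], of ?B] I(1) E(2) cfun.span_superset[of E]
    by auto
  moreover have "card ?B \<le> card I" by (rule card_image_le[OF I(1)])
  ultimately show ?thesis using E I(2) by (intro exI[of _ E]) auto
qed

text \<open>Subtract from f its projection onto the restricted polynomials of degree k. The rest is
  orthogonal to those by construction and to the other degrees by
  \<open>harmonics_orth_hharm\<close>, applied to f and to the projection. So it has norm zero and,
  being continuous and zero off the sphere, vanishes.\<close>

lemma harmonics_eq:
  "(harmonics k :: (real ^ ('d::finite option) \<Rightarrow> complex) set) = sphere_restrict ` Collect (hharm k)"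
proof (intro equalityI subsetI)
  fix f :: "real ^ ('d option) \<Rightarrow> complex" assume f: "f \<in> harmonics k"
  obtain E :: "(real ^ ('d option) \<Rightarrow> complex) set"
    where E: "orthonormal E" "cfun.span E = sphere_restrict ` Collect (hharm k)"
    using sphere_restrict_basis by blast
  let ?P = "\<lambda>x. \<Sum>e\<in>E. L2_inner f e * e x"
  have "?P \<in> cfun.span E"
    by (intro cfun_span_sum cfun.span_scale cfun.span_base)
  then obtain P where P: "hharm k P" "?P = sphere_restrict P" unfolding E(2) by auto
  have PF: "sphere_fun ?P" unfolding P(2) by (rule sphere_fun_restrict[OF hharm_hpoly[OF P(1)]])
  have PH: "?P \<in> harmonics k" unfolding P(2) by (rule sphere_restrict_in_harmonics[OF P(1)])
  let ?g = "\<lambda>x. f x - ?P x"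
  have g: "sphere_fun ?g" by (rule sphere_fun_diff[OF harmonics_sphere_fun[OF f] PF])
  have diff: "L2_inner ?g q = L2_inner f q - L2_inner ?P q" if "q \<in> sphere_L2" for q
    by (rule L2_inner_diff_left[OF harmonics_L2[OF f] sphere_fun_L2[OF PF] that])
  have gE: "L2_inner ?g e = 0" if "e \<in> E" for e
    using E(1) that orthonormal_coeff[OF E(1) that, of "L2_inner f"]
    by (subst diff) (auto simp: orthonormal_def sphere_fun_L2)
  have "L2_inner ?g q = 0" if q: "hharm l q" for l q
  proof (cases "l = k")
    case False
    then show ?thesis
      using harmonics_orth_hharm[OF f q] harmonics_orth_hharm[OF PH q] by (simp add: diff hharm_L2[OF q])
  next
    case True
    then have "sphere_restrict q \<in> cfun.span E" using q E(2) by auto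
    from orthonormal_expand[OF E(1) this]
    have "L2_inner ?g (sphere_restrict q) = L2_inner ?g (\<lambda>x. \<Sum>e\<in>E. L2_inner (sphere_restrict q) e * e x)"
      by simp
    also have "\<dots> = (\<Sum>e\<in>E. L2_inner ?g (\<lambda>x. L2_inner (sphere_restrict q) e * e x))"
      using E(1) by (intro L2_inner_sum_right sphere_L2_cmult sphere_fun_L2[OF g]) (auto simp: orthonormal_def sphere_fun_L2)
    also have "\<dots> = 0" using gE by (simp add: L2_inner_cmult_right)
    also have "L2_inner ?g (sphere_restrict q) = L2_inner ?g q"
      by (rule L2_inner_cong) (auto simp: sphere_restrict_eq)
    finally show ?thesis .
  qed
  from orthogonal_to_all_zero[OF sphere_fun_L2[OF g] this] have "L2_norm ?g = 0" .
  from sphere_fun_norm_zero[OF g this] have "f = ?P" by (auto simp: fun_eq_iff)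
  then have "f = sphere_restrict P" using P(2) by simp
  then show "f \<in> sphere_restrict ` Collect (hharm k)" using P(1) by simp
qed (auto intro: sphere_restrict_in_harmonics)

subsection \<open>Projections onto spherical harmonics\<close>

definition hbasis :: "nat \<Rightarrow> (real ^ ('d::finite option) \<Rightarrow> complex) set"
  where "hbasis k = (SOME E. orthonormal E \<and> cfun.span E = harmonics k \<and>
    card E \<le> ((k + CARD('d) - 1) choose k) + ((k - 1 + CARD('d) - 1) choose (k - 1)))"

lemma hbasis_props:
  "orthonormal (hbasis k :: (real ^ ('d::finite option) \<Rightarrow> complex) set) \<and> cfun.span (hbasis k) = (harmonics k :: (real ^ ('d option) \<Rightarrow> complex) set) \<and>
    card (hbasis k :: (real ^ ('d option) \<Rightarrow> complex) set) \<le> ((k + CARD('d) - 1) choose k) + ((k - 1 + CARD('d) - 1) choose (k - 1))"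
  unfolding hbasis_def
proof (rule someI_ex)
  have "k + DIM(real ^ ('d option)) - 2 = k + CARD('d) - 1" "k - 1 + DIM(real ^ ('d option)) - 2 = k - 1 + CARD('d) - 1"
    unfolding DIM_option by simp_all
  then show "\<exists>E. orthonormal E \<and> cfun.span E = (harmonics k :: (real ^ ('d option) \<Rightarrow> complex) set) \<and>
    card E \<le> ((k + CARD('d) - 1) choose k) + ((k - 1 + CARD('d) - 1) choose (k - 1))"
    using sphere_restrict_basis[of k, where 'a = "real ^ ('d option)"] unfolding harmonics_eq by simp
qed

lemma orthonormal_hbasis: "orthonormal (hbasis k)"
  and span_hbasis: "cfun.span (hbasis k) = harmonics k"
  using hbasis_props by blast+

lemma hbasis_harmonics: "e \<in> hbasis k \<Longrightarrow> e \<in> harmonics k"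
  using cfun.span_superset[of "hbasis k"] span_hbasis[of k] by auto

lemma dim_harmonics:
  "cfun.dim (harmonics k :: (real ^ ('d::finite option) \<Rightarrow> complex) set) = card (hbasis k :: (real ^ ('d option) \<Rightarrow> complex) set)"
proof (rule cfun.dim_eq_card)
  show "cfun.span (hbasis k) = cfun.span (harmonics k :: (real ^ ('d option) \<Rightarrow> complex) set)"
    by (metis cfun.span_span span_hbasis)
  show "cfun.independent (hbasis k :: (real ^ ('d option) \<Rightarrow> complex) set)"
    by (rule orthonormal_independent[OF orthonormal_hbasis])
qed

lemma harmonics_add: "p \<in> harmonics k \<Longrightarrow> q \<in> harmonics k \<Longrightarrow> (\<lambda>x. p x + q x) \<in> harmonics k"
  using cfun_span_plus unfolding span_hbasis[symmetric] .

lemma harmonics_cmult: "p \<in> harmonics k \<Longrightarrow> (\<lambda>x. c * p x) \<in> harmonics k"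
  using cfun.span_scale unfolding span_hbasis[symmetric] .

lemma harmonics_diff: "p \<in> harmonics k \<Longrightarrow> q \<in> harmonics k \<Longrightarrow> (\<lambda>x. p x - q x) \<in> harmonics k"
  using harmonics_add[OF _ harmonics_cmult[of q k "-1"]] by simp

lemma harmonics_zero: "(\<lambda>x. 0) \<in> harmonics k"
  using cfun_span_zero unfolding span_hbasis[symmetric] .

lemma harmonics_orthogonal:
  assumes "p \<in> harmonics k" "q \<in> harmonics l" "k \<noteq> l"
  shows "L2_inner p q = 0"
proof -
  obtain r where r: "q = sphere_restrict r" "hharm l r" using assms(2) by (auto simp: harmonics_eq)
  have "L2_inner p q = L2_inner p r"
    unfolding r(1) by (rule L2_inner_cong) (auto simp: sphere_restrict_eq)
  also have "\<dots> = 0" by (rule harmonics_orth_hharm[OF assms(1) r(2) assms(3)])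
  finally show ?thesis .
qed

lemma harmonics_expand: "q \<in> harmonics k \<Longrightarrow> q = (\<lambda>x. \<Sum>e\<in>hbasis k. L2_inner q e * e x)"
  using orthonormal_expand[OF orthonormal_hbasis] unfolding span_hbasis .

lemma harmonics_definite:
  assumes "p \<in> harmonics k" "\<And>q. q \<in> harmonics k \<Longrightarrow> L2_inner p q = 0"
  shows "p = (\<lambda>x. 0)"
proof -
  have "L2_inner p p = 0" by (rule assms(2)[OF assms(1)])
  then have "L2_norm p = 0" unfolding L2_inner_self by simp
  then show ?thesis by (rule sphere_fun_norm_zero[OF harmonics_sphere_fun[OF assms(1)]])
qed

definition hproj :: "nat \<Rightarrow> (real ^ ('d::finite option) \<Rightarrow> complex) \<Rightarrow> real ^ ('d option) \<Rightarrow> complex"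
  where "hproj k f = (\<lambda>x. \<Sum>e\<in>hbasis k. L2_inner f e * e x)"

lemma hproj_harmonics: "hproj k f \<in> harmonics k"
  unfolding hproj_def span_hbasis[symmetric]
  by (intro cfun_span_sum cfun.span_scale cfun.span_base)

lemma hbasis_L2: "e \<in> hbasis k \<Longrightarrow> e \<in> sphere_L2"
  by (rule harmonics_L2[OF hbasis_harmonics])

lemma hproj_inner:
  assumes q: "q \<in> harmonics k" and f: "f \<in> sphere_L2"
  shows "L2_inner (hproj k f) q = L2_inner f q"
proof -
  have e: "L2_inner (hproj k f) e = L2_inner f e" if "e \<in> hbasis k" for e
    unfolding hproj_def by (rule orthonormal_coeff[OF orthonormal_hbasis that])
  have expand: "L2_inner u q = (\<Sum>e\<in>hbasis k. cnj (L2_inner q e) * L2_inner u e)" if "u \<in> sphere_L2" for u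
  proof -
    have "L2_inner u q = L2_inner u (\<lambda>x. \<Sum>e\<in>hbasis k. L2_inner q e * e x)"
      using harmonics_expand[OF q] by simp
    also have "\<dots> = (\<Sum>e\<in>hbasis k. L2_inner u (\<lambda>x. L2_inner q e * e x))"
      by (intro L2_inner_sum_right sphere_L2_cmult hbasis_L2 that)
    finally show ?thesis by (simp add: L2_inner_cmult_right)
  qed
  show ?thesis
    unfolding expand[OF harmonics_L2[OF hproj_harmonics]] expand[OF f]
    by (intro sum.cong refl) (simp add: e)
qed

text \<open>The definite description in \<open>harmonic_proj\<close> needs uniqueness: two
  candidates differ by an element of the eigenspace that is orthogonal to the whole eigenspace,
  itself included.\<close>

lemma harmonic_proj_eqI:
  fixes f :: "real ^ ('d::finite option) \<Rightarrow> complex"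
  assumes f: "f \<in> sphere_L2" and p: "p \<in> harmonics k" and q: "\<And>q. q \<in> harmonics k \<Longrightarrow> L2_inner p q = L2_inner f q"
  shows "harmonic_proj k f = p"
  unfolding harmonic_proj_def
proof (rule the_equality)
  show "p \<in> harmonics k \<and> (\<forall>q\<in>harmonics k. L2_inner (\<lambda>x. f x - p x) q = 0)"
    using p q by (auto simp: L2_inner_diff_left[OF f harmonics_L2[OF p] harmonics_L2])
next
  fix p' assume p': "p' \<in> harmonics k \<and> (\<forall>q\<in>harmonics k. L2_inner (\<lambda>x. f x - p' x) q = 0)"
  have "(\<lambda>x. p' x - p x) = (\<lambda>x. 0)"
  proof (rule harmonics_definite)
    show "(\<lambda>x. p' x - p x) \<in> harmonics k" using p p' by (intro harmonics_diff) auto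
    fix q :: "real ^ ('d option) \<Rightarrow> complex" assume q': "q \<in> harmonics k"
    have "L2_inner f q - L2_inner p' q = 0"
      using p' q' L2_inner_diff_left[OF f harmonics_L2[of p' k] harmonics_L2[OF q']] by auto
    then show "L2_inner (\<lambda>x. p' x - p x) q = 0"
      using p p' q[OF q'] by (subst L2_inner_diff_left) (auto intro: harmonics_L2 q')
  qed
  then show "p' = p" by (auto simp: fun_eq_iff)
qed

lemma harmonic_proj_eq: "f \<in> sphere_L2 \<Longrightarrow> harmonic_proj k f = hproj k f"
  by (rule harmonic_proj_eqI) (auto intro: hproj_harmonics hproj_inner)

lemma harmonic_proj_harmonics: "f \<in> sphere_L2 \<Longrightarrow> harmonic_proj k f \<in> harmonics k"
  by (simp add: harmonic_proj_eq hproj_harmonics)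

lemma harmonic_proj_inner:
  "f \<in> sphere_L2 \<Longrightarrow> q \<in> harmonics k \<Longrightarrow> L2_inner (harmonic_proj k f) q = L2_inner f q"
  by (simp add: harmonic_proj_eq hproj_inner)

lemma harmonic_proj_L2: "f \<in> sphere_L2 \<Longrightarrow> harmonic_proj k f \<in> sphere_L2"
  by (rule harmonics_L2[OF harmonic_proj_harmonics])

lemma harmonic_proj_of_harmonics:
  fixes q :: "real ^ ('d::finite option) \<Rightarrow> complex"
  assumes "q \<in> harmonics l"
  shows "harmonic_proj k q = (if k = l then q else (\<lambda>x. 0))"
proof (rule harmonic_proj_eqI[OF harmonics_L2[OF assms]])
  show "(if k = l then q else (\<lambda>x. 0)) \<in> harmonics k" using assms by (simp add: harmonics_zero)
  fix r :: "real ^ ('d option) \<Rightarrow> complex" assume "r \<in> harmonics k"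
  then show "L2_inner (if k = l then q else (\<lambda>x. 0)) r = L2_inner q r"
    using harmonics_orthogonal[OF assms, of r k] by (auto simp: L2_inner_def)
qed

lemma harmonic_proj_diff:
  assumes "f \<in> sphere_L2" "g \<in> sphere_L2"
  shows "harmonic_proj k (\<lambda>x. f x - g x) = (\<lambda>x. harmonic_proj k f x - harmonic_proj k g x)"
  using assms
  by (intro harmonic_proj_eqI sphere_L2_diff harmonics_diff harmonic_proj_harmonics)
    (simp_all add: L2_inner_diff_left harmonics_L2 harmonic_proj_L2 harmonic_proj_inner)

lemma harmonic_proj_sum:
  fixes f :: "'i \<Rightarrow> real ^ ('d::finite option) \<Rightarrow> complex"
  assumes "\<And>i. i \<in> A \<Longrightarrow> f i \<in> sphere_L2"
  shows "harmonic_proj k (\<lambda>x. \<Sum>i\<in>A. f i x) = (\<lambda>x. \<Sum>i\<in>A. harmonic_proj k (f i) x)"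
proof (rule harmonic_proj_eqI)
  show "(\<lambda>x. \<Sum>i\<in>A. f i x) \<in> sphere_L2" using assms by (rule sphere_L2_sum)
  show "(\<lambda>x. \<Sum>i\<in>A. harmonic_proj k (f i) x) \<in> harmonics k"
    unfolding span_hbasis[symmetric]
    by (rule cfun_span_sum) (simp add: span_hbasis harmonic_proj_harmonics assms)
  fix q :: "real ^ ('d option) \<Rightarrow> complex" assume "q \<in> harmonics k"
  then show "L2_inner (\<lambda>x. \<Sum>i\<in>A. harmonic_proj k (f i) x) q = L2_inner (\<lambda>x. \<Sum>i\<in>A. f i x) q"
    using assms by (simp add: L2_inner_sum_left harmonic_proj_L2 harmonics_L2 harmonic_proj_inner)
qed

lemma harmonic_proj_upto:
  assumes "\<And>l. l \<le> m \<Longrightarrow> q l \<in> harmonics l"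
  shows "harmonic_proj k (\<lambda>x. \<Sum>l\<le>m. q l x) = (if k \<le> m then q k else (\<lambda>x. 0))"
proof -
  have "harmonic_proj k (\<lambda>x. \<Sum>l\<le>m. q l x) = (\<lambda>x. \<Sum>l\<le>m. harmonic_proj k (q l) x)"
    by (rule harmonic_proj_sum) (use assms harmonics_L2 in blast)
  also have "\<dots> = (\<lambda>x. \<Sum>l\<le>m. if k = l then q l x else 0)"
  proof (intro ext sum.cong refl)
    fix x l assume "l \<in> {..m}"
    then have "q l \<in> harmonics l" using assms by simp
    then show "harmonic_proj k (q l) x = (if k = l then q l x else 0)"
      by (simp add: harmonic_proj_of_harmonics)
  qed
  finally show ?thesis by (auto simp: fun_eq_iff)
qed

definition hpartial :: "nat \<Rightarrow> (real ^ ('d::finite option) \<Rightarrow> complex) \<Rightarrow> real ^ ('d option) \<Rightarrow> complex"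
  where "hpartial N f = (\<lambda>x. \<Sum>k\<le>N. harmonic_proj k f x)"

lemma hpartial_upto: "f \<in> sphere_L2 \<Longrightarrow> hpartial N f \<in> harmonics_upto N"
  unfolding hpartial_def harmonics_upto_def
  by (intro CollectI exI[of _ "\<lambda>k. harmonic_proj k f"]) (simp add: harmonic_proj_harmonics)

lemma harmonics_upto_L2: "q \<in> harmonics_upto N \<Longrightarrow> q \<in> sphere_L2"
  unfolding harmonics_upto_def by (auto intro!: sphere_L2_sum intro: harmonics_L2)

lemma L2_norm_sq_upto:
  "(\<And>k. k \<le> N \<Longrightarrow> q k \<in> harmonics k) \<Longrightarrow>
    (L2_norm (\<lambda>x. \<Sum>k\<le>N. q k x))\<^sup>2 = (\<Sum>k\<le>N. (L2_norm (q k))\<^sup>2)"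
proof (induction N)
  case (Suc N)
  have s: "(\<lambda>x. \<Sum>k\<le>N. q k x) \<in> sphere_L2"
    by (rule sphere_L2_sum, rule harmonics_L2, rule Suc.prems) simp
  have "L2_inner (\<lambda>x. \<Sum>k\<le>N. q k x) (q (Suc N)) = (\<Sum>k\<le>N. L2_inner (q k) (q (Suc N)))"
    by (rule L2_inner_sum_left; rule harmonics_L2, rule Suc.prems) simp_all
  also have "\<dots> = 0"
  proof (intro sum.neutral ballI)
    fix k assume "k \<in> {..N}"
    then show "L2_inner (q k) (q (Suc N)) = 0"
      by (intro harmonics_orthogonal[of _ k _ "Suc N"] Suc.prems) auto
  qed
  finally have "L2_inner (\<lambda>x. \<Sum>k\<le>N. q k x) (q (Suc N)) = 0" .
  from L2_norm_sq_add_orthogonal[OF s harmonics_L2[OF Suc.prems[of "Suc N"]] this]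
  show ?case using Suc by simp
qed simp

lemma hpartial_orthogonal:
  assumes f: "f \<in> sphere_L2" and q: "q \<in> harmonics_upto N"
  shows "L2_inner (\<lambda>x. f x - hpartial N f x) q = 0"
proof -
  have P: "hpartial N f \<in> sphere_L2" by (rule harmonics_upto_L2[OF hpartial_upto[OF f]])
  obtain r where r: "q = (\<lambda>x. \<Sum>l\<le>N. r l x)" "\<And>l. l \<le> N \<Longrightarrow> r l \<in> harmonics l"
    using q by (auto simp: harmonics_upto_def)
  have "L2_inner (\<lambda>x. f x - hpartial N f x) (r l) = 0" if "l \<le> N" for l
  proof -
    have "L2_inner (hpartial N f) (r l) = L2_inner (harmonic_proj l (hpartial N f)) (r l)"
      using harmonic_proj_inner[OF P r(2)[OF that]] by simp
    also have "harmonic_proj l (hpartial N f) = harmonic_proj l f"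
      unfolding hpartial_def using that harmonic_proj_harmonics[OF f] by (subst harmonic_proj_upto) auto
    also have "L2_inner \<dots> (r l) = L2_inner f (r l)"
      by (rule harmonic_proj_inner[OF f r(2)[OF that]])
    finally show ?thesis
      by (simp add: L2_inner_diff_left[OF f P harmonics_L2[OF r(2)[OF that]]])
  qed
  then show ?thesis
    unfolding r(1) using r(2) f P
    by (subst L2_inner_sum_right) (auto intro: harmonics_L2 sphere_L2_diff)
qed

lemma harmonics_upto_diff:
  assumes "p \<in> harmonics_upto N" "q \<in> harmonics_upto N"
  shows "(\<lambda>x. p x - q x) \<in> harmonics_upto N"
proof -
  obtain r s where "p = (\<lambda>x. \<Sum>l\<le>N. r l x)" "\<forall>l\<le>N. r l \<in> harmonics l" "q = (\<lambda>x. \<Sum>l\<le>N. s l x)" "\<forall>l\<le>N. s l \<in> harmonics l"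
    using assms by (auto simp: harmonics_upto_def)
  then show ?thesis
    unfolding harmonics_upto_def
    by (intro CollectI exI[of _ "\<lambda>l x. r l x - s l x"]) (simp add: sum_subtractf harmonics_diff)
qed

lemma L2_norm_sq_diff_add:
  assumes "f \<in> sphere_L2" "g \<in> sphere_L2" "L2_inner (\<lambda>x. f x - g x) g = 0"
  shows "(L2_norm f)\<^sup>2 = (L2_norm (\<lambda>x. f x - g x))\<^sup>2 + (L2_norm g)\<^sup>2"
  using L2_norm_sq_add_orthogonal[OF sphere_L2_diff[OF assms(1,2)] assms(2,3)] by simp

lemma hpartial_norm:
  assumes f: "f \<in> sphere_L2"
  shows "(L2_norm f)\<^sup>2 = (L2_norm (\<lambda>x. f x - hpartial N f x))\<^sup>2 + (\<Sum>k\<le>N. (L2_norm (harmonic_proj k f))\<^sup>2)"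
proof -
  have P: "hpartial N f \<in> harmonics_upto N" by (rule hpartial_upto[OF f])
  have "(L2_norm (hpartial N f))\<^sup>2 = (\<Sum>k\<le>N. (L2_norm (harmonic_proj k f))\<^sup>2)"
    unfolding hpartial_def by (rule L2_norm_sq_upto[OF harmonic_proj_harmonics[OF f]])
  then show ?thesis
    using L2_norm_sq_diff_add[OF f harmonics_upto_L2[OF P] hpartial_orthogonal[OF f P]] by simp
qed

text \<open>The remainder is orthogonal to all degrees up to N, so the partial sum is the best
  approximation from these degrees and no worse than the one that density provides.\<close>

lemma hpartial_limit:
  fixes f :: "real ^ ('d::finite option) \<Rightarrow> complex"
  assumes f: "f \<in> sphere_L2"
  shows "(\<lambda>N. (L2_norm (\<lambda>x. f x - hpartial N f x))\<^sup>2) \<longlonglongrightarrow> 0"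
proof (rule LIMSEQ_I)
  fix \<epsilon> :: real assume "0 < \<epsilon>"
  then obtain M and q :: "nat \<Rightarrow> real ^ ('d option) \<Rightarrow> complex" where q: "\<forall>l. hharm l (q l)" "\<forall>l>M. q l = (\<lambda>x. 0)"
    "(L2_norm (\<lambda>x. f x - (\<Sum>l\<le>M. q l x)))\<^sup>2 < \<epsilon>"
    using harmonic_sum_dense[OF f] by blast
  have "norm ((L2_norm (\<lambda>x. f x - hpartial N f x))\<^sup>2 - 0) < \<epsilon>" if "N \<ge> M" for N
  proof -
    let ?Q = "\<lambda>x. \<Sum>l\<le>N. sphere_restrict (q l) x"
    have Q: "?Q \<in> harmonics_upto N"
      unfolding harmonics_upto_def
      by (intro CollectI exI[of _ "\<lambda>l. sphere_restrict (q l)"]) (simp add: sphere_restrict_in_harmonics q(1))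
    have eq: "(\<Sum>l\<le>M. q l x) = ?Q x" if "x \<in> sphere 0 1" for x
    proof -
      have "(\<Sum>l\<le>M. q l x) = (\<Sum>l\<le>N. q l x)"
        using \<open>N \<ge> M\<close> q(2) by (intro sum.mono_neutral_left) (auto simp: not_le)
      then show ?thesis using that by (simp add: sphere_restrict_eq)
    qed
    let ?R = "\<lambda>x. hpartial N f x - ?Q x"
    have R: "?R \<in> harmonics_upto N" by (rule harmonics_upto_diff[OF hpartial_upto[OF f] Q])
    let ?g = "\<lambda>x. f x - hpartial N f x"
    have g: "?g \<in> sphere_L2" by (rule sphere_L2_diff[OF f harmonics_upto_L2[OF hpartial_upto[OF f]]])
    have "(L2_norm ?g)\<^sup>2 \<le> (L2_norm ?g)\<^sup>2 + (L2_norm ?R)\<^sup>2" by simp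
    also have "\<dots> = (L2_norm (\<lambda>x. ?g x + ?R x))\<^sup>2"
      by (rule L2_norm_sq_add_orthogonal[OF g harmonics_upto_L2[OF R] hpartial_orthogonal[OF f R], symmetric])
    also have "L2_norm (\<lambda>x. ?g x + ?R x) = L2_norm (\<lambda>x. f x - (\<Sum>l\<le>M. q l x))"
      by (rule L2_norm_cong) (simp add: eq)
    also have "(L2_norm (\<lambda>x. f x - (\<Sum>l\<le>M. q l x)))\<^sup>2 < \<epsilon>" by (rule q(3))
    finally show ?thesis by simp
  qed
  then show "\<exists>no. \<forall>n\<ge>no. norm ((L2_norm (\<lambda>x. f x - hpartial n f x))\<^sup>2 - 0) < \<epsilon>" by blast
qed

lemma parseval:
  assumes f: "f \<in> sphere_L2"
  shows "(\<lambda>k. (L2_norm (harmonic_proj k f))\<^sup>2) sums (L2_norm f)\<^sup>2"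
proof -
  have "(\<lambda>N. (L2_norm f)\<^sup>2 - (L2_norm (\<lambda>x. f x - hpartial N f x))\<^sup>2) \<longlonglongrightarrow> (L2_norm f)\<^sup>2 - 0"
    by (intro tendsto_diff tendsto_const hpartial_limit f)
  moreover have "(L2_norm f)\<^sup>2 - (L2_norm (\<lambda>x. f x - hpartial N f x))\<^sup>2 = (\<Sum>k\<le>N. (L2_norm (harmonic_proj k f))\<^sup>2)" for N
    using hpartial_norm[OF f, of N] by simp
  ultimately show ?thesis by (simp add: sums_def_le)
qed


subsection \<open>The reproducing kernel\<close>

definition hkernel :: "nat \<Rightarrow> real ^ ('d::finite option) \<Rightarrow> real ^ ('d option) \<Rightarrow> complex"
  where "hkernel k x y = (\<Sum>e\<in>hbasis k. e x * cnj (e y))"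

lemma hkernel_harmonics: "(\<lambda>x. hkernel k x y) \<in> harmonics k"
proof -
  have "(\<lambda>x. \<Sum>e\<in>hbasis k. cnj (e y) * e x) \<in> cfun.span (hbasis k)"
    by (intro cfun_span_sum cfun.span_scale cfun.span_base)
  then show ?thesis by (simp add: hkernel_def span_hbasis mult.commute)
qed

lemma hkernel_proj:
  assumes "f \<in> sphere_L2"
  shows "L2_inner f (\<lambda>x. hkernel k x y) = harmonic_proj k f y"
proof -
  have "L2_inner f (\<lambda>x. hkernel k x y) = L2_inner f (\<lambda>x. \<Sum>e\<in>hbasis k. cnj (e y) * e x)"
    by (simp add: hkernel_def mult.commute)
  also have "\<dots> = (\<Sum>e\<in>hbasis k. L2_inner f (\<lambda>x. cnj (e y) * e x))"
    by (intro L2_inner_sum_right sphere_L2_cmult hbasis_L2 assms)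
  also have "\<dots> = harmonic_proj k f y"
    unfolding L2_inner_cmult_right harmonic_proj_eq[OF assms] hproj_def by (simp add: mult.commute)
  finally show ?thesis .
qed

lemma hkernel_reproducing: "q \<in> harmonics k \<Longrightarrow> L2_inner q (\<lambda>x. hkernel k x y) = q y"
  by (simp add: hkernel_proj[OF harmonics_L2] harmonic_proj_of_harmonics)

lemma hkernel_cnj: "cnj (hkernel k x y) = hkernel k y x"
  by (simp add: hkernel_def mult.commute)

lemma harmonics_compose_orthogonal:
  fixes R :: "real ^ ('d::finite option) \<Rightarrow> real ^ ('d option)"
  assumes R: "orthogonal_transformation R" and q: "q \<in> harmonics k"
  shows "(\<lambda>x. q (R x)) \<in> harmonics k"
proof -
  obtain p where p: "hharm k p" "q = sphere_restrict p" using q by (auto simp: harmonics_eq)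
  have "(\<lambda>x. q (R x)) = sphere_restrict (\<lambda>x. p (R x))"
    by (auto simp: p(2) sphere_restrict_def orthogonal_transformation_norm[OF R])
  then show ?thesis
    using hharm_compose_orthogonal[OF R p(1)] by (simp add: sphere_restrict_in_harmonics)
qed

lemma L2_inner_orthogonal:
  fixes R :: "'a::euclidean_space \<Rightarrow> 'a"
  assumes R: "orthogonal_transformation R" and f: "f \<in> sphere_L2" and g: "g \<in> sphere_L2"
  shows "L2_inner (\<lambda>x. f (R x)) (\<lambda>x. g (R x)) = L2_inner f g"
proof -
  have "(\<lambda>x. f x * cnj (g x)) \<in> borel_measurable sphere_measure"
    using sphere_L2_D(1)[OF f] sphere_L2_D(1)[OF g] by measurable
  from integral_sphere_orthogonal[OF R this] show ?thesis by (simp add: L2_inner_def)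
qed

text \<open>Both sides, as functions of x, represent evaluation at y on the eigenspace, because R
  preserves the eigenspace and the inner product.\<close>

lemma hkernel_orthogonal:
  fixes R :: "real ^ ('d::finite option) \<Rightarrow> real ^ ('d option)"
  assumes R: "orthogonal_transformation R"
  shows "hkernel k (R x) (R y) = hkernel k x y"
proof -
  let ?S = "inv R"
  have S: "orthogonal_transformation ?S" by (rule orthogonal_transformation_inv[OF R])
  have RS: "R (?S z) = z" and SR: "?S (R z) = z" for z
    using orthogonal_transformation_surj[OF R] orthogonal_transformation_inj[OF R]
    by (simp_all add: surj_f_inv_f)
  have W: "(\<lambda>x. hkernel k (R x) (R y)) \<in> harmonics k"
    by (rule harmonics_compose_orthogonal[OF R hkernel_harmonics])
  have "(\<lambda>x. hkernel k (R x) (R y) - hkernel k x y) = (\<lambda>x. 0)"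
  proof (rule harmonics_definite[OF harmonics_diff[OF W hkernel_harmonics]])
    fix q :: "real ^ ('d option) \<Rightarrow> complex" assume q: "q \<in> harmonics k"
    have "L2_inner q (\<lambda>x. hkernel k (R x) (R y)) = L2_inner (\<lambda>x. q (?S (R x))) (\<lambda>x. hkernel k (R x) (R y))"
      by (simp add: SR)
    also have "\<dots> = L2_inner (\<lambda>x. q (?S x)) (\<lambda>x. hkernel k x (R y))"
      by (rule L2_inner_orthogonal[OF R harmonics_L2[OF harmonics_compose_orthogonal[OF S q]]
            harmonics_L2[OF hkernel_harmonics[of k "R y"]]])
    also have "\<dots> = q (?S (R y))"
      by (rule hkernel_reproducing[OF harmonics_compose_orthogonal[OF S q]])
    also have "\<dots> = L2_inner q (\<lambda>x. hkernel k x y)"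
      by (simp add: SR hkernel_reproducing[OF q])
    finally have "L2_inner (\<lambda>x. hkernel k (R x) (R y)) q = L2_inner (\<lambda>x. hkernel k x y) q"
      using L2_inner_cnj[of "\<lambda>x. hkernel k (R x) (R y)" q] L2_inner_cnj[of "\<lambda>x. hkernel k x y" q] by simp
    then show "L2_inner (\<lambda>x. hkernel k (R x) (R y) - hkernel k x y) q = 0"
      by (simp add: L2_inner_diff_left harmonics_L2[OF W] harmonics_L2[OF hkernel_harmonics] harmonics_L2[OF q])
  qed
  from fun_cong[OF this, of x] show ?thesis by simp
qed

lemma sphere_transitive:
  fixes x y :: "real ^ ('d::finite option)"
  assumes "x \<in> sphere 0 1" "y \<in> sphere 0 1"
  obtains R where "orthogonal_transformation R" "det (matrix R) = 1" "R x = y"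
proof -
  have "2 \<le> CARD('d option)" by simp
  from rotation_exists_1[OF this, of x y] that assms show ?thesis by auto
qed

text \<open>Transitivity makes the diagonal constant on the sphere. As the total mass is 1, the
  constant equals its integral, which is the number of basis functions.\<close>

lemma hkernel_diagonal:
  fixes x :: "real ^ ('d::finite option)"
  assumes x: "x \<in> sphere 0 1"
  shows "hkernel k x x = of_nat (cfun.dim (harmonics k :: (real ^ ('d option) \<Rightarrow> complex) set))"
proof -
  have const: "hkernel k y y = hkernel k x x" if "y \<in> sphere 0 1" for y :: "real ^ ('d option)"
  proof -
    obtain R where "orthogonal_transformation R" "R x = y" using sphere_transitive[OF x \<open>y \<in> sphere 0 1\<close>] by blast
    then show ?thesis using hkernel_orthogonal[of R k x x] by simp
  qed
  have "hkernel k x x = (\<integral>y. hkernel k x x \<partial>(sphere_measure :: (real ^ ('d option)) measure))"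
    using sphere.prob_space[where 'a = "real ^ ('d option)"] by simp
  also have "\<dots> = (\<integral>y. hkernel k y y \<partial>(sphere_measure :: (real ^ ('d option)) measure))"
    by (rule Bochner_Integration.integral_cong) (auto simp: const)
  also have "\<dots> = (\<Sum>e\<in>(hbasis k :: (real ^ ('d option) \<Rightarrow> complex) set). \<integral>y. e y * cnj (e y) \<partial>sphere_measure)"
    unfolding hkernel_def
    by (rule Bochner_Integration.integral_sum) (intro sphere_L2_inner_integrable hbasis_L2)
  also have "\<dots> = (\<Sum>e\<in>(hbasis k :: (real ^ ('d option) \<Rightarrow> complex) set). 1)"
  proof (rule sum.cong[OF refl])
    fix e :: "real ^ ('d option) \<Rightarrow> complex" assume "e \<in> hbasis k"
    then have "L2_inner e e = 1" using orthonormal_hbasis[of k] by (auto simp: orthonormal_def)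
    then show "(\<integral>y. e y * cnj (e y) \<partial>sphere_measure) = 1" by (simp add: L2_inner_def)
  qed
  finally show ?thesis by (simp add: dim_harmonics)
qed

text \<open>Cauchy-Schwarz for q x as the pairing with the kernel at x, whose squared norm is the
  diagonal value of the kernel.\<close>

lemma harmonics_pointwise_bound:
  fixes q :: "real ^ ('d::finite option) \<Rightarrow> complex"
  assumes q: "q \<in> harmonics k" and x: "x \<in> sphere 0 1"
  shows "cmod (q x) \<le> sqrt (real (cfun.dim (harmonics k :: (real ^ ('d option) \<Rightarrow> complex) set))) * L2_norm q"
proof -
  let ?Z = "\<lambda>y. hkernel k y x"
  have "L2_inner ?Z ?Z = of_nat (cfun.dim (harmonics k :: (real ^ ('d option) \<Rightarrow> complex) set))"
    using hkernel_reproducing[OF hkernel_harmonics, of k x x] hkernel_diagonal[OF x] by simp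
  then have "complex_of_real ((L2_norm ?Z)\<^sup>2) = of_real (real (cfun.dim (harmonics k :: (real ^ ('d option) \<Rightarrow> complex) set)))"
    unfolding L2_inner_self by simp
  then have n: "L2_norm ?Z = sqrt (real (cfun.dim (harmonics k :: (real ^ ('d option) \<Rightarrow> complex) set)))"
    unfolding of_real_eq_iff by (metis L2_norm_nonneg real_sqrt_unique)
  have "cmod (q x) = cmod (L2_inner q ?Z)" by (simp add: hkernel_reproducing[OF q])
  also have "\<dots> \<le> L2_norm q * L2_norm ?Z"
    by (rule L2_inner_cauchy_schwarz[OF harmonics_L2[OF q] harmonics_L2[OF hkernel_harmonics]])
  finally show ?thesis unfolding n by (simp add: mult.commute)
qed

subsection \<open>Zonal harmonics\<close>

lemma hpoly_eq_on_sphere: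
  assumes p: "hpoly k p" and q: "hpoly k q" and eq: "\<And>x. x \<in> sphere 0 1 \<Longrightarrow> p x = q x"
  shows "p = (q :: 'a::euclidean_space \<Rightarrow> complex)"
proof
  fix x :: 'a
  obtain b :: 'a where b: "b \<in> Basis" using nonempty_Basis by blast
  show "p x = q x"
  proof (cases "x = 0")
    \<comment> \<open>The origin is compared through the unit vector b. This also covers degree 0,
      because \<open>0 ^ 0 = 1\<close>.\<close>
    case True
    then have "p x = of_real 0 ^ k * p b" "q x = of_real 0 ^ k * q b"
      using hpoly_homogeneous[OF p, of 0 b] hpoly_homogeneous[OF q, of 0 b] by simp_all
    then show ?thesis using eq[of b] b by simp
  next
    case False
    have "x = norm x *\<^sub>R sgn x" using False by (simp add: sgn_div_norm)
    then have "p x = of_real (norm x) ^ k * p (sgn x)" "q x = of_real (norm x) ^ k * q (sgn x)"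
      using hpoly_homogeneous[OF p, of "norm x" "sgn x"] hpoly_homogeneous[OF q, of "norm x" "sgn x"] by simp_all
    then show ?thesis using eq[of "sgn x"] False by (simp add: norm_sgn)
  qed
qed

text \<open>The rotation takes place in a plane that contains a and b and is orthogonal to e.
  Dimension 3 is needed when b = a or b = - a: then the plane is not determined, and a third
  direction must exist.\<close>

lemma rot_transitive:
  fixes e a b :: "'a::euclidean_space"
  assumes D: "3 \<le> DIM('a)" and a: "norm a = 1" "a \<bullet> e = 0" and b: "norm b = 1" "b \<bullet> e = 0"
  shows "\<exists>v t. orthonormal_pair a v \<and> v \<bullet> e = 0 \<and> rot a v t a = b"
proof -
  have aa: "a \<bullet> a = 1" and bb: "b \<bullet> b = 1" using a b by (simp_all add: dot_square_norm)
  define w where "w = b - (b \<bullet> a) *\<^sub>R a"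
  have wa: "w \<bullet> a = 0" and we: "w \<bullet> e = 0" by (simp_all add: w_def inner_diff_left aa a b)
  \<comment> \<open>The vector w is the part of b orthogonal to a; its direction is taken if it is
    nonzero, and any unit vector orthogonal to a and e otherwise.\<close>
  obtain v where v: "norm v = 1" "a \<bullet> v = 0" "v \<bullet> e = 0" "w = (w \<bullet> v) *\<^sub>R v"
  proof (cases "w = 0")
    case True
    have "dim {a, e} \<le> card {a, e}" by (rule dim_le_card') simp
    also have "\<dots> \<le> 2" by (simp add: card_insert_if)
    finally have "dim {a, e} < DIM('a)" using D by simp
    then obtain y where y: "y \<noteq> 0" "\<And>z. z \<in> span {a, e} \<Longrightarrow> orthogonal y z"
      using orthogonal_to_subspace_exists[of "{a, e}"] by metis
    have "orthogonal y a" "orthogonal y e" by (auto intro!: y(2) span_base)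
    then show ?thesis
      using y(1) True by (intro that[of "sgn y"]) (auto simp: norm_sgn sgn_div_norm orthogonal_def inner_commute)
  next
    case False
    have "w \<bullet> sgn w = norm w"
      by (simp add: sgn_div_norm dot_square_norm power2_eq_square False)
    then have "w = (w \<bullet> sgn w) *\<^sub>R sgn w" using False by (simp add: sgn_div_norm)
    then show ?thesis
      using wa we False by (intro that[of "sgn w"]) (auto simp: norm_sgn sgn_div_norm inner_commute)
  qed
  have "w \<bullet> v = b \<bullet> v" using v(2) by (simp add: w_def inner_diff_left)
  with v(4) have "w = (b \<bullet> v) *\<^sub>R v" by simp
  then have bv: "b = (b \<bullet> a) *\<^sub>R a + (b \<bullet> v) *\<^sub>R v" by (simp add: w_def algebra_simps)
  have vv: "v \<bullet> v = 1" using v(1) by (simp add: dot_square_norm)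
  have "b \<bullet> b = (b \<bullet> a)\<^sup>2 + (b \<bullet> v)\<^sup>2"
    by (subst (2) bv) (simp add: inner_add_right power2_eq_square)
  then obtain t where t: "b \<bullet> a = cos t" "b \<bullet> v = sin t"
    using sincos_total_2pi[of "b \<bullet> a" "b \<bullet> v"] bb by metis
  have "rot a v t a = b"
    using v(2) by (subst bv) (simp add: rot_def aa t algebra_simps)
  then show ?thesis using a v by (intro exI[of _ v] exI[of _ t]) (simp add: orthonormal_pair_def)
qed

text \<open>Invariance is required only under explicit plane rotations that fix e. By
  \<open>rot_transitive\<close> these already move the equator transitively.\<close>

definition zonal_invariant :: "'a::euclidean_space \<Rightarrow> ('a \<Rightarrow> complex) \<Rightarrow> bool"
  where "zonal_invariant e p \<longleftrightarrow> (\<forall>u v t x. orthonormal_pair u v \<longrightarrow> u \<bullet> e = 0 \<longrightarrow> v \<bullet> e = 0 \<longrightarrow> p (rot u v t x) = p x)"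

text \<open>Transitivity makes p constant on the unit equator. In odd degree the value at - a is
  both p a and - p a, so the constant vanishes; only even degrees need the value at a as an
  assumption.\<close>

lemma zonal_invariant_equator:
  fixes e a :: "'a::euclidean_space"
  assumes D: "3 \<le> DIM('a)" and p: "hpoly k p" and inv: "zonal_invariant e p"
    and a: "norm a = 1" "a \<bullet> e = 0" and x: "x \<bullet> e = 0" and 0: "even k \<Longrightarrow> p a = 0"
  shows "p x = 0"
proof -
  have tr: "p b = p a" if nb: "norm b = 1" "b \<bullet> e = 0" for b
  proof -
    obtain v t where v: "orthonormal_pair a v" "v \<bullet> e = 0" "rot a v t a = b"
      using rot_transitive[OF D a nb] by blast
    have "p (rot a v t a) = p a" using inv v(1,2) a(2) unfolding zonal_invariant_def by blast
    then show ?thesis using v(3) by simp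
  qed
  have pa: "p a = 0"
  proof (cases "even k")
    case False
    have "p ((-1) *\<^sub>R a) = of_real (-1) ^ k * p a" by (rule hpoly_homogeneous[OF p])
    moreover have "p ((-1) *\<^sub>R a) = p a" using a by (intro tr) auto
    ultimately show ?thesis using False by simp
  qed (rule 0)
  show ?thesis
  proof (cases "x = 0")
    case True
    have "p (0 *\<^sub>R a) = of_real 0 ^ k * p a" by (rule hpoly_homogeneous[OF p])
    then show ?thesis using True pa by simp
  next
    case False
    have "p (norm x *\<^sub>R sgn x) = of_real (norm x) ^ k * p (sgn x)" by (rule hpoly_homogeneous[OF p])
    moreover have "p (sgn x) = p a" using False x by (intro tr) (auto simp: norm_sgn sgn_div_norm)
    ultimately show ?thesis using pa False by (simp add: sgn_div_norm)
  qed
qed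

lemma zonal_invariant_dd:
  assumes p: "hpoly k p" and inv: "zonal_invariant e p"
  shows "zonal_invariant e (dd e p)"
  unfolding zonal_invariant_def
proof (intro allI impI)
  fix u v :: 'a and t x assume uv: "orthonormal_pair u v" "u \<bullet> e = 0" "v \<bullet> e = 0"
  let ?R = "rot u v t"
  have "(\<lambda>x. p (?R x)) = p" using inv uv by (auto simp: zonal_invariant_def)
  then have "dd e p x = dd e (\<lambda>x. p (?R x)) x" by simp
  also have "\<dots> = dd (?R e) p (?R x)"
    by (rule dd_compose_linear[OF orthogonal_transformation_linear[OF orthogonal_transformation_rot[OF uv(1)]] hpoly_differentiable[OF p]])
  also have "?R e = e" using uv by (simp add: rot_def inner_commute)
  finally show "dd e p (?R x) = dd e p x" by simp
qed

lemma zonal_invariant_diff: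
  "zonal_invariant e p \<Longrightarrow> zonal_invariant e q \<Longrightarrow> zonal_invariant e (\<lambda>x. p x - c * q x)"
  by (simp add: zonal_invariant_def)

text \<open>The Cauchy data of a zonal harmonic polynomial are multiples of powers of the norm, and one of
  the two data vanishes because of parity.\<close>

lemma zonal_harmonic_unique:
  fixes e :: "'a::euclidean_space"
  assumes D: "3 \<le> DIM('a)" and e: "e \<in> Basis"
    and p: "hharm k p" "zonal_invariant e p" and q: "hharm k q" "zonal_invariant e q" "q \<noteq> (\<lambda>x. 0)"
  shows "\<exists>c. p = (\<lambda>x. c * q x)"
proof -
  have ne: "norm e = 1" using e by simp
  have "\<exists>a\<in>Basis. a \<noteq> e"
  proof (rule ccontr)
    assume "\<not> (\<exists>a\<in>Basis. a \<noteq> e)"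
    then have "(Basis :: 'a set) \<subseteq> {e}" by auto
    then have "DIM('a) \<le> card {e}" by (rule card_mono[rotated]) simp
    then show False using D by simp
  qed
  then obtain a where "a \<in> Basis" "a \<noteq> e" by blast
  then have a: "norm a = 1" "a \<bullet> e = 0" using e by (auto simp: inner_Basis)
  define T where "T r = (if even k then r a else dd e r a)" for r
  have zero: "r = (\<lambda>x. 0)" if r: "hharm k r" "zonal_invariant e r" "T r = 0" for r
  proof -
    note hr = hharm_hpoly[OF r(1)]
    have 1: "r (drop_coord e x) = 0" for x
      by (rule zonal_invariant_equator[OF D hr r(2) a drop_coord_inner[OF ne]]) (use r(3) in \<open>simp add: T_def\<close>)
    have 2: "dd e r (drop_coord e x) = 0" for x
    proof (cases "k = 0")
      case True
      then show ?thesis using hpoly_dd_0 hr by metis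
    next
      case False
      show ?thesis
        by (rule zonal_invariant_equator[OF D hpoly_dd[OF hr] zonal_invariant_dd[OF hr r(2)] a drop_coord_inner[OF ne]])
          (use r(3) False in \<open>simp add: T_def split: if_splits\<close>)
    qed
    show ?thesis using hharm_cauchy_unique[OF e r(1) 1 2] by blast
  qed
  have Tq: "T q \<noteq> 0" using zero q by blast
  define c where "c = T p / T q"
  let ?r = "\<lambda>x. p x - c * q x"
  have "T ?r = T p - c * T q"
  proof -
    have "dd e ?r a = dd e p a - c * dd e q a"
      using dd_hpoly_diff[OF hharm_hpoly[OF p(1)] hpoly_cmult[OF hharm_hpoly[OF q(1)], of c], of e]
        dd_hpoly_cmult[OF hharm_hpoly[OF q(1)], of e c] by simp
    then show ?thesis unfolding T_def by simp
  qed
  then have "T ?r = 0" using Tq by (simp add: c_def)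
  then have "?r = (\<lambda>x. 0)"
    by (intro zero hharm_diff p(1) hharm_cmult q(1) zonal_invariant_diff p(2) q(2))
  then have "p = (\<lambda>x. c * q x)" by (auto simp: fun_eq_iff)
  then show ?thesis by blast
qed

lemma north_pole_Basis: "north_pole \<in> Basis"
  by (auto simp: north_pole_def Basis_vec_def)

lemma north_pole_sphere: "north_pole \<in> sphere 0 1"
  by (simp add: norm_Basis[OF north_pole_Basis])

text \<open>A homogeneous polynomial is determined by its values on the sphere, so invariance there
  extends to the whole space, as the argument with Cauchy data requires.\<close>

lemma zonal_restrict:
  assumes p: "hharm k p" and inv: "zonal_invariant e (sphere_restrict p)"
  shows "zonal_invariant e p"
  unfolding zonal_invariant_def
proof (intro allI impI)
  fix u v :: 'a and t x assume uv: "orthonormal_pair u v" "u \<bullet> e = 0" "v \<bullet> e = 0"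
  let ?R = "rot u v t"
  note R = orthogonal_transformation_rot[OF uv(1), of t]
  have "(\<lambda>x. p (?R x)) = p"
  proof (rule hpoly_eq_on_sphere[OF hpoly_compose_linear[OF orthogonal_transformation_linear[OF R]]])
    show "hpoly k p" "hpoly k p" using p by (simp_all add: hharm_hpoly)
    fix x :: 'a assume x: "x \<in> sphere 0 1"
    have "sphere_restrict p (?R x) = sphere_restrict p x"
      using inv uv by (auto simp: zonal_invariant_def)
    then show "p (?R x) = p x"
      using x orthogonal_transformation_sphere[OF R x] by (simp only: sphere_restrict_eq)
  qed
  then show "p (?R x) = p x" by (rule fun_cong)
qed

lemma hkernel_zonal: "zonal_invariant e (\<lambda>x. hkernel k x e)"
  unfolding zonal_invariant_def
proof (intro allI impI)
  fix u v t x assume uv: "orthonormal_pair u v" "u \<bullet> e = 0" "v \<bullet> e = 0"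
  have "rot u v t e = e" using uv by (simp add: rot_def inner_commute)
  then show "hkernel k (rot u v t x) e = hkernel k x e"
    using hkernel_orthogonal[OF orthogonal_transformation_rot[OF uv(1)], of k t x e] by simp
qed

lemma zonal_harmonic_kernel:
  fixes V :: "real ^ ('d::finite option) \<Rightarrow> complex"
  assumes D: "2 \<le> CARD('d)" and V: "V \<in> harmonics k" "zonal_invariant north_pole V"
  shows "\<exists>c. V = (\<lambda>x. c * hkernel k x north_pole)"
proof (cases "(\<lambda>x. hkernel k x (north_pole :: real ^ ('d option))) = (\<lambda>x. 0)")
  case True
  \<comment> \<open>A vanishing kernel forces dimension 0 through its diagonal value, and the
    pointwise bound then kills V.\<close>
  have "V x = 0" for x
  proof (cases "x \<in> sphere 0 1")
    case True
    have "hkernel k (north_pole :: real ^ ('d option)) north_pole = 0"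
      using \<open>(\<lambda>x. hkernel k x north_pole) = (\<lambda>x. 0)\<close> by (rule fun_cong)
    then have "cfun.dim (harmonics k :: (real ^ ('d option) \<Rightarrow> complex) set) = 0"
      using hkernel_diagonal[OF north_pole_sphere, of k, where 'd = 'd] by simp
    then show ?thesis using harmonics_pointwise_bound[OF V(1) True] by simp
  next
    case False
    then show ?thesis using harmonics_sphere_fun[OF V(1)] by (simp add: sphere_fun_def)
  qed
  then show ?thesis by (intro exI[of _ 0]) auto
next
  case False
  obtain p where p: "hharm k p" "V = sphere_restrict p" using V(1) by (auto simp: harmonics_eq)
  obtain q where q: "hharm k q" "(\<lambda>x. hkernel k x (north_pole :: real ^ ('d option))) = sphere_restrict q"
    using hkernel_harmonics[of k "north_pole :: real ^ ('d option)"] by (auto simp: harmonics_eq)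
  have "q \<noteq> (\<lambda>x. 0)" using False q(2) sphere_restrict_zero by metis
  moreover have "zonal_invariant north_pole p" by (rule zonal_restrict[OF p(1)]) (use V(2) p(2) in simp)
  moreover have "zonal_invariant north_pole q"
    by (rule zonal_restrict[OF q(1)]) (use hkernel_zonal[of "north_pole :: real ^ ('d option)" k] q(2) in simp)
  moreover have "3 \<le> DIM(real ^ ('d option))" unfolding DIM_option using D by simp
  ultimately obtain c where "p = (\<lambda>x. c * q x)"
    using zonal_harmonic_unique[OF _ north_pole_Basis p(1) _ q(1)] by blast
  then have "V = (\<lambda>x. c * sphere_restrict q x)" by (simp add: p(2) sphere_restrict_cmult)
  then show ?thesis unfolding q(2)[symmetric] by blast
qed

text \<open>The determinant of an orthogonal matrix is 1 or - 1, and this one is the square of the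
  rotation by half the angle.\<close>

lemma rotation_matrix_rot:
  assumes "orthonormal_pair u (v :: real ^ 'n)"
  shows "rotation_matrix (matrix (rot u v t))" "matrix (rot u v t) *v x = rot u v t x"
proof -
  have R: "orthogonal_transformation (rot u v s)" for s by (rule orthogonal_transformation_rot[OF assms])
  have L: "linear (rot u v s)" for s by (rule orthogonal_transformation_linear[OF R])
  have "rot u v t = rot u v (t/2) \<circ> rot u v (t/2)"
    by (auto simp: rot_add[OF assms])
  then have "matrix (rot u v t) = matrix (rot u v (t/2)) ** matrix (rot u v (t/2))"
    by (metis matrix_compose L)
  then have "det (matrix (rot u v t)) = det (matrix (rot u v (t/2))) * det (matrix (rot u v (t/2)))"
    by (simp add: det_mul)
  moreover have "det (matrix (rot u v (t/2))) = 1 \<or> det (matrix (rot u v (t/2))) = -1"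
    using R orthogonal_transformation_matrix det_orthogonal_matrix by blast
  ultimately have "det (matrix (rot u v t)) = 1" by auto
  then show "rotation_matrix (matrix (rot u v t))"
    using R orthogonal_transformation_matrix by (auto simp: rotation_matrix_def)
  show "matrix (rot u v t) *v x = rot u v t x" by (simp add: L)
qed

subsection \<open>Haar measure\<close>

text \<open>Keeps \<open>transpose g *v x\<close> visible as the action of the inverse of g, rather
  than turning it into multiplication of x from the left.\<close>

declare transpose_matrix_vector [simp del]

context
  fixes G :: "(real ^ 'n ^ 'n::finite) measure"
  assumes haar: "haar_prob_SO G"
begin

lemma haar_sets: "sets G = sets (restrict_space borel {g. rotation_matrix g})"
  and haar_prob: "prob_space G"
  and haar_left: "rotation_matrix k \<Longrightarrow> distr G G (\<lambda>g. k ** g) = G"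
  using haar by (auto simp: haar_prob_SO_def)

lemma haar_space: "space G = {g. rotation_matrix g}"
  using sets_eq_imp_space_eq[OF haar_sets] by (simp add: space_restrict_space)

lemma haar_id_measurable: "(\<lambda>g. g) \<in> G \<rightarrow>\<^sub>M borel"
  unfolding measurable_cong_sets[OF haar_sets refl] by (rule measurable_restrict_space1) simp

lemma haar_measurableI:
  assumes "f \<in> M \<rightarrow>\<^sub>M borel" "\<And>x. x \<in> space M \<Longrightarrow> rotation_matrix (f x)"
  shows "f \<in> M \<rightarrow>\<^sub>M G"
  unfolding measurable_cong_sets[OF refl haar_sets]
  by (rule measurable_restrict_space2) (use assms in auto)

end

lemma rotation_matrix_transpose: "rotation_matrix (g :: real ^ 'n ^ 'n) \<Longrightarrow> rotation_matrix (transpose g)"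
  by (simp add: rotation_matrix_def)

lemma rotation_matrix_mult: "rotation_matrix (g :: real ^ 'n ^ 'n) \<Longrightarrow> rotation_matrix h \<Longrightarrow> rotation_matrix (g ** h)"
  by (simp add: rotation_matrix_def orthogonal_matrix_mul det_mul)

lemma rotation_matrix_orthogonal_transformation:
  "rotation_matrix (g :: real ^ 'n ^ 'n) \<Longrightarrow> orthogonal_transformation (\<lambda>x. g *v x)"
  by (simp add: orthogonal_transformation_matrix rotation_matrix_def)

lemma rotation_matrix_sphere:
  "rotation_matrix (g :: real ^ 'n ^ 'n) \<Longrightarrow> x \<in> sphere 0 1 \<Longrightarrow> g *v x \<in> sphere 0 1"
  using orthogonal_transformation_sphere[OF rotation_matrix_orthogonal_transformation] .

lemma rotation_matrix_inv: "rotation_matrix (g :: real ^ 'n ^ 'n) \<Longrightarrow> matrix_inv g = transpose g"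
  unfolding matrix_inv_def
proof (rule some_equality)
  assume "rotation_matrix g"
  then show g: "g ** transpose g = mat 1 \<and> transpose g ** g = mat 1"
    by (simp add: rotation_matrix_def orthogonal_matrix_def)
  show "h = transpose g" if "g ** h = mat 1 \<and> h ** g = mat 1" for h
    using that g by (metis matrix_mul_assoc matrix_mul_lid matrix_mul_rid)
qed

lemma continuous_on_transpose: "continuous_on UNIV (transpose :: real ^ 'n ^ 'm \<Rightarrow> real ^ 'm ^ 'n)"
  unfolding transpose_def by (intro continuous_intros)

lemma continuous_on_matrix_mult:
  "continuous_on UNIV (\<lambda>p. (fst p :: real ^ 'n ^ 'm) ** (snd p :: real ^ 'k ^ 'n))"
  unfolding matrix_matrix_mult_def by (intro continuous_intros)

lemma continuous_on_matrix_vector_mult: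
  "continuous_on UNIV (\<lambda>p. (fst p :: real ^ 'n ^ 'm) *v (snd p))"
  unfolding matrix_vector_mult_def by (intro continuous_intros)

lemma borel_measurable_transpose:
  "f \<in> M \<rightarrow>\<^sub>M borel \<Longrightarrow> (\<lambda>x. transpose (f x :: real ^ 'n ^ 'm)) \<in> M \<rightarrow>\<^sub>M borel"
  by (rule measurable_compose[OF _ borel_measurable_continuous_onI[OF continuous_on_transpose]])

lemma borel_measurable_matrix_mult:
  "f \<in> M \<rightarrow>\<^sub>M borel \<Longrightarrow> g \<in> M \<rightarrow>\<^sub>M borel \<Longrightarrow> (\<lambda>x. (f x :: real ^ 'n ^ 'm) ** (g x :: real ^ 'k ^ 'n)) \<in> M \<rightarrow>\<^sub>M borel"
  by (rule borel_measurable_continuous_Pair[OF _ _ continuous_on_matrix_mult])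

lemma borel_measurable_matrix_vector_mult:
  "f \<in> M \<rightarrow>\<^sub>M borel \<Longrightarrow> g \<in> M \<rightarrow>\<^sub>M borel \<Longrightarrow> (\<lambda>x. (f x :: real ^ 'n ^ 'm) *v g x) \<in> M \<rightarrow>\<^sub>M borel"
  by (rule borel_measurable_continuous_Pair[OF _ _ continuous_on_matrix_vector_mult])

lemma sphere_measurableI:
  assumes "f \<in> M \<rightarrow>\<^sub>M borel" "\<And>x. x \<in> space M \<Longrightarrow> f x \<in> sphere 0 1"
  shows "f \<in> M \<rightarrow>\<^sub>M sphere_measure"
  unfolding measurable_cong_sets[OF refl sets_sphere_measure]
  by (rule measurable_restrict_space2) (use assms in auto)

lemma sphere_id_measurable: "(\<lambda>x. x) \<in> sphere_measure \<rightarrow>\<^sub>M borel"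
  unfolding measurable_cong_sets[OF sets_sphere_measure refl] by (rule measurable_restrict_space1) simp

section \<open>Inversion and right invariance of Haar measure\<close>

context
  fixes G :: "(real ^ 'n ^ 'n::finite) measure"
  assumes haar: "haar_prob_SO G"
begin

interpretation prob_space G by (rule haar_prob[OF haar])
interpretation GG: pair_sigma_finite G G ..
interpretation GS: pair_sigma_finite G "sphere_measure :: (real ^ 'n) measure" ..

lemma haar_transpose_measurable: "transpose \<in> G \<rightarrow>\<^sub>M G"
  by (rule haar_measurableI[OF haar borel_measurable_transpose[OF haar_id_measurable[OF haar]]])
    (simp add: haar_space[OF haar] rotation_matrix_transpose)

lemma haar_mult_measurable:
  "f \<in> M \<rightarrow>\<^sub>M G \<Longrightarrow> g \<in> M \<rightarrow>\<^sub>M G \<Longrightarrow> (\<lambda>x. f x ** g x) \<in> M \<rightarrow>\<^sub>M G"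
  using measurable_compose[OF _ haar_id_measurable[OF haar]] measurable_space[of f M G] measurable_space[of g M G]
  by (intro haar_measurableI[OF haar borel_measurable_matrix_mult]) (auto simp: haar_space[OF haar] rotation_matrix_mult)

lemma haar_act_measurable:
  fixes g :: "'x \<Rightarrow> real ^ 'n"
  shows "f \<in> M \<rightarrow>\<^sub>M G \<Longrightarrow> g \<in> M \<rightarrow>\<^sub>M sphere_measure \<Longrightarrow> (\<lambda>x. f x *v g x) \<in> M \<rightarrow>\<^sub>M sphere_measure"
  using measurable_compose[OF _ haar_id_measurable[OF haar]] measurable_compose[OF _ sphere_id_measurable, of g M]
    measurable_space[of f M G] measurable_space[of g M sphere_measure]
  by (intro sphere_measurableI borel_measurable_matrix_vector_mult rotation_matrix_sphere) (auto simp: haar_space[OF haar])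

text \<open>The double integral of the indicator of A at \<open>transpose k ** g\<close> has the
  mass of A as its inner integral over g. Transposing the argument exchanges k and g, so the inner
  integral over k is the mass of the inverse of A. Left invariance and total mass 1 suffice.\<close>

lemma haar_inverse: "distr G G transpose = G"
proof (rule measure_eqI)
  fix A assume "A \<in> sets (distr G G transpose)"
  then have A [measurable]: "A \<in> sets G" by simp
  note [measurable] = haar_transpose_measurable
  let ?A = "transpose -` A \<inter> space G"
  have A' [measurable]: "?A \<in> sets G" by (rule measurable_sets[OF haar_transpose_measurable A])
  have left: "emeasure G B = (\<integral>\<^sup>+g. indicator B (transpose k ** g) \<partial>G)" if k: "k \<in> space G" and B: "B \<in> sets G" for k B
  proof -
    have r: "rotation_matrix (transpose k)" using k by (simp add: haar_space[OF haar] rotation_matrix_transpose)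
    have m: "(\<lambda>g. transpose k ** g) \<in> G \<rightarrow>\<^sub>M G"
      using r by (intro haar_mult_measurable measurable_const measurable_ident_sets[OF refl]) (simp_all add: haar_space[OF haar])
    have "emeasure G B = (\<integral>\<^sup>+g. indicator B g \<partial>distr G G (\<lambda>g. transpose k ** g))"
      unfolding haar_left[OF haar r] using B by simp
    also have "\<dots> = (\<integral>\<^sup>+g. indicator B (transpose k ** g) \<partial>G)"
      using B by (intro nn_integral_distr m) simp
    finally show ?thesis .
  qed
  have m: "(\<lambda>(k, g). transpose k ** g) \<in> G \<Otimes>\<^sub>M G \<rightarrow>\<^sub>M G"
    unfolding case_prod_beta'
    by (intro haar_mult_measurable measurable_compose[OF measurable_fst haar_transpose_measurable] measurable_snd)
  have "emeasure G A = (\<integral>\<^sup>+k. emeasure G A \<partial>G)" by (simp add: emeasure_space_1)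
  also have "\<dots> = (\<integral>\<^sup>+k. (\<integral>\<^sup>+g. indicator A (transpose k ** g) \<partial>G) \<partial>G)"
    by (rule nn_integral_cong) (rule left[OF _ A])
  also have "\<dots> = (\<integral>\<^sup>+g. (\<integral>\<^sup>+k. indicator A (transpose k ** g) \<partial>G) \<partial>G)"
    using measurable_compose[OF m borel_measurable_indicator[OF A]] by (intro GG.Fubini'[symmetric]) (simp add: case_prod_beta')
  also have "\<dots> = (\<integral>\<^sup>+g. (\<integral>\<^sup>+k. indicator ?A (transpose g ** k) \<partial>G) \<partial>G)"
  proof (rule nn_integral_cong, rule nn_integral_cong)
    fix g k assume "g \<in> space G" "k \<in> space G"
    then have "transpose g ** k \<in> space G"
      by (simp add: haar_space[OF haar] rotation_matrix_mult rotation_matrix_transpose)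
    then show "indicator A (transpose k ** g) = (indicator ?A (transpose g ** k) :: ennreal)"
      by (simp add: indicator_def matrix_transpose_mul)
  qed
  also have "\<dots> = (\<integral>\<^sup>+g. emeasure G ?A \<partial>G)"
    by (rule nn_integral_cong) (rule left[OF _ A', symmetric])
  also have "\<dots> = emeasure (distr G G transpose) A"
    by (simp add: emeasure_space_1 emeasure_distr[OF haar_transpose_measurable A])
  finally show "emeasure (distr G G transpose) A = emeasure G A" by simp
qed simp

lemma haar_right_measurable: "rotation_matrix k \<Longrightarrow> (\<lambda>g. g ** k) \<in> G \<rightarrow>\<^sub>M G"
  by (intro haar_mult_measurable measurable_const measurable_ident_sets[OF refl]) (simp_all add: haar_space[OF haar])

text \<open>Right translation by k is left translation by \<open>transpose k\<close>, preceded and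
  followed by inversion.\<close>

lemma haar_right:
  assumes k: "rotation_matrix k" shows "distr G G (\<lambda>g. g ** k) = G"
proof -
  have m: "(\<lambda>g. transpose k ** g) \<in> G \<rightarrow>\<^sub>M G"
    using k by (intro haar_mult_measurable measurable_const measurable_ident_sets[OF refl]) (simp_all add: haar_space[OF haar] rotation_matrix_transpose)
  have "distr G G (\<lambda>g. g ** k) = distr (distr G G transpose) G (\<lambda>g. g ** k)" by (simp only: haar_inverse)
  also have "\<dots> = distr G G (\<lambda>g. transpose g ** k)"
    by (subst distr_distr[OF haar_right_measurable[OF k] haar_transpose_measurable]) (simp add: o_def)
  also have "\<dots> = distr G G (\<lambda>g. transpose (transpose k ** g))"
    by (simp add: matrix_transpose_mul)
  also have "\<dots> = distr (distr G G (\<lambda>g. transpose k ** g)) G transpose"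
    by (subst distr_distr[OF haar_transpose_measurable m]) (simp add: o_def)
  also have "\<dots> = G"
    by (simp only: haar_left[OF haar rotation_matrix_transpose[OF k]] haar_inverse)
  finally show ?thesis .
qed

lemma haar_orbit_measurable: "x \<in> sphere 0 1 \<Longrightarrow> (\<lambda>g. g *v x) \<in> G \<rightarrow>\<^sub>M sphere_measure"
  by (intro haar_act_measurable measurable_ident_sets[OF refl] measurable_const) simp_all

end

text \<open>By right invariance and transitivity the image measure is the same for all base points.
  Averaging it over the base point and exchanging integrals yields the measure of the sphere, which
  every rotation preserves.\<close>

lemma haar_orbit:
  fixes G :: "(real ^ ('d::finite option) ^ ('d option)) measure"
  assumes haar: "haar_prob_SO G" and x: "x \<in> sphere 0 1"
  shows "distr G sphere_measure (\<lambda>g. g *v x) = sphere_measure"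
proof (rule measure_eqI)
  interpret prob_space G by (rule haar_prob[OF haar])
  interpret GS: pair_sigma_finite G "sphere_measure :: (real ^ ('d option)) measure" ..
  fix A assume "A \<in> sets (distr G sphere_measure (\<lambda>g. g *v x))"
  then have A: "A \<in> sets sphere_measure" by simp
  let ?S = "sphere_measure :: (real ^ ('d option)) measure"
  have indep: "emeasure (distr G ?S (\<lambda>g. g *v x)) A = (\<integral>\<^sup>+g. indicator A (g *v y) \<partial>G)" if y: "y \<in> sphere 0 1" for y
  proof -
    obtain R where R: "orthogonal_transformation R" "det (matrix R) = 1" "R x = y"
      using sphere_transitive[OF x y] by blast
    have k: "rotation_matrix (matrix R)"
      using R orthogonal_transformation_matrix by (auto simp: rotation_matrix_def)
    have kx: "matrix R *v x = y" using R by (simp add: orthogonal_transformation_linear)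
    have "distr G ?S (\<lambda>g. g *v x) = distr (distr G G (\<lambda>g. g ** matrix R)) ?S (\<lambda>g. g *v x)"
      by (simp only: haar_right[OF haar k])
    also have "\<dots> = distr G ?S (\<lambda>g. g *v y)"
      by (subst distr_distr[OF haar_orbit_measurable[OF haar x] haar_right_measurable[OF haar k]])
        (simp add: o_def matrix_vector_mul_assoc[symmetric] kx)
    finally have "emeasure (distr G ?S (\<lambda>g. g *v x)) A = (\<integral>\<^sup>+z. indicator A z \<partial>distr G ?S (\<lambda>g. g *v y))"
      using A by simp
    also have "\<dots> = (\<integral>\<^sup>+g. indicator A (g *v y) \<partial>G)"
      using A by (intro nn_integral_distr haar_orbit_measurable[OF haar y]) simp
    finally show ?thesis .
  qed
  have m: "(\<lambda>(g, y). g *v y) \<in> G \<Otimes>\<^sub>M ?S \<rightarrow>\<^sub>M ?S"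
    unfolding case_prod_beta' by (intro haar_act_measurable[OF haar] measurable_fst measurable_snd)
  have "emeasure (distr G ?S (\<lambda>g. g *v x)) A = (\<integral>\<^sup>+y. emeasure (distr G ?S (\<lambda>g. g *v x)) A \<partial>?S)"
    using sphere.emeasure_space_1[where 'a = "real ^ ('d option)"] by simp
  also have "\<dots> = (\<integral>\<^sup>+y. (\<integral>\<^sup>+g. indicator A (g *v y) \<partial>G) \<partial>?S)"
    by (rule nn_integral_cong) (rule indep, simp)
  also have "\<dots> = (\<integral>\<^sup>+g. (\<integral>\<^sup>+y. indicator A (g *v y) \<partial>?S) \<partial>G)"
    using measurable_compose[OF m borel_measurable_indicator[OF A]] by (intro GS.Fubini') (simp add: case_prod_beta')
  also have "\<dots> = (\<integral>\<^sup>+g. emeasure ?S A \<partial>G)"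
  proof (rule nn_integral_cong)
    fix g assume "g \<in> space G"
    then have R: "orthogonal_transformation (\<lambda>x. g *v x)"
      by (simp add: haar_space[OF haar] rotation_matrix_orthogonal_transformation)
    have "(\<integral>\<^sup>+y. indicator A (g *v y) \<partial>?S) = (\<integral>\<^sup>+y. indicator A y \<partial>distr ?S ?S (\<lambda>x. g *v x))"
      using A by (intro nn_integral_distr[symmetric] orthogonal_transformation_sphere_measurable[OF R]) simp
    also have "\<dots> = emeasure ?S A"
      unfolding distr_sphere_measure_orthogonal[OF R] using A by simp
    finally show "(\<integral>\<^sup>+y. indicator A (g *v y) \<partial>?S) = emeasure ?S A" .
  qed
  also have "\<dots> = emeasure ?S A" by (simp add: emeasure_space_1)
  finally show "emeasure (distr G ?S (\<lambda>g. g *v x)) A = emeasure ?S A" .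
qed simp


subsection \<open>Convolution\<close>

context
  fixes G :: "(real ^ ('d::finite option) ^ ('d option)) measure"
  assumes haar: "haar_prob_SO G"
begin

lemma haar_orbit_inverse_measurable:
  fixes x :: "real ^ ('d option)"
  shows "x \<in> sphere 0 1 \<Longrightarrow> (\<lambda>g. transpose g *v x) \<in> G \<rightarrow>\<^sub>M sphere_measure"
  by (rule measurable_compose[OF haar_transpose_measurable[OF haar] haar_orbit_measurable[OF haar]])

lemma haar_orbit_inverse:
  assumes x: "x \<in> sphere 0 1"
  shows "distr G sphere_measure (\<lambda>g. transpose g *v x) = sphere_measure"
proof -
  have "distr G sphere_measure (\<lambda>g. transpose g *v x) = distr (distr G G transpose) sphere_measure (\<lambda>g. g *v x)"
    by (subst distr_distr[OF haar_orbit_measurable[OF haar x] haar_transpose_measurable[OF haar]]) (simp add: o_def)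
  then show ?thesis by (simp only: haar_inverse[OF haar] haar_orbit[OF haar x])
qed

lemma haar_orbit_L2:
  assumes x: "x \<in> sphere 0 1" and f: "f \<in> sphere_L2"
  shows "(\<lambda>g. f (g *v x)) \<in> borel_measurable G" "integrable G (\<lambda>g. (cmod (f (g *v x)))\<^sup>2)"
    "(\<integral>g. (cmod (f (g *v x)))\<^sup>2 \<partial>G) = (L2_norm f)\<^sup>2"
proof -
  note m = haar_orbit_measurable[OF haar x] and fm = sphere_L2_D[OF f]
  show "(\<lambda>g. f (g *v x)) \<in> borel_measurable G" by (rule measurable_compose[OF m fm(1)])
  have q: "(\<lambda>x. (cmod (f x))\<^sup>2) \<in> borel_measurable sphere_measure" using fm(1) by measurable
  show "integrable G (\<lambda>g. (cmod (f (g *v x)))\<^sup>2)"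
    using fm(2) integrable_distr_eq[OF m q] haar_orbit[OF haar x] by simp
  show "(\<integral>g. (cmod (f (g *v x)))\<^sup>2 \<partial>G) = (L2_norm f)\<^sup>2"
    using integral_distr[OF m q] haar_orbit[OF haar x] by (simp add: L2_norm_sq)
qed

lemma haar_orbit_inverse_L2:
  assumes x: "x \<in> sphere 0 1" and f: "f \<in> sphere_L2"
  shows "(\<lambda>g. f (transpose g *v x)) \<in> borel_measurable G" "integrable G (\<lambda>g. (cmod (f (transpose g *v x)))\<^sup>2)"
    "(\<integral>g. (cmod (f (transpose g *v x)))\<^sup>2 \<partial>G) = (L2_norm f)\<^sup>2"
proof -
  note m = haar_orbit_inverse_measurable[OF x] and fm = sphere_L2_D[OF f]
  show "(\<lambda>g. f (transpose g *v x)) \<in> borel_measurable G" by (rule measurable_compose[OF m fm(1)])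
  have q: "(\<lambda>x. (cmod (f x))\<^sup>2) \<in> borel_measurable sphere_measure" using fm(1) by measurable
  show "integrable G (\<lambda>g. (cmod (f (transpose g *v x)))\<^sup>2)"
    using fm(2) integrable_distr_eq[OF m q] haar_orbit_inverse[OF x] by simp
  show "(\<integral>g. (cmod (f (transpose g *v x)))\<^sup>2 \<partial>G) = (L2_norm f)\<^sup>2"
    using integral_distr[OF m q] haar_orbit_inverse[OF x] by (simp add: L2_norm_sq)
qed

lemma sphere_conv_eq: "sphere_conv G h f x = (\<integral>g. h (transpose g *v x) * f (g *v north_pole) \<partial>G)"
  unfolding sphere_conv_def
  by (rule Bochner_Integration.integral_cong) (simp_all add: haar_space[OF haar] rotation_matrix_inv)

text \<open>Both orbit maps carry Haar measure to the measure of the sphere, so the factors of the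
  integrand have the norms of h and f. Cauchy-Schwarz on the group then bounds every point
  value.\<close>

lemma sphere_conv_bound:
  assumes h: "h \<in> sphere_L2" and f: "f \<in> sphere_L2" and x: "x \<in> sphere 0 1"
  shows "integrable G (\<lambda>g. h (transpose g *v x) * f (g *v north_pole))"
    "cmod (sphere_conv G h f x) \<le> L2_norm h * L2_norm f"
  using cauchy_schwarz_integral[OF haar_orbit_inverse_L2(1,2)[OF x h] haar_orbit_L2(1,2)[OF north_pole_sphere f]]
  by (simp_all add: sphere_conv_eq haar_orbit_inverse_L2(3)[OF x h] haar_orbit_L2(3)[OF north_pole_sphere f] L2_norm_nonneg)

lemma sphere_conv_sum:
  assumes h: "\<And>i. i \<in> A \<Longrightarrow> h i \<in> sphere_L2" and f: "f \<in> sphere_L2" and x: "x \<in> sphere 0 1"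
  shows "sphere_conv G (\<lambda>x. \<Sum>i\<in>A. c i * h i x) f x = (\<Sum>i\<in>A. c i * sphere_conv G (h i) f x)"
proof -
  have "sphere_conv G (\<lambda>x. \<Sum>i\<in>A. c i * h i x) f x =
     (\<integral>g. (\<Sum>i\<in>A. c i * (h i (transpose g *v x) * f (g *v north_pole))) \<partial>G)"
    by (simp add: sphere_conv_eq sum_distrib_right mult.assoc)
  also have "\<dots> = (\<Sum>i\<in>A. \<integral>g. c i * (h i (transpose g *v x) * f (g *v north_pole)) \<partial>G)"
    by (intro Bochner_Integration.integral_sum integrable_mult_right sphere_conv_bound(1) h f x)
  finally show ?thesis by (simp add: sphere_conv_eq)
qed

lemma sphere_conv_diff:
  assumes "h \<in> sphere_L2" "h' \<in> sphere_L2" "f \<in> sphere_L2" "x \<in> sphere 0 1"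
  shows "sphere_conv G (\<lambda>x. h x - h' x) f x = sphere_conv G h f x - sphere_conv G h' f x"
  using sphere_conv_bound(1)[OF assms(1,3,4)] sphere_conv_bound(1)[OF assms(2,3,4)]
  by (simp add: sphere_conv_eq left_diff_distrib)

text \<open>Substitute \<open>g ** k\<close> for g: in the first factor k cancels against its
  transpose, in the second k fixes the pole.\<close>

lemma sphere_conv_stabilizer:
  assumes k: "rotation_matrix k" "k *v north_pole = north_pole"
    and h: "h \<in> sphere_L2" and f: "f \<in> sphere_L2" and x: "x \<in> sphere 0 1"
  shows "sphere_conv G (\<lambda>x. h (k *v x)) f x = sphere_conv G h f x"
proof -
  let ?F = "\<lambda>g. h (k *v (transpose g *v x)) * f (g *v north_pole)"
  have "(\<lambda>x. h (k *v x)) \<in> sphere_L2"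
  proof -
    have R: "orthogonal_transformation (\<lambda>x. k *v x)" by (rule rotation_matrix_orthogonal_transformation[OF k(1)])
    note m = orthogonal_transformation_sphere_measurable[OF R]
    have q: "(\<lambda>x. (cmod (h x))\<^sup>2) \<in> borel_measurable sphere_measure" using sphere_L2_D(1)[OF h] by measurable
    show ?thesis
      using measurable_compose[OF m sphere_L2_D(1)[OF h]] sphere_L2_D(2)[OF h] integrable_distr_eq[OF m q]
        distr_sphere_measure_orthogonal[OF R] by (simp add: sphere_L2_def)
  qed
  from sphere_conv_bound(1)[OF this f x] have m: "?F \<in> borel_measurable G" by auto
  have "sphere_conv G (\<lambda>x. h (k *v x)) f x = (\<integral>g. ?F g \<partial>distr G G (\<lambda>g. g ** k))"
    by (simp only: sphere_conv_eq haar_right[OF haar k(1)])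
  also have "\<dots> = (\<integral>g. ?F (g ** k) \<partial>G)"
    by (rule integral_distr[OF haar_right_measurable[OF haar k(1)] m])
  also have "\<dots> = (\<integral>g. h (transpose g *v x) * f (g *v north_pole) \<partial>G)"
  proof (rule Bochner_Integration.integral_cong[OF refl])
    fix g
    have "k *v (transpose (g ** k) *v x) = (k ** transpose k) *v (transpose g *v x)"
      by (simp add: matrix_transpose_mul matrix_vector_mul_assoc matrix_mul_assoc)
    also have "k ** transpose k = mat 1" using k(1) by (simp add: rotation_matrix_def orthogonal_matrix_def)
    finally have "k *v (transpose (g ** k) *v x) = transpose g *v x" by simp
    moreover have "(g ** k) *v north_pole = g *v north_pole"
      by (simp add: matrix_vector_mul_assoc[symmetric] k(2))
    ultimately show "?F (g ** k) = h (transpose g *v x) * f (g *v north_pole)" by simp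
  qed
  finally show ?thesis by (simp add: sphere_conv_eq)
qed

text \<open>The functional \<open>Y \<mapsto> (Y * f)(x)\<close> is invariant under the stabilizer of the pole, so it is
  represented by a multiple of the zonal harmonic; the multiple is found by evaluating the
  functional at the zonal harmonic itself.\<close>

lemma sphere_conv_harmonics:
  fixes Y :: "real ^ ('d option) \<Rightarrow> complex"
  assumes D: "2 \<le> CARD('d)" and Y: "Y \<in> harmonics k" and f: "f \<in> sphere_L2" and x: "x \<in> sphere 0 1"
  shows "sphere_conv G Y f x =
    Y north_pole / of_nat (cfun.dim (harmonics k :: (real ^ ('d option) \<Rightarrow> complex) set)) * harmonic_proj k f x"
proof -
  define B where "B q = sphere_conv G q f x" for q
  define V where "V = (\<lambda>z. \<Sum>e\<in>hbasis k. cnj (B e) * e z)"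
  have V: "V \<in> harmonics k"
    unfolding V_def span_hbasis[symmetric] by (intro cfun_span_sum cfun.span_scale cfun.span_base)
  have BV: "B q = L2_inner q V" if q: "q \<in> harmonics k" for q
  proof -
    have "B q = B (\<lambda>z. \<Sum>e\<in>hbasis k. L2_inner q e * e z)" using harmonics_expand[OF q] by simp
    also have "\<dots> = (\<Sum>e\<in>hbasis k. L2_inner q e * B e)"
      unfolding B_def by (rule sphere_conv_sum[OF hbasis_L2 f x])
    also have "\<dots> = (\<Sum>e\<in>hbasis k. L2_inner q (\<lambda>z. cnj (B e) * e z))"
      unfolding L2_inner_cmult_right by (simp add: mult.commute)
    also have "\<dots> = L2_inner q V"
      unfolding V_def by (intro L2_inner_sum_right[symmetric] sphere_L2_cmult hbasis_L2 harmonics_L2[OF q])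
    finally show ?thesis .
  qed
  have "zonal_invariant north_pole V"
    unfolding zonal_invariant_def
  proof (intro allI impI)
    fix u v :: "real ^ ('d option)" and t z
    assume uv: "orthonormal_pair u v" "u \<bullet> north_pole = 0" "v \<bullet> north_pole = 0"
    let ?R = "rot u v t" and ?S = "rot u v (- t)"
    have R: "orthogonal_transformation ?R" and S: "orthogonal_transformation ?S"
      by (rule orthogonal_transformation_rot[OF uv(1)])+
    have SR: "?S (?R z) = z" for z by (simp add: rot_add[OF uv(1)])
    have VR: "(\<lambda>z. V (?R z)) \<in> harmonics k" by (rule harmonics_compose_orthogonal[OF R V])
    have "(\<lambda>z. V (?R z) - V z) = (\<lambda>z. 0)"
    proof (rule harmonics_definite[OF harmonics_diff[OF VR V]])
      fix q :: "real ^ ('d option) \<Rightarrow> complex" assume q: "q \<in> harmonics k"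
      have qS: "(\<lambda>z. q (?S z)) \<in> harmonics k" by (rule harmonics_compose_orthogonal[OF S q])
      have "L2_inner q (\<lambda>z. V (?R z)) = L2_inner (\<lambda>z. q (?S (?R z))) (\<lambda>z. V (?R z))" by (simp only: SR)
      also have "\<dots> = L2_inner (\<lambda>z. q (?S z)) V"
        by (rule L2_inner_orthogonal[OF R harmonics_L2[OF qS] harmonics_L2[OF V]])
      also have "\<dots> = B (\<lambda>z. q (?S z))" by (rule BV[OF qS, symmetric])
      also have "\<dots> = B q"
      proof -
        have "matrix ?S *v north_pole = north_pole"
          using uv by (simp add: rotation_matrix_rot(2) rot_def inner_commute)
        from sphere_conv_stabilizer[OF rotation_matrix_rot(1)[OF uv(1)] this harmonics_L2[OF q] f x]
        show ?thesis by (simp add: B_def rotation_matrix_rot(2)[OF uv(1)])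
      qed
      also have "\<dots> = L2_inner q V" by (rule BV[OF q])
      finally have "L2_inner (\<lambda>z. V (?R z)) q = L2_inner V q"
        using L2_inner_cnj[of "\<lambda>z. V (?R z)" q] L2_inner_cnj[of V q] by simp
      then show "L2_inner (\<lambda>z. V (?R z) - V z) q = 0"
        by (simp add: L2_inner_diff_left harmonics_L2[OF VR] harmonics_L2[OF V] harmonics_L2[OF q])
    qed
    from fun_cong[OF this, of z] show "V (?R z) = V z" by simp
  qed
  then obtain c where c: "V = (\<lambda>z. c * hkernel k z north_pole)"
    using zonal_harmonic_kernel[OF D V] by blast
  have BY: "B q = cnj c * q north_pole" if "q \<in> harmonics k" for q
    unfolding BV[OF that] c L2_inner_cmult_right hkernel_reproducing[OF that] ..
  let ?Z = "\<lambda>z. hkernel k z (north_pole :: real ^ ('d option))"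
  let ?\<delta> = "of_nat (cfun.dim (harmonics k :: (real ^ ('d option) \<Rightarrow> complex) set)) :: complex"
  have "B ?Z = harmonic_proj k f x"
  proof -
    have "B ?Z = (\<integral>g. hkernel k x (g *v north_pole) * f (g *v north_pole) \<partial>G)"
      unfolding B_def sphere_conv_eq
    proof (rule Bochner_Integration.integral_cong[OF refl])
      fix g assume "g \<in> space G"
      then have g: "rotation_matrix g" by (simp add: haar_space[OF haar])
      have "g *v (transpose g *v x) = x"
        using g by (simp add: matrix_vector_mul_assoc rotation_matrix_def orthogonal_matrix_def)
      then have "hkernel k (transpose g *v x) north_pole = hkernel k x (g *v north_pole)"
        using hkernel_orthogonal[OF rotation_matrix_orthogonal_transformation[OF g], of k "transpose g *v x" north_pole] by simp
      then show "hkernel k (transpose g *v x) north_pole * f (g *v north_pole) = hkernel k x (g *v north_pole) * f (g *v north_pole)"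
        by simp
    qed
    also have "\<dots> = (\<integral>z. hkernel k x z * f z \<partial>distr G sphere_measure (\<lambda>g. g *v north_pole))"
    proof (rule integral_distr[symmetric, OF haar_orbit_measurable[OF haar north_pole_sphere]])
      have "(\<lambda>z. cnj (hkernel k z x)) \<in> borel_measurable sphere_measure"
        using sphere_L2_D(1)[OF sphere_L2_cnj[OF harmonics_L2[OF hkernel_harmonics]]] .
      then show "(\<lambda>z. hkernel k x z * f z) \<in> borel_measurable sphere_measure"
        using sphere_L2_D(1)[OF f] unfolding hkernel_cnj by (rule borel_measurable_times)
    qed
    also have "\<dots> = L2_inner f (\<lambda>z. hkernel k z x)"
      unfolding haar_orbit[OF haar north_pole_sphere] by (simp add: L2_inner_def hkernel_cnj mult.commute)
    also have "\<dots> = harmonic_proj k f x" by (rule hkernel_proj[OF f])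
    finally show ?thesis .
  qed
  moreover have "B ?Z = cnj c * ?\<delta>"
    using BY[OF hkernel_harmonics[of k north_pole]] hkernel_diagonal[OF north_pole_sphere, of k, where 'd = 'd] by simp
  ultimately have cd: "harmonic_proj k f x = cnj c * ?\<delta>" by simp
  show ?thesis
  proof (cases "?\<delta> = 0")
    case True
    then have "Y north_pole = 0"
      using harmonics_pointwise_bound[OF Y north_pole_sphere] by simp
    then show ?thesis using BY[OF Y] by (simp add: B_def)
  next
    case False
    then show ?thesis using BY[OF Y] cd by (simp add: B_def)
  qed
qed

end

section \<open>The multiplier expansion of the convolution\<close>

context
  fixes G :: "(real ^ ('d::finite option) ^ ('d option)) measure"
    and h f :: "real ^ ('d option) \<Rightarrow> complex"
  assumes haar: "haar_prob_SO G" and D: "2 \<le> CARD('d)" and h: "h \<in> sphere_L2" and f: "f \<in> sphere_L2"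
begin

definition conv_partial :: "nat \<Rightarrow> real ^ ('d option) \<Rightarrow> complex"
  where "conv_partial N = (\<lambda>x. \<Sum>k\<le>N. conv_coeff h k * harmonic_proj k f x)"

lemma conv_partial_eq:
  assumes x: "x \<in> sphere 0 1"
  shows "sphere_conv G (hpartial N h) f x = conv_partial N x"
proof -
  have "sphere_conv G (hpartial N h) f x = sphere_conv G (\<lambda>x. \<Sum>k\<le>N. 1 * harmonic_proj k h x) f x"
    by (simp add: hpartial_def)
  also have "\<dots> = (\<Sum>k\<le>N. 1 * sphere_conv G (harmonic_proj k h) f x)"
    by (rule sphere_conv_sum[OF haar harmonic_proj_L2[OF h] f x])
  also have "\<dots> = conv_partial N x"
    unfolding conv_partial_def conv_coeff_def
    by (simp add: sphere_conv_harmonics[OF haar D harmonic_proj_harmonics[OF h] f x])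
  finally show ?thesis .
qed

text \<open>It is h that gets truncated: the error is again a convolution, and
  \<open>sphere_conv_bound\<close> makes it small uniformly in x. Continuity and the pointwise
  expansion both rest on this.\<close>

lemma conv_partial_error:
  assumes x: "x \<in> sphere 0 1"
  shows "cmod (sphere_conv G h f x - conv_partial N x) \<le> L2_norm (\<lambda>x. h x - hpartial N h x) * L2_norm f"
proof -
  have P: "hpartial N h \<in> sphere_L2" by (rule harmonics_upto_L2[OF hpartial_upto[OF h]])
  have "sphere_conv G h f x - conv_partial N x = sphere_conv G (\<lambda>x. h x - hpartial N h x) f x"
    by (simp add: conv_partial_eq[OF x, symmetric] sphere_conv_diff[OF haar h P f x])
  then show ?thesis using sphere_conv_bound(2)[OF haar sphere_L2_diff[OF h P] f x] by simp
qed

lemma conv_error_tendsto: "(\<lambda>N. L2_norm (\<lambda>x. h x - hpartial N h x) * L2_norm f) \<longlonglongrightarrow> 0"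
proof -
  have "(\<lambda>N. sqrt ((L2_norm (\<lambda>x. h x - hpartial N h x))\<^sup>2)) \<longlonglongrightarrow> sqrt 0"
    by (intro tendsto_real_sqrt hpartial_limit h)
  then have "(\<lambda>N. L2_norm (\<lambda>x. h x - hpartial N h x)) \<longlonglongrightarrow> 0"
    by (simp add: L2_norm_nonneg)
  from tendsto_mult_right[OF this, of "L2_norm f"] show ?thesis by simp
qed

lemma conv_sums:
  assumes x: "x \<in> sphere 0 1"
  shows "(\<lambda>k. conv_coeff h k * harmonic_proj k f x) sums sphere_conv G h f x"
proof -
  have "(\<lambda>N. norm (sphere_conv G h f x - conv_partial N x)) \<longlonglongrightarrow> 0"
    by (rule tendsto_sandwich[OF _ _ tendsto_const conv_error_tendsto])
      (use conv_partial_error[OF x] in auto)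
  then have "(\<lambda>N. dist (conv_partial N x) (sphere_conv G h f x)) \<longlonglongrightarrow> 0"
    by (simp add: dist_norm norm_minus_commute)
  then have "(\<lambda>N. conv_partial N x) \<longlonglongrightarrow> sphere_conv G h f x"
    by (subst tendsto_dist_iff)
  then show ?thesis by (simp add: sums_def_le conv_partial_def)
qed

lemma conv_partial_upto: "conv_partial N \<in> harmonics_upto N"
  unfolding harmonics_upto_def conv_partial_def
  by (intro CollectI exI[of _ "\<lambda>k x. conv_coeff h k * harmonic_proj k f x"])
    (simp add: harmonics_cmult harmonic_proj_harmonics f)

lemma conv_continuous: "continuous_on (sphere 0 1) (sphere_conv G h f)"
proof (rule uniform_limit_theorem)
  show "\<forall>\<^sub>F N in sequentially. continuous_on (sphere 0 1) (conv_partial N)"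
  proof (intro always_eventually allI)
    fix N
    have "sphere_fun (harmonic_proj k f)" for k by (rule harmonics_sphere_fun[OF harmonic_proj_harmonics[OF f]])
    then have "sphere_fun (conv_partial N)"
      unfolding conv_partial_def by (intro sphere_fun_sum sphere_fun_cmult)
    then show "continuous_on (sphere 0 1) (conv_partial N)" by (simp add: sphere_fun_def)
  qed
  show "uniform_limit (sphere 0 1) conv_partial (sphere_conv G h f) sequentially"
  proof (rule uniform_limitI)
    fix e :: real assume "0 < e"
    from order_tendstoD(2)[OF conv_error_tendsto this]
    show "\<forall>\<^sub>F N in sequentially. \<forall>x\<in>sphere 0 1. dist (conv_partial N x) (sphere_conv G h f x) < e"
    proof eventually_elim
      case (elim N)
      then show ?case
        using le_less_trans[OF conv_partial_error elim] by (simp add: dist_norm norm_minus_commute)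
    qed
  qed
qed simp

lemma conv_L2: "sphere_conv G h f \<in> sphere_L2"
  by (rule sphere_L2_continuous[OF conv_continuous])

lemma conv_partial_L2_error:
  "L2_norm (\<lambda>x. sphere_conv G h f x - conv_partial N x) \<le> L2_norm (\<lambda>x. h x - hpartial N h x) * L2_norm f"
proof -
  let ?e = "L2_norm (\<lambda>x. h x - hpartial N h x) * L2_norm f"
  have e: "0 \<le> ?e" by (simp add: L2_norm_nonneg)
  have d: "(\<lambda>x. sphere_conv G h f x - conv_partial N x) \<in> sphere_L2"
    by (rule sphere_L2_diff[OF conv_L2 harmonics_upto_L2[OF conv_partial_upto]])
  have "(L2_norm (\<lambda>x. sphere_conv G h f x - conv_partial N x))\<^sup>2 \<le> (\<integral>x. ?e\<^sup>2 \<partial>(sphere_measure :: (real ^ ('d option)) measure))"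
    unfolding L2_norm_sq
  proof (rule integral_mono)
    show "(cmod (sphere_conv G h f x - conv_partial N x))\<^sup>2 \<le> ?e\<^sup>2" if "x \<in> space sphere_measure" for x
      using that by (intro power_mono conv_partial_error) auto
  qed (use sphere_L2_D(2)[OF d] in auto)
  also have "\<dots> = ?e\<^sup>2" using sphere.prob_space[where 'a = "real ^ ('d option)"] by simp
  finally show ?thesis using e by (rule power2_le_imp_le)
qed

text \<open>For k \<le> N the projection of the partial sum is already the claimed function, so the
  two pairings with q differ by at most the truncation error times the norm of q, which tends to
  0.\<close>

lemma harmonic_proj_conv:
  "harmonic_proj k (sphere_conv G h f) = (\<lambda>x. conv_coeff h k * harmonic_proj k f x)"
proof (rule harmonic_proj_eqI[OF conv_L2 harmonics_cmult[OF harmonic_proj_harmonics[OF f]]])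
  fix q :: "real ^ ('d option) \<Rightarrow> complex" assume q: "q \<in> harmonics k"
  let ?A = "L2_inner (sphere_conv G h f) q" and ?B = "L2_inner (\<lambda>x. conv_coeff h k * harmonic_proj k f x) q"
  have "cmod (?A - ?B) \<le> (L2_norm (\<lambda>x. h x - hpartial N h x) * L2_norm f) * L2_norm q" if "k \<le> N" for N
  proof -
    have P: "conv_partial N \<in> sphere_L2" by (rule harmonics_upto_L2[OF conv_partial_upto])
    have "L2_inner (conv_partial N) q = L2_inner (harmonic_proj k (conv_partial N)) q"
      by (rule harmonic_proj_inner[OF P q, symmetric])
    also have "harmonic_proj k (conv_partial N) = (\<lambda>x. conv_coeff h k * harmonic_proj k f x)"
      unfolding conv_partial_def
      using that by (subst harmonic_proj_upto) (auto intro: harmonics_cmult harmonic_proj_harmonics f)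
    finally have "?A - ?B = L2_inner (\<lambda>x. sphere_conv G h f x - conv_partial N x) q"
      by (simp add: L2_inner_diff_left[OF conv_L2 P harmonics_L2[OF q]])
    also have "cmod \<dots> \<le> L2_norm (\<lambda>x. sphere_conv G h f x - conv_partial N x) * L2_norm q"
      by (rule L2_inner_cauchy_schwarz[OF sphere_L2_diff[OF conv_L2 P] harmonics_L2[OF q]])
    also have "\<dots> \<le> (L2_norm (\<lambda>x. h x - hpartial N h x) * L2_norm f) * L2_norm q"
      by (intro mult_right_mono conv_partial_L2_error L2_norm_nonneg)
    finally show ?thesis .
  qed
  then have ev: "\<forall>\<^sub>F N in sequentially. cmod (?A - ?B) \<le> (L2_norm (\<lambda>x. h x - hpartial N h x) * L2_norm f) * L2_norm q"
    using eventually_ge_at_top[of k] by (rule eventually_mono[rotated])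
  have "(\<lambda>N. (L2_norm (\<lambda>x. h x - hpartial N h x) * L2_norm f) * L2_norm q) \<longlonglongrightarrow> 0 * L2_norm q"
    by (rule tendsto_mult_right[OF conv_error_tendsto])
  from tendsto_lowerbound[OF this ev] have "cmod (?A - ?B) \<le> 0" by simp
  then show "?B = ?A" by simp
qed

end

subsection \<open>Dimension estimates\<close>

lemma powr_bernoulli:
  fixes x r :: real
  assumes "0 < x" "0 \<le> r"
  shows "1 + r * (1 - x) \<le> x powr (- r)"
proof -
  have "ln x \<le> x - 1" using assms by (intro ln_le_minus_one)
  then have "r * (1 - x) \<le> - r * ln x" using mult_left_mono[of "ln x" "x - 1" r] assms by (simp add: algebra_simps)
  moreover have "1 + (- r * ln x) \<le> exp (- r * ln x)" by (rule exp_ge_add_one_self)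
  ultimately show ?thesis using assms by (simp add: powr_def)
qed

text \<open>Both sides agree at x = 1, and \<open>powr_bernoulli\<close> with exponent s + 1 makes
  their difference nonincreasing.\<close>

lemma powr_taylor2:
  fixes x s :: real
  assumes x: "0 < x" "x \<le> 1" and s: "0 < s"
  shows "1 + s * (1 - x) + s * (s + 1) / 2 * (1 - x)\<^sup>2 \<le> x powr (- s)"
proof -
  let ?h = "\<lambda>x. x powr (- s) - (1 + s * (1 - x) + s * (s + 1) / 2 * (1 - x)\<^sup>2)"
  have "?h 1 \<le> ?h x"
  proof (rule DERIV_nonpos_imp_nonincreasing[OF x(2)])
    fix y assume y: "x \<le> y" "y \<le> 1"
    then have "0 < y" using x by simp
    have "(?h has_real_derivative (- s * y powr (- s - 1) + s + s * (s + 1) * (1 - y))) (at y)"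
      using \<open>0 < y\<close> by (auto intro!: derivative_eq_intros simp: field_simps power2_eq_square)
    moreover have "- s * y powr (- s - 1) + s + s * (s + 1) * (1 - y) \<le> 0"
    proof -
      have e: "- s - 1 = - (s + 1)" by simp
      have "1 + (s + 1) * (1 - y) \<le> y powr (- s - 1)"
        unfolding e by (rule powr_bernoulli) (use \<open>0 < y\<close> s in auto)
      then have "s * (1 + (s + 1) * (1 - y)) \<le> s * y powr (- s - 1)"
        using s by (intro mult_left_mono) auto
      moreover have "s * (1 + (s + 1) * (1 - y)) = s + s * (s + 1) * (1 - y)"
        by (simp add: algebra_simps)
      ultimately show ?thesis by simp
    qed
    ultimately show "\<exists>D. (?h has_real_derivative D) (at y) \<and> D \<le> 0" by blast
  qed
  then show ?thesis by simp
qed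

text \<open>The bound \<open>powr_taylor2\<close> at x = a / b, scaled by
  \<open>b powr (- s) / s\<close>. The expansion is about the larger point because each summand over
  the degrees carries the weight of its own degree while the difference looks back to the previous
  one.\<close>

lemma powr_diff_lower:
  fixes a b s :: real
  assumes a: "0 < a" "a \<le> b" and s: "0 < s"
  shows "(b - a) * b powr (- s - 1) + (s + 1) / 2 * (b - a)\<^sup>2 * b powr (- s - 2) \<le> (a powr (- s) - b powr (- s)) / s"
proof -
  have b: "0 < b" using a by simp
  have "1 + s * (1 - a / b) + s * (s + 1) / 2 * (1 - a / b)\<^sup>2 \<le> (a / b) powr (- s)"
    using a b s by (intro powr_taylor2) auto
  also have "(a / b) powr (- s) = a powr (- s) / b powr (- s)"
    using a b by (simp add: powr_divide)
  finally have e0: "b powr (- s) * (1 + s * (1 - a / b) + s * (s + 1) / 2 * (1 - a / b)\<^sup>2) \<le> a powr (- s)"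
    using b by (simp add: pos_le_divide_eq mult.commute)
  have ab: "1 - a / b = (b - a) / b" using b by (simp add: diff_divide_distrib)
  have e1: "b powr (- s) * (1 - a / b) = (b - a) * b powr (- s - 1)"
    unfolding ab using b by (simp add: powr_diff)
  have "b powr (- s - 2) = b powr (- s) / b\<^sup>2" using b by (simp add: powr_diff powr_numeral)
  then have e2: "b powr (- s) * (1 - a / b)\<^sup>2 = (b - a)\<^sup>2 * b powr (- s - 2)"
    unfolding ab by (simp add: power_divide)
  have "P * (1 + s * x + s * (s + 1) / 2 * x\<^sup>2) = P + s * (P * x) + s * (s + 1) / 2 * (P * x\<^sup>2)" for P x
    by (simp add: algebra_simps)
  from e0[unfolded this e1 e2]
  have "s * ((b - a) * b powr (- s - 1)) + s * ((s + 1) / 2 * (b - a)\<^sup>2 * b powr (- s - 2)) \<le> a powr (- s) - b powr (- s)"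
    by simp
  then have "s * ((b - a) * b powr (- s - 1) + (s + 1) / 2 * (b - a)\<^sup>2 * b powr (- s - 2)) \<le> a powr (- s) - b powr (- s)"
    by (simp only: distrib_left)
  then show ?thesis using s by (simp add: pos_le_divide_eq mult.commute)
qed

lemma binomial_prod: "real ((k + e) choose e) = (\<Prod>j=1..e. (real k + real j) / real j)"
proof (induction e)
  case (Suc e)
  have "Suc e * (Suc (k + e) choose Suc e) = Suc (k + e) * (k + e choose e)"
    by (rule Suc_times_binomial)
  then have "real (Suc e) * real (Suc (k + e) choose Suc e) = real (Suc (k + e)) * real (k + e choose e)"
    by (metis of_nat_mult)
  then have "real ((k + Suc e) choose Suc e) = real (k + e choose e) * ((real k + real (Suc e)) / real (Suc e))"
    by (simp add: field_simps)
  then show ?case using Suc by simp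
qed simp

text \<open>Pairing factor j with factor e + 1 - j gives 1 + k (k + e + 1) / a, where a = j (e + 1 -
  j) is at least 1. With d = e + 2 each pair is thus at most one plus the eigenvalue.\<close>

lemma binomial_sq_bound: "(real ((k + e) choose e))\<^sup>2 \<le> (1 + real k * (real k + real e + 1)) ^ e"
proof -
  let ?f = "\<lambda>j. (real k + real j) / real j"
  have "(\<Prod>j=1..e. ?f j) = (\<Prod>j=1..e. ?f (e + 1 - j))"
    by (rule prod.atLeastAtMost_rev[of ?f 1 e, THEN trans]) simp
  then have "(real ((k + e) choose e))\<^sup>2 = (\<Prod>j=1..e. ?f j * ?f (e + 1 - j))"
    by (simp only: binomial_prod power2_eq_square prod.distrib)
  also have "\<dots> \<le> (\<Prod>j=1..e. 1 + real k * (real k + real e + 1))"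
  proof (rule prod_mono)
    fix j assume j: "j \<in> {1..e}"
    define a where "a = real j * real (e + 1 - j)"
    have "1 \<le> real j" "1 \<le> real (e + 1 - j)" using j by auto
    then have a: "1 \<le> a" unfolding a_def using mult_mono[of 1 "real j" 1 "real (e + 1 - j)"] by simp
    have "?f j * ?f (e + 1 - j) = ((real k + real j) * (real k + real (e + 1 - j))) / a"
      by (simp add: a_def)
    also have "(real k + real j) * (real k + real (e + 1 - j)) = real k * (real k + (real j + real (e + 1 - j))) + a"
      by (simp add: a_def algebra_simps)
    also have "real j + real (e + 1 - j) = real e + 1" using j by (simp add: of_nat_diff)
    finally have "?f j * ?f (e + 1 - j) = (real k * (real k + real e + 1) + a) / a"
      by (simp add: add.assoc)
    also have "\<dots> \<le> 1 + real k * (real k + real e + 1)"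
    proof -
      have "real k * (real k + real e + 1) * 1 \<le> real k * (real k + real e + 1) * a"
        using a by (intro mult_left_mono) auto
      then show ?thesis using a by (simp add: divide_le_eq algebra_simps)
    qed
    finally show "0 \<le> ?f j * ?f (e + 1 - j) \<and> ?f j * ?f (e + 1 - j) \<le> 1 + real k * (real k + real e + 1)"
      by simp
  qed
  finally show ?thesis by simp
qed

text \<open>At k = 0 truncated subtraction makes this 2 instead of 1; the sums below run over
  degrees above m \<ge> 1.\<close>

definition harmonic_dim_bound :: "nat \<Rightarrow> nat \<Rightarrow> nat"
  where "harmonic_dim_bound d k = ((k + d - 1) choose k) + ((k - 1 + d - 1) choose (k - 1))"

text \<open>The classical dimension formula: a linear factor times a binomial coefficient of lower
  index e = d - 2, which \<open>binomial_sq_bound\<close> compares with a power of the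
  eigenvalue.\<close>

lemma harmonic_dim_bound_eq:
  assumes k: "1 \<le> k"
  shows "(real e + 1) * real (harmonic_dim_bound (e + 2) k) = (2 * real k + real e + 1) * real ((k + e) choose e)"
proof -
  obtain j where j: "k = Suc j" using k by (cases k) auto
  have s: "((k + (e + 2) - 1) choose k) = (k + Suc e choose Suc e)" "((k - 1 + (e + 2) - 1) choose (k - 1)) = (k + e choose Suc e)"
    using binomial_symmetric[of k "k + Suc e"] binomial_symmetric[of j "j + Suc e"] by (simp_all add: j)
  have "Suc e * (Suc (k + e) choose Suc e) = Suc (k + e) * (k + e choose e)"
    by (rule Suc_times_binomial)
  then have 1: "(real e + 1) * real (k + Suc e choose Suc e) = (real k + real e + 1) * real (k + e choose e)"
    by (metis (no_types, opaque_lifting) add_Suc_right of_nat_Suc of_nat_add of_nat_mult add.assoc add.commute)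
  have "Suc e * (k + e choose Suc e) = k * (k + e choose e)"
    using binomial_absorb_comp[of "k + e" e] binomial_absorption[of e "k + e"] Suc_times_binomial[of e "j + e"] by (simp add: j)
  then have 2: "(real e + 1) * real (k + e choose Suc e) = real k * real (k + e choose e)"
    by (metis of_nat_Suc of_nat_mult add.commute)
  show ?thesis unfolding harmonic_dim_bound_def s using 1 2 by (simp add: algebra_simps)
qed

text \<open>The right-hand side telescopes. Its first-order lower bound suffices for \<open>d \<ge> 3\<close>; the case
  \<open>d = 2\<close> needs the second-order term.\<close>

lemma harmonic_dim_term:
  fixes s :: real
  assumes d: "2 \<le> d" and k: "2 \<le> k" and s: "0 < s"
  defines "u \<equiv> \<lambda>k. 1 + lb_eigenvalue d k"
  shows "real (harmonic_dim_bound d k) * u k powr (- s - real d / 2) \<le> (u (k - 1) powr (- s) - u k powr (- s)) / s"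
proof -
  obtain e where e: "d = e + 2" using d by (metis add.commute le_Suc_ex)
  have uk: "u k = 1 + real k * (real k + real e + 1)" by (simp add: u_def lb_eigenvalue_def e)
  have k1: "real (k - 1) = real k - 1" using k by (simp add: of_nat_diff)
  have ud: "u k - u (k - 1) = 2 * real k + real e"
    unfolding u_def lb_eigenvalue_def e k1 by (simp add: algebra_simps)
  have u1: "1 \<le> u k" "0 < u (k - 1)"
    unfolding u_def using lb_eigenvalue_nonneg[of d] d by (auto simp: add_pos_nonneg)
  let ?C = "real ((k + e) choose e)"
  have C: "?C \<le> u k powr (real e / 2)"
  proof -
    have "?C\<^sup>2 \<le> u k ^ e" using binomial_sq_bound[of k e] by (simp add: uk)
    also have "\<dots> = (u k powr (real e / 2))\<^sup>2"
    proof -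
      have "(u k powr (real e / 2))\<^sup>2 = u k powr real e"
        unfolding power2_eq_square powr_add[symmetric] by simp
      then show ?thesis using powr_realpow[of "u k" e] u1 by simp
    qed
    finally show ?thesis by (rule power2_le_imp_le) simp
  qed
  have pw: "u k powr (real e / 2) * u k powr (- s - real d / 2) = u k powr (- s - 1)"
  proof -
    have "real e / 2 + (- s - real d / 2) = - s - 1" by (simp add: e field_simps)
    then show ?thesis unfolding powr_add[symmetric] by (rule arg_cong)
  qed
  have N: "real (harmonic_dim_bound d k) = (2 * real k + real e + 1) / (real e + 1) * ?C"
    using harmonic_dim_bound_eq[of k e] k by (simp add: e field_simps)
  have "real (harmonic_dim_bound d k) * u k powr (- s - real d / 2) \<le>
      (2 * real k + real e + 1) / (real e + 1) * u k powr (real e / 2) * u k powr (- s - real d / 2)"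
    unfolding N by (intro mult_right_mono mult_left_mono C) auto
  also have "\<dots> = (2 * real k + real e + 1) / (real e + 1) * u k powr (- s - 1)"
    by (simp only: mult.assoc pw)
  also have "\<dots> \<le> (2 * real k + real e) * u k powr (- s - 1) + (s + 1) / 2 * (2 * real k + real e)\<^sup>2 * u k powr (- s - 2)"
  proof (cases "e = 0")
    case True
    \<comment> \<open>For d = 2 this reads 1 + k + k^2 \<le> 2 k^2: true from k = 2 on and false for
      k = 1.\<close>
    have "u k \<le> 2 * (real k)\<^sup>2"
    proof -
      have "real k * 2 \<le> real k * real k" using k by (intro mult_left_mono) auto
      moreover have "2 \<le> real k" using k by simp
      moreover have "u k = 1 + real k * real k + real k" by (simp add: uk True algebra_simps)
      ultimately show ?thesis unfolding power2_eq_square by linarith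
    qed
    moreover have "(real k)\<^sup>2 \<le> (s + 1) * (real k)\<^sup>2"
      using s mult_right_mono[of 1 "s + 1" "(real k)\<^sup>2"] by simp
    moreover have "(s + 1) / 2 * (2 * real k)\<^sup>2 = 2 * ((s + 1) * (real k)\<^sup>2)"
      by (simp add: power2_eq_square)
    ultimately have "u k \<le> (s + 1) / 2 * (2 * real k)\<^sup>2" by linarith
    then have "u k * u k powr (- s - 2) \<le> (s + 1) / 2 * (2 * real k)\<^sup>2 * u k powr (- s - 2)"
      by (intro mult_right_mono) auto
    moreover have "u k * u k powr (- s - 2) = u k powr (- s - 1)"
    proof -
      have "1 + (- s - 2) = - s - 1" by simp
      with powr_add[of "u k" 1 "- s - 2"] have "u k powr (- s - 1) = u k powr 1 * u k powr (- s - 2)" by simp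
      then show ?thesis using u1 by simp
    qed
    ultimately show ?thesis using True by (simp add: distrib_right)
  next
    case False
    then have "1 \<le> real e" by simp
    have "(2 * real k + real e + 1) / (real e + 1) \<le> 2 * real k + real e"
    proof -
      have "2 * real k + real e + 1 \<le> (2 * real k + real e) * 2" using \<open>1 \<le> real e\<close> by simp
      also have "\<dots> \<le> (2 * real k + real e) * (real e + 1)"
        using \<open>1 \<le> real e\<close> by (intro mult_left_mono) auto
      finally show ?thesis by (simp add: divide_le_eq)
    qed
    then have "(2 * real k + real e + 1) / (real e + 1) * u k powr (- s - 1) \<le> (2 * real k + real e) * u k powr (- s - 1)"
      by (intro mult_right_mono) auto
    moreover have "0 \<le> (s + 1) / 2 * (2 * real k + real e)\<^sup>2 * u k powr (- s - 2)" using s by simp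
    ultimately show ?thesis by linarith
  qed
  also have "\<dots> \<le> (u (k - 1) powr (- s) - u k powr (- s)) / s"
    using powr_diff_lower[OF u1(2), of "u k" s] s ud by (simp add: algebra_simps)
  finally show ?thesis .
qed

text \<open>The first degree is m + 1 \<ge> 2, as \<open>harmonic_dim_term\<close> requires; the
  negative end term of the telescoping sum is discarded.\<close>

lemma harmonic_dim_sum:
  fixes s :: real
  assumes d: "2 \<le> d" and m: "1 \<le> m" and s: "0 < s"
  shows "(\<Sum>k\<in>{m<..m + n}. real (harmonic_dim_bound d k) * (1 + lb_eigenvalue d k) powr (- s - real d / 2))
    \<le> (1 + lb_eigenvalue d m) powr (- s) / s"
proof -
  let ?u = "\<lambda>k. 1 + lb_eigenvalue d k"
  have "(\<Sum>k\<in>{m<..m + n}. real (harmonic_dim_bound d k) * ?u k powr (- s - real d / 2))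
    \<le> (?u m powr (- s) - ?u (m + n) powr (- s)) / s"
  proof (induction n)
    case (Suc n)
    have "{m<..m + Suc n} = insert (m + Suc n) {m<..m + n}" by auto
    then show ?case
      using Suc harmonic_dim_term[OF d, of "m + Suc n" s] m s by (simp add: diff_divide_distrib)
  qed simp
  also have "\<dots> \<le> ?u m powr (- s) / s"
    using s by (intro divide_right_mono) auto
  finally show ?thesis .
qed

text \<open>Serves the omitted degrees in the Sobolev norm, which must fit under the same bound as
  the uniform tail. The power estimate applies again because consecutive eigenvalues differ by at
  least 1 and d / 2 \<ge> 1.\<close>

lemma next_eigenvalue_bound:
  fixes s :: real
  assumes d: "2 \<le> d" and s: "0 < s"
  shows "(1 + lb_eigenvalue d (Suc m)) powr (- s - real d / 2) \<le> (1 + lb_eigenvalue d m) powr (- s) / s"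
proof -
  let ?a = "1 + lb_eigenvalue d m" and ?b = "1 + lb_eigenvalue d (Suc m)"
  have a: "0 < ?a" using lb_eigenvalue_nonneg[of d m] d by simp
  have ba: "1 \<le> ?b - ?a" using d by (simp add: lb_eigenvalue_def algebra_simps)
  have b: "1 \<le> ?b" using lb_eigenvalue_nonneg[of d "Suc m"] d by simp
  have "?b powr (- s - real d / 2) \<le> ?b powr (- s - 1)"
    using b d by (intro powr_mono) auto
  also have "\<dots> \<le> (?b - ?a) * ?b powr (- s - 1)"
    using ba mult_right_mono[of 1 "?b - ?a" "?b powr (- s - 1)"] by simp
  also have "\<dots> \<le> (?b - ?a) * ?b powr (- s - 1) + (s + 1) / 2 * (?b - ?a)\<^sup>2 * ?b powr (- s - 2)"
    using s by simp
  also have "\<dots> \<le> (?a powr (- s) - ?b powr (- s)) / s"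
    using a ba s by (intro powr_diff_lower) auto
  also have "\<dots> \<le> ?a powr (- s) / s"
    using s by (intro divide_right_mono) auto
  finally show ?thesis .
qed

subsection \<open>Discrete least squares\<close>

text \<open>Dividing by t leaves 2 r \<le> t v, impossible for positive r once t is small; one
  explicit t with t v \<le> r is enough.\<close>

lemma nonpos_if_quadratic:
  fixes r v :: real
  assumes "\<And>t. 0 < t \<Longrightarrow> t \<le> 1 \<Longrightarrow> 2 * t * r \<le> t\<^sup>2 * v"
  shows "r \<le> 0"
proof (rule ccontr)
  assume "\<not> r \<le> 0"
  then have r: "0 < r" by simp
  define t where "t = min 1 (r / (\<bar>v\<bar> + 1))"
  have t: "0 < t" "t \<le> 1" using r by (auto simp: t_def)
  have "t * (\<bar>v\<bar> + 1) \<le> r"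
    using r by (simp add: t_def min_def pos_le_divide_eq split: if_splits)
  then have "t * v \<le> r"
    using t mult_left_mono[of v "\<bar>v\<bar> + 1" t] by linarith
  moreover have "2 * r \<le> t * v"
    using assms[OF t] t by (simp add: power2_eq_square)
  ultimately show False using r by simp
qed

text \<open>Minimality along the segment gives the obtuse angle condition: the real inner product of
  a and v is at most 0. Expanding the square on the right and discarding the contribution of a gives
  the claim.\<close>

lemma least_squares_projection:
  fixes a v :: "'i \<Rightarrow> complex"
  assumes fin: "finite A"
    and min: "\<And>t::real. 0 < t \<Longrightarrow> t \<le> 1 \<Longrightarrow> (\<Sum>j\<in>A. (cmod (a j))\<^sup>2) \<le> (\<Sum>j\<in>A. (cmod (a j - of_real t * v j))\<^sup>2)"
  shows "(\<Sum>j\<in>A. (cmod (v j))\<^sup>2) \<le> (\<Sum>j\<in>A. (cmod (a j - v j))\<^sup>2)"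
proof -
  let ?r = "\<Sum>j\<in>A. a j \<bullet> v j" and ?v = "\<Sum>j\<in>A. (cmod (v j))\<^sup>2" and ?a = "\<Sum>j\<in>A. (cmod (a j))\<^sup>2"
  have e: "(\<Sum>j\<in>A. (cmod (a j - of_real t * v j))\<^sup>2) = ?a - 2 * t * ?r + t\<^sup>2 * ?v" for t
  proof -
    have "(cmod (a j - of_real t * v j))\<^sup>2 = (cmod (a j))\<^sup>2 - 2 * t * (a j \<bullet> v j) + t\<^sup>2 * (cmod (v j))\<^sup>2" for j
      unfolding scaleR_conv_of_real[symmetric]
      by (simp only: power2_norm_eq_inner)
        (simp add: inner_diff_left inner_diff_right inner_commute power2_eq_square algebra_simps)
    then show ?thesis by (simp add: sum.distrib sum_subtractf sum_distrib_left)
  qed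
  have "?r \<le> 0"
    by (rule nonpos_if_quadratic[of _ ?v]) (use min e in force)
  moreover have "0 \<le> ?a" by (simp add: sum_nonneg)
  ultimately show ?thesis using e[of 1] by simp
qed

lemma sum_cmod_sq_le:
  fixes a :: "'i \<Rightarrow> complex"
  assumes "\<And>j. j \<in> A \<Longrightarrow> cmod (a j) \<le> B"
  shows "(\<Sum>j\<in>A. (cmod (a j))\<^sup>2) \<le> real (card A) * B\<^sup>2"
proof -
  have "(cmod (a j))\<^sup>2 \<le> B\<^sup>2" if "j \<in> A" for j
    using assms[OF that] by (intro power_mono) auto
  then show ?thesis by (rule sum_bounded_above)
qed

text \<open>With noise B and tail E, squaring leaves only the cross terms to compare, and \<kappa>
  \<le> sqrt (1 + \<kappa>) sqrt \<kappa> settles these.\<close>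

lemma sqrt_le_weighted_sum:
  fixes \<kappa> B E X :: real
  assumes "0 \<le> \<kappa>" "0 \<le> B" "0 \<le> E"
    and X: "X \<le> \<kappa> * (B + E)\<^sup>2 + E\<^sup>2"
  shows "sqrt X \<le> sqrt (1 + \<kappa>) * E + sqrt \<kappa> * B"
proof (rule real_le_lsqrt)
  show "0 \<le> sqrt (1 + \<kappa>) * E + sqrt \<kappa> * B" using assms by simp
  have "\<kappa> \<le> sqrt (1 + \<kappa>) * sqrt \<kappa>"
    unfolding real_sqrt_mult[symmetric] using assms by (intro real_le_rsqrt) (simp add: power2_eq_square algebra_simps)
  then have "2 * \<kappa> * (B * E) \<le> 2 * (sqrt (1 + \<kappa>) * sqrt \<kappa>) * (B * E)"
    using assms by (intro mult_right_mono) auto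
  moreover have "(sqrt (1 + \<kappa>) * E + sqrt \<kappa> * B)\<^sup>2 = (1 + \<kappa>) * E\<^sup>2 + \<kappa> * B\<^sup>2 + 2 * (sqrt (1 + \<kappa>) * sqrt \<kappa>) * (B * E)"
    using assms by (simp add: power2_sum power_mult_distrib)
  moreover have "\<kappa> * (B + E)\<^sup>2 + E\<^sup>2 = (1 + \<kappa>) * E\<^sup>2 + \<kappa> * B\<^sup>2 + 2 * \<kappa> * (B * E)"
    by (simp add: power2_eq_square algebra_simps)
  ultimately show "X \<le> (sqrt (1 + \<kappa>) * E + sqrt \<kappa> * B)\<^sup>2"
    using X by linarith
qed

lemma const_in_harmonics: "sphere_restrict (\<lambda>x. 1) \<in> harmonics 0"
  by (rule sphere_restrict_in_harmonics)
    (use laplacian_hpoly_low[OF hpoly_const] in \<open>simp add: hharm_def hpoly_const\<close>)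

lemma L2_norm_const: "L2_norm (sphere_restrict (\<lambda>x. 1) :: 'a::euclidean_space \<Rightarrow> complex) = 1"
proof -
  have "L2_norm (sphere_restrict (\<lambda>x. 1) :: 'a \<Rightarrow> complex) = L2_norm (\<lambda>x::'a. 1)"
    by (rule L2_norm_cong) (rule sphere_restrict_eq)
  also have "\<dots> = 1" using sphere.prob_space[where 'a = 'a] by (simp add: L2_norm_def)
  finally show ?thesis .
qed

lemma dim_harmonics_le:
  "cfun.dim (harmonics k :: (real ^ ('d::finite option) \<Rightarrow> complex) set) \<le> harmonic_dim_bound CARD('d) k"
  unfolding dim_harmonics harmonic_dim_bound_def using hbasis_props by blast

lemma lb_eigenvalue_mono: "0 < d \<Longrightarrow> k \<le> l \<Longrightarrow> lb_eigenvalue d k \<le> lb_eigenvalue d l"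
  using lb_eigenvalue_strict_mono[of d k l] by (cases "k = l") auto

section \<open>Sobolev estimates for the convolution and for the least squares solution\<close>

context
  fixes G :: "(real ^ ('d::finite option) ^ ('d option)) measure"
    and h :: "real ^ ('d option) \<Rightarrow> complex" and eig :: "nat \<Rightarrow> real"
  assumes haar: "haar_prob_SO G" and D: "2 \<le> CARD('d)" and h: "h \<in> sphere_L2"
    and eig: "eig = (\<lambda>k. 1 + lb_eigenvalue CARD('d) k)"
begin

lemma eig_ge_1: "1 \<le> eig k"
  using lb_eigenvalue_nonneg[of "CARD('d)" k] D by (simp add: eig)

lemma eig_mono: "k \<le> l \<Longrightarrow> eig k \<le> eig l"
  using lb_eigenvalue_mono[of "CARD('d)" k l] D by (simp add: eig)

lemma L2_norm_harmonic_proj_conv: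
  "f \<in> sphere_L2 \<Longrightarrow> (L2_norm (harmonic_proj k (sphere_conv G h f)))\<^sup>2 =
    (cmod (conv_coeff h k))\<^sup>2 * (L2_norm (harmonic_proj k f))\<^sup>2"
  by (simp add: harmonic_proj_conv[OF haar D h] L2_norm_sq_cmult)

lemma conv_sobolev:
  assumes f: "f \<in> sobolev \<omega>" and c: "c \<ge> 0"
    and b: "\<And>k. cmod (conv_coeff h k) \<le> c * eig k powr (- \<gamma> / 2)"
  shows "sphere_conv G h f \<in> sobolev (\<omega> + \<gamma>)"
proof -
  have f2: "f \<in> sphere_L2" and sf: "summable (\<lambda>k. eig k powr \<omega> * (L2_norm (harmonic_proj k f))\<^sup>2)"
    using f by (auto simp: sobolev_def eig)
  have "summable (\<lambda>k. eig k powr (\<omega> + \<gamma>) * (L2_norm (harmonic_proj k (sphere_conv G h f)))\<^sup>2)"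
  proof (rule summable_comparison_test)
    show "summable (\<lambda>k. c\<^sup>2 * (eig k powr \<omega> * (L2_norm (harmonic_proj k f))\<^sup>2))"
      by (rule summable_mult[OF sf])
    have "norm (eig k powr (\<omega> + \<gamma>) * (L2_norm (harmonic_proj k (sphere_conv G h f)))\<^sup>2) \<le>
        c\<^sup>2 * (eig k powr \<omega> * (L2_norm (harmonic_proj k f))\<^sup>2)" for k
    proof -
      have "(cmod (conv_coeff h k))\<^sup>2 \<le> (c * eig k powr (- \<gamma> / 2))\<^sup>2" by (intro power_mono b) auto
      also have "\<dots> = c\<^sup>2 * eig k powr (- \<gamma>)"
        by (simp add: power_mult_distrib power2_eq_square powr_add[symmetric])
      finally have "eig k powr (\<omega> + \<gamma>) * ((cmod (conv_coeff h k))\<^sup>2 * (L2_norm (harmonic_proj k f))\<^sup>2) \<le>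
          eig k powr (\<omega> + \<gamma>) * (c\<^sup>2 * eig k powr (- \<gamma>) * (L2_norm (harmonic_proj k f))\<^sup>2)"
        by (intro mult_left_mono mult_right_mono) auto
      also have "\<dots> = c\<^sup>2 * ((eig k powr (\<omega> + \<gamma>) * eig k powr (- \<gamma>)) * (L2_norm (harmonic_proj k f))\<^sup>2)"
        by (simp add: mult_ac)
      also have "eig k powr (\<omega> + \<gamma>) * eig k powr (- \<gamma>) = eig k powr \<omega>"
        by (simp add: powr_add[symmetric])
      finally show ?thesis by (simp add: L2_norm_harmonic_proj_conv[OF f2])
    qed
    then show "\<exists>N. \<forall>k\<ge>N. norm (eig k powr (\<omega> + \<gamma>) * (L2_norm (harmonic_proj k (sphere_conv G h f)))\<^sup>2) \<le>
        c\<^sup>2 * (eig k powr \<omega> * (L2_norm (harmonic_proj k f))\<^sup>2)" by blast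
  qed
  then show ?thesis using conv_L2[OF haar D h f2] by (simp add: sobolev_def eig)
qed

lemma sobolev_norm_sq:
  "(sobolev_norm s g)\<^sup>2 = (\<Sum>k. eig k powr s * (L2_norm (harmonic_proj k g))\<^sup>2)"
  if "g \<in> sobolev s" for g :: "real ^ ('d option) \<Rightarrow> complex"
  using that unfolding sobolev_norm_def sobolev_def eig
  by (auto intro!: real_sqrt_pow2 suminf_nonneg)

lemma sobolev_norm_nonneg:
  "0 \<le> sobolev_norm s g" if "g \<in> sobolev s" for g :: "real ^ ('d option) \<Rightarrow> complex"
  unfolding sobolev_norm_def
  by (rule real_sqrt_ge_zero, rule suminf_nonneg) (use that in \<open>auto simp: sobolev_def\<close>)

text \<open>Cauchy-Schwarz over the degrees, with weights that turn one factor into the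
  \<sigma>-norm. The other factor is the telescoping sum of dimensions. Blocks of finitely many
  degrees are bounded first, uniformly in their length.\<close>

lemma conv_tail_pointwise:
  assumes f: "f \<in> sphere_L2" and g: "sphere_conv G h f \<in> sobolev \<sigma>" and s: "0 < s" "s + real CARD('d) / 2 + \<zeta> = \<sigma>"
    and \<zeta>: "0 \<le> \<zeta>" and m: "1 \<le> m" and x: "x \<in> sphere 0 1"
  shows "cmod (sphere_conv G h f x - conv_partial h f m x) \<le>
    sqrt (eig m powr (- s) / s) * sobolev_norm \<sigma> (sphere_conv G h f) * eig m powr (- \<zeta> / 2)"
proof -
  let ?g = "sphere_conv G h f"
  let ?n = "\<lambda>k. L2_norm (harmonic_proj k ?g)"
  let ?\<delta> = "\<lambda>k. real (cfun.dim (harmonics k :: (real ^ ('d option) \<Rightarrow> complex) set))"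
  let ?S = "sobolev_norm \<sigma> ?g" and ?T = "eig m powr (- s) / s * eig m powr (- \<zeta>)"
  have g2: "?g \<in> sphere_L2" by (rule conv_L2[OF haar D h f])
  have summ: "summable (\<lambda>k. eig k powr \<sigma> * (?n k)\<^sup>2)" using g by (simp add: sobolev_def eig)
  have part: "cmod (conv_partial h f (m + n) x - conv_partial h f m x) \<le> sqrt ?T * ?S" for n
  proof -
    have "{..m + n} = {..m} \<union> {m<..m + n}" by auto
    then have "conv_partial h f (m + n) x = conv_partial h f m x + (\<Sum>k\<in>{m<..m + n}. conv_coeff h k * harmonic_proj k f x)"
      by (simp add: conv_partial_def[OF haar D h f] sum.union_disjoint ivl_disj_int)
    then have "cmod (conv_partial h f (m + n) x - conv_partial h f m x) = cmod (\<Sum>k\<in>{m<..m + n}. harmonic_proj k ?g x)"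
      by (simp add: harmonic_proj_conv[OF haar D h f])
    also have "\<dots> \<le> (\<Sum>k\<in>{m<..m + n}. cmod (harmonic_proj k ?g x))" by (rule norm_sum)
    \<comment> \<open>The pointwise bound by the square root of the dimension, with reciprocal
      weights inserted.\<close>
    also have "\<dots> \<le> (\<Sum>k\<in>{m<..m + n}. (sqrt (?\<delta> k) * eig k powr (- \<sigma> / 2)) * (eig k powr (\<sigma> / 2) * ?n k))"
    proof (rule sum_mono)
      fix k
      have one: "eig k powr (- \<sigma> / 2) * eig k powr (\<sigma> / 2) = 1"
        using eig_ge_1[of k] by (simp add: powr_add[symmetric])
      have "(sqrt (?\<delta> k) * eig k powr (- \<sigma> / 2)) * (eig k powr (\<sigma> / 2) * ?n k) =
          (eig k powr (- \<sigma> / 2) * eig k powr (\<sigma> / 2)) * (sqrt (?\<delta> k) * ?n k)"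
        by (simp only: mult_ac)
      then have eqn: "(sqrt (?\<delta> k) * eig k powr (- \<sigma> / 2)) * (eig k powr (\<sigma> / 2) * ?n k) = sqrt (?\<delta> k) * ?n k"
        unfolding one by simp
      show "cmod (harmonic_proj k ?g x) \<le> (sqrt (?\<delta> k) * eig k powr (- \<sigma> / 2)) * (eig k powr (\<sigma> / 2) * ?n k)"
        unfolding eqn by (rule harmonics_pointwise_bound[OF harmonic_proj_harmonics[OF g2] x])
    qed
    also have "\<dots> \<le> sqrt ((\<Sum>k\<in>{m<..m + n}. (sqrt (?\<delta> k) * eig k powr (- \<sigma> / 2))\<^sup>2) * (\<Sum>k\<in>{m<..m + n}. (eig k powr (\<sigma> / 2) * ?n k)\<^sup>2))"
      by (rule real_le_rsqrt[OF Cauchy_Schwarz_ineq_sum])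
    also have "\<dots> \<le> sqrt (?T * ?S\<^sup>2)"
    proof (intro real_sqrt_le_mono mult_mono)
      have "(sqrt (?\<delta> k) * eig k powr (- \<sigma> / 2))\<^sup>2 \<le> eig m powr (- \<zeta>) * (real (harmonic_dim_bound CARD('d) k) * eig k powr (- s - real CARD('d) / 2))"
        if "k \<in> {m<..m + n}" for k
      proof -
        have "(sqrt (?\<delta> k) * eig k powr (- \<sigma> / 2))\<^sup>2 = ?\<delta> k * eig k powr (- \<sigma>)"
          by (simp add: power_mult_distrib power2_eq_square[of "eig k powr _"] powr_add[symmetric])
        \<comment> \<open>The exponent splits as - \<sigma> = - \<zeta> + (- s - d / 2): the first
          power is largest at m, the second belongs to the telescoping sum.\<close>
        also have "eig k powr (- \<sigma>) = eig k powr (- \<zeta>) * eig k powr (- s - real CARD('d) / 2)"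
          by (simp add: powr_add[symmetric] s(2)[symmetric] algebra_simps)
        also have "?\<delta> k * \<dots> \<le> real (harmonic_dim_bound CARD('d) k) * (eig m powr (- \<zeta>) * eig k powr (- s - real CARD('d) / 2))"
        proof (intro mult_mono)
          show "?\<delta> k \<le> real (harmonic_dim_bound CARD('d) k)" using dim_harmonics_le by simp
          show "eig k powr (- \<zeta>) \<le> eig m powr (- \<zeta>)"
            using eig_mono[of m k] eig_ge_1[of m] that \<zeta> by (intro powr_mono2') auto
        qed auto
        finally show ?thesis by (simp add: mult_ac)
      qed
      then have "(\<Sum>k\<in>{m<..m + n}. (sqrt (?\<delta> k) * eig k powr (- \<sigma> / 2))\<^sup>2) \<le>
          (\<Sum>k\<in>{m<..m + n}. eig m powr (- \<zeta>) * (real (harmonic_dim_bound CARD('d) k) * eig k powr (- s - real CARD('d) / 2)))"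
        by (rule sum_mono)
      also have "\<dots> \<le> eig m powr (- \<zeta>) * (eig m powr (- s) / s)"
        unfolding sum_distrib_left[symmetric] eig
        by (intro mult_left_mono harmonic_dim_sum D m s) simp
      finally show "(\<Sum>k\<in>{m<..m + n}. (sqrt (?\<delta> k) * eig k powr (- \<sigma> / 2))\<^sup>2) \<le> ?T"
        by (simp add: mult.commute)
      have "(\<Sum>k\<in>{m<..m + n}. (eig k powr (\<sigma> / 2) * ?n k)\<^sup>2) = (\<Sum>k\<in>{m<..m + n}. eig k powr \<sigma> * (?n k)\<^sup>2)"
        by (simp add: power_mult_distrib power2_eq_square[of "eig _ powr _"] powr_add[symmetric])
      also have "\<dots> \<le> ?S\<^sup>2"
        unfolding sobolev_norm_sq[OF g] by (rule sum_le_suminf[OF summ]) auto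
      finally show "(\<Sum>k\<in>{m<..m + n}. (eig k powr (\<sigma> / 2) * ?n k)\<^sup>2) \<le> ?S\<^sup>2" .
    qed (use s in \<open>auto intro: sum_nonneg\<close>)
    also have "\<dots> = sqrt ?T * ?S"
      using sobolev_norm_nonneg[OF g] by (subst real_sqrt_mult) simp
    finally show ?thesis .
  qed
  \<comment> \<open>The bound for blocks does not depend on n, so it survives the limit of the
    pointwise expansion.\<close>
  have "(\<lambda>N. conv_partial h f N x) \<longlonglongrightarrow> ?g x"
    using conv_sums[OF haar D h f x] by (simp add: sums_def_le conv_partial_def[OF haar D h f])
  then have "(\<lambda>n. conv_partial h f (n + m) x) \<longlonglongrightarrow> ?g x" by (rule LIMSEQ_ignore_initial_segment)
  then have "(\<lambda>n. cmod (conv_partial h f (n + m) x - conv_partial h f m x)) \<longlonglongrightarrow> cmod (?g x - conv_partial h f m x)"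
    by (intro tendsto_norm tendsto_diff tendsto_const)
  then have "cmod (?g x - conv_partial h f m x) \<le> sqrt ?T * ?S"
    by (rule LIMSEQ_le_const2) (use part in \<open>auto simp: add.commute\<close>)
  also have "sqrt ?T = sqrt (eig m powr (- s) / s) * eig m powr (- \<zeta> / 2)"
  proof -
    have "sqrt (eig m powr (- \<zeta>)) = eig m powr (- \<zeta> / 2)"
      by (rule real_sqrt_unique) (simp_all add: power2_eq_square powr_add[symmetric])
    then show ?thesis by (simp only: real_sqrt_mult)
  qed
  finally show ?thesis by (simp add: mult_ac)
qed

text \<open>Only finitely many projections are nonzero, so the expansion of the convolution is a
  finite sum, valid at every point of the sphere and not merely in norm.\<close>

lemma conv_upto:
  assumes r: "\<And>k. k \<le> m \<Longrightarrow> r k \<in> harmonics k" and x: "x \<in> sphere 0 1"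
  shows "sphere_conv G h (\<lambda>x. \<Sum>k\<le>m. r k x) x = (\<Sum>k\<le>m. conv_coeff h k * r k x)"
proof -
  have q: "(\<lambda>x. \<Sum>k\<le>m. r k x) \<in> sphere_L2"
    by (rule sphere_L2_sum, rule harmonics_L2, rule r) simp
  have "(\<lambda>k. conv_coeff h k * harmonic_proj k (\<lambda>x. \<Sum>k\<le>m. r k x) x) sums sphere_conv G h (\<lambda>x. \<Sum>k\<le>m. r k x) x"
    by (rule conv_sums[OF haar D h q x])
  moreover have "harmonic_proj k (\<lambda>x. \<Sum>k\<le>m. r k x) = (if k \<le> m then r k else (\<lambda>x. 0))" for k
    by (rule harmonic_proj_upto[OF r])
  ultimately have "(\<lambda>k. conv_coeff h k * (if k \<le> m then r k x else 0)) sums sphere_conv G h (\<lambda>x. \<Sum>k\<le>m. r k x) x"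
    by (simp add: if_distrib if_distribR cong: if_cong)
  moreover have "(\<lambda>k. conv_coeff h k * (if k \<le> m then r k x else 0)) sums (\<Sum>k\<le>m. conv_coeff h k * (if k \<le> m then r k x else 0))"
    by (rule sums_finite) auto
  ultimately have "sphere_conv G h (\<lambda>x. \<Sum>k\<le>m. r k x) x = (\<Sum>k\<le>m. conv_coeff h k * (if k \<le> m then r k x else 0))"
    by (rule sums_unique2)
  then show ?thesis by simp
qed

lemma least_squares_sobolev_estimate:
  fixes x :: "nat \<Rightarrow> real ^ ('d option)" and y :: "nat \<Rightarrow> complex"
  assumes f: "f \<in> sphere_L2" and g: "sphere_conv G h f \<in> sobolev \<sigma>"
    and s: "0 < s" "s + real CARD('d) / 2 + \<zeta> = \<sigma>" and \<zeta>: "0 \<le> \<zeta>" and m: "1 \<le> m" and L: "0 < L"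
    and x: "\<And>j. j \<in> {1..L} \<Longrightarrow> x j \<in> sphere 0 1" and \<epsilon>: "0 < \<epsilon>" "\<epsilon> < 1"
    and MZ: "\<And>q. q \<in> harmonics_upto m \<Longrightarrow> (1 - \<epsilon>) * (L2_norm q)\<^sup>2 \<le> 1 / real L * (\<Sum>j=1..L. (cmod (q (x j)))\<^sup>2)"
    and \<beta>: "0 \<le> \<beta>" and y: "\<And>j. j \<in> {1..L} \<Longrightarrow> cmod (y j - sphere_conv G h f (x j)) \<le> \<beta>"
    and p: "p \<in> harmonics_upto m"
    and min: "\<And>q. q \<in> harmonics_upto m \<Longrightarrow> (\<Sum>j=1..L. (cmod (y j - sphere_conv G h p (x j)))\<^sup>2) \<le>
      (\<Sum>j=1..L. (cmod (y j - sphere_conv G h q (x j)))\<^sup>2)"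
    and \<kappa>: "\<kappa> = (1 + \<epsilon>) / (1 - \<epsilon>)"
  shows "(\<lambda>z. sphere_conv G h f z - sphere_conv G h p z) \<in> sobolev \<zeta>"
    "sobolev_norm \<zeta> (\<lambda>z. sphere_conv G h f z - sphere_conv G h p z) \<le>
      sqrt (1 + \<kappa>) * (sqrt (eig m powr (- s) / s) * sobolev_norm \<sigma> (sphere_conv G h f)) + sqrt \<kappa> * (eig m powr (\<zeta> / 2) * \<beta>)"
proof -
  let ?b = "conv_coeff h" and ?g = "sphere_conv G h f" and ?gp = "sphere_conv G h p"
  let ?S = "sobolev_norm \<sigma> ?g"
  obtain r where r: "p = (\<lambda>x. \<Sum>l\<le>m. r l x)" "\<And>l. l \<le> m \<Longrightarrow> r l \<in> harmonics l"
    using p by (auto simp: harmonics_upto_def)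
  have p2: "p \<in> sphere_L2" by (rule harmonics_upto_L2[OF p])
  \<comment> \<open>The displacement from p to the truncation of f. Its image under F is Q, and p
    plus any multiple of it is an admissible competitor even where multipliers vanish.\<close>
  define w where "w k = (\<lambda>x. harmonic_proj k f x - r k x)" for k
  have w: "w k \<in> harmonics k" if "k \<le> m" for k
    unfolding w_def by (intro harmonics_diff harmonic_proj_harmonics f r that)
  define Q where "Q = (\<lambda>x. \<Sum>k\<le>m. ?b k * w k x)"
  have Q: "Q \<in> harmonics_upto m"
    unfolding harmonics_upto_def Q_def
    by (intro CollectI exI[of _ "\<lambda>k x. ?b k * w k x"]) (simp add: harmonics_cmult w)
  have gp: "?gp z = (\<Sum>k\<le>m. ?b k * r k z)" if "z \<in> sphere 0 1" for z
    unfolding r(1) by (rule conv_upto[OF r(2) that])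
  have gt: "sphere_conv G h (\<lambda>z. \<Sum>k\<le>m. r k z + of_real t * w k z) z = ?gp z + of_real t * Q z"
    if z: "z \<in> sphere 0 1" for z t
  proof -
    have "sphere_conv G h (\<lambda>z. \<Sum>k\<le>m. r k z + of_real t * w k z) z = (\<Sum>k\<le>m. ?b k * (r k z + of_real t * w k z))"
      by (rule conv_upto[OF harmonics_add[OF r(2) harmonics_cmult[OF w]] z])
    then show ?thesis
      by (simp add: gp[OF z] Q_def distrib_left sum.distrib sum_distrib_left mult_ac)
  qed
  have Qz: "?gp z + Q z = conv_partial h f m z" if "z \<in> sphere 0 1" for z
    by (simp add: gp[OF that] Q_def w_def conv_partial_def[OF haar D h f] right_diff_distrib sum_subtractf)
  \<comment> \<open>The uniform tail bound from \<open>conv_tail_pointwise\<close>. Its factor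
    \<open>eig m powr (- \<zeta> / 2)\<close> will cancel against the weight of the low degrees in
    the \<zeta>-norm.\<close>
  define \<rho> where "\<rho> = sqrt (eig m powr (- s) / s) * ?S * eig m powr (- \<zeta> / 2)"
  have "(\<Sum>j=1..L. (cmod (Q (x j)))\<^sup>2) \<le> (\<Sum>j=1..L. (cmod ((y j - ?gp (x j)) - Q (x j)))\<^sup>2)"
  proof (rule least_squares_projection)
    fix t :: real
    have "(\<lambda>z. \<Sum>k\<le>m. r k z + of_real t * w k z) \<in> harmonics_upto m"
      unfolding harmonics_upto_def
      by (intro CollectI exI[of _ "\<lambda>k z. r k z + of_real t * w k z"]) (simp add: harmonics_add harmonics_cmult r(2) w)
    from min[OF this] have "(\<Sum>j=1..L. (cmod (y j - ?gp (x j)))\<^sup>2) \<le>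
        (\<Sum>j=1..L. (cmod (y j - sphere_conv G h (\<lambda>z. \<Sum>k\<le>m. r k z + of_real t * w k z) (x j)))\<^sup>2)" .
    also have "\<dots> = (\<Sum>j=1..L. (cmod ((y j - ?gp (x j)) - of_real t * Q (x j)))\<^sup>2)"
      by (rule sum.cong[OF refl]) (simp only: gt[OF x] diff_diff_eq)
    finally show "(\<Sum>j=1..L. (cmod (y j - ?gp (x j)))\<^sup>2) \<le> (\<Sum>j=1..L. (cmod ((y j - ?gp (x j)) - of_real t * Q (x j)))\<^sup>2)" .
  qed simp
  also have "\<dots> \<le> real (card {1..L}) * (\<beta> + \<rho>)\<^sup>2"
  proof (rule sum_cmod_sq_le)
    fix j assume j: "j \<in> {1..L}"
    \<comment> \<open>Q completes F p to the truncation of F f, so the residual splits into data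
      error and tail.\<close>
    have "(y j - ?gp (x j)) - Q (x j) = (y j - ?g (x j)) + (?g (x j) - conv_partial h f m (x j))"
      using Qz[OF x[OF j]] by (simp add: algebra_simps)
    then have "cmod ((y j - ?gp (x j)) - Q (x j)) \<le> cmod (y j - ?g (x j)) + cmod (?g (x j) - conv_partial h f m (x j))"
      by (simp only: norm_triangle_ineq)
    also have "\<dots> \<le> \<beta> + \<rho>"
      unfolding \<rho>_def by (intro add_mono y[OF j] conv_tail_pointwise[OF f g s \<zeta> m x[OF j]])
    finally show "cmod ((y j - ?gp (x j)) - Q (x j)) \<le> \<beta> + \<rho>" .
  qed
  finally have "1 / real L * (\<Sum>j=1..L. (cmod (Q (x j)))\<^sup>2) \<le> (\<beta> + \<rho>)\<^sup>2"
    using L by (simp add: divide_le_eq mult.commute)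
  with MZ[OF Q] have "(1 - \<epsilon>) * (L2_norm Q)\<^sup>2 \<le> (\<beta> + \<rho>)\<^sup>2" by linarith
  then have "(L2_norm Q)\<^sup>2 \<le> 1 / (1 - \<epsilon>) * (\<beta> + \<rho>)\<^sup>2"
    using \<epsilon> by (simp add: pos_le_divide_eq mult.commute)
  \<comment> \<open>Here 1 / (1 - \<epsilon>) \<le> \<kappa>, since the numerator of \<kappa> is 1 +
    \<epsilon>.\<close>
  also have "\<dots> \<le> \<kappa> * (\<beta> + \<rho>)\<^sup>2"
    unfolding \<kappa> using \<epsilon> by (intro mult_right_mono divide_right_mono) auto
  finally have QN: "(L2_norm Q)\<^sup>2 \<le> \<kappa> * (\<beta> + \<rho>)\<^sup>2" .
  have \<kappa>0: "0 \<le> \<kappa>" unfolding \<kappa> using \<epsilon> by simp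

  let ?D = "\<lambda>z. ?g z - ?gp z"
  have g2: "?g \<in> sphere_L2" and gp2: "?gp \<in> sphere_L2"
    by (rule conv_L2[OF haar D h f], rule conv_L2[OF haar D h p2])
  have D2: "?D \<in> sphere_L2" by (rule sphere_L2_diff[OF g2 gp2])
  have PD: "harmonic_proj k ?D = (\<lambda>z. ?b k * harmonic_proj k f z - ?b k * harmonic_proj k p z)" for k
    unfolding harmonic_proj_diff[OF g2 gp2] harmonic_proj_conv[OF haar D h f] harmonic_proj_conv[OF haar D h p2] ..
  have Pp: "harmonic_proj k p = (if k \<le> m then r k else (\<lambda>x. 0))" for k
    unfolding r(1) by (rule harmonic_proj_upto[OF r(2)])
  have low: "harmonic_proj k ?D = (\<lambda>z. ?b k * w k z)" if "k \<le> m" for k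
    using that by (simp add: PD Pp w_def right_diff_distrib)
  have high: "harmonic_proj k ?D = harmonic_proj k ?g" if "m < k" for k
    using that by (simp add: PD Pp harmonic_proj_conv[OF haar D h f])
  define t where "t k = eig k powr \<zeta> * (L2_norm (harmonic_proj k ?D))\<^sup>2" for k
  define a where "a k = eig k powr \<sigma> * (L2_norm (harmonic_proj k ?g))\<^sup>2" for k
  \<comment> \<open>The ratio of \<zeta>-weight to \<sigma>-weight at the first omitted degree; the
    ratio decreases in k.\<close>
  define C where "C = eig (Suc m) powr (- s - real CARD('d) / 2)"
  have sa: "summable a" using g unfolding a_def by (simp add: sobolev_def eig)
  have a0: "0 \<le> a k" and t0: "0 \<le> t k" for k by (simp_all add: a_def t_def)
  have ta: "t k \<le> C * a k" if k: "Suc m \<le> k" for k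
  proof -
    have "eig k powr \<zeta> = eig k powr (- s - real CARD('d) / 2) * eig k powr \<sigma>"
      by (simp add: powr_add[symmetric] s(2)[symmetric])
    then have "t k = eig k powr (- s - real CARD('d) / 2) * a k"
      using k by (simp add: t_def a_def high mult.assoc)
    also have "\<dots> \<le> C * a k"
      unfolding C_def using eig_mono[OF k] eig_ge_1[of "Suc m"] s
      by (intro mult_right_mono a0 powr_mono2') auto
    finally show ?thesis .
  qed
  have st: "summable t"
  proof (rule summable_comparison_test')
    show "summable (\<lambda>k. C * a k)" by (rule summable_mult[OF sa])
    show "norm (t k) \<le> C * a k" if "Suc m \<le> k" for k using ta[OF that] t0[of k] by simp
  qed
  then show DS: "?D \<in> sobolev \<zeta>" unfolding t_def using D2 by (simp add: sobolev_def eig)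
  have S2: "?S\<^sup>2 = suminf a" unfolding a_def by (rule sobolev_norm_sq[OF g])
  have S0: "0 \<le> ?S" by (rule sobolev_norm_nonneg[OF g])
  \<comment> \<open>Up to degree m the weight is largest at m, and by orthogonality the remaining
    squared norms add up to that of Q.\<close>
  have "(\<Sum>k\<le>m. t k) \<le> (\<Sum>k\<le>m. eig m powr \<zeta> * (L2_norm (\<lambda>z. ?b k * w k z))\<^sup>2)"
  proof (rule sum_mono)
    fix k assume "k \<in> {..m}"
    then have "k \<le> m" by simp
    then show "t k \<le> eig m powr \<zeta> * (L2_norm (\<lambda>z. ?b k * w k z))\<^sup>2"
      unfolding t_def low[OF \<open>k \<le> m\<close>] using eig_mono[of k m] eig_ge_1[of k] \<zeta>
      by (intro mult_right_mono powr_mono2) auto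
  qed
  also have "\<dots> = eig m powr \<zeta> * (L2_norm Q)\<^sup>2"
    unfolding Q_def by (subst L2_norm_sq_upto) (auto simp: sum_distrib_left intro: harmonics_cmult w)
  also have "\<dots> \<le> eig m powr \<zeta> * (\<kappa> * (\<beta> + \<rho>)\<^sup>2)"
    by (intro mult_left_mono QN) simp
  finally have lowsum: "(\<Sum>k\<le>m. t k) \<le> eig m powr \<zeta> * (\<kappa> * (\<beta> + \<rho>)\<^sup>2)" .
  have "(\<Sum>k. t (k + Suc m)) \<le> (\<Sum>k. C * a (k + Suc m))"
    by (intro suminf_le ta summable_mult summable_ignore_initial_segment st sa) simp
  also have "\<dots> = C * (\<Sum>k. a (k + Suc m))"
    by (rule suminf_mult[OF summable_ignore_initial_segment[OF sa]])
  also have "\<dots> \<le> C * suminf a"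
  proof (rule mult_left_mono)
    have "suminf a = (\<Sum>k. a (k + Suc m)) + sum a {..<Suc m}"
      by (rule suminf_split_initial_segment[OF sa])
    moreover have "0 \<le> sum a {..<Suc m}" by (rule sum_nonneg) (rule a0)
    ultimately show "(\<Sum>k. a (k + Suc m)) \<le> suminf a" by linarith
  qed (simp add: C_def)
  also have "\<dots> \<le> (eig m powr (- s) / s) * suminf a"
  proof (rule mult_right_mono)
    show "C \<le> eig m powr (- s) / s" unfolding C_def eig by (rule next_eigenvalue_bound[OF D s(1)])
    show "0 \<le> suminf a" by (rule suminf_nonneg[OF sa a0])
  qed
  finally have highsum: "(\<Sum>k. t (k + Suc m)) \<le> (eig m powr (- s) / s) * ?S\<^sup>2" unfolding S2 .
  \<comment> \<open>Noise and tail on the scale of the \<zeta>-norm. The same E bounds the tail that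
    enters through the samples and the omitted degrees themselves.\<close>
  define B where "B = eig m powr (\<zeta> / 2) * \<beta>"
  define E where "E = sqrt (eig m powr (- s) / s) * ?S"
  have E2: "E\<^sup>2 = (eig m powr (- s) / s) * ?S\<^sup>2"
    unfolding E_def power_mult_distrib using s by simp
  have BE: "eig m powr \<zeta> * (\<beta> + \<rho>)\<^sup>2 = (B + E)\<^sup>2"
  proof -
    have "eig m powr (\<zeta> / 2) * eig m powr (- \<zeta> / 2) = 1"
      using eig_ge_1[of m] by (simp add: powr_add[symmetric])
    moreover have "\<rho> = E * eig m powr (- \<zeta> / 2)" by (simp add: \<rho>_def E_def)
    ultimately have "eig m powr (\<zeta> / 2) * \<rho> = E"
      by (metis mult.left_commute mult.right_neutral)
    then have "B + E = eig m powr (\<zeta> / 2) * (\<beta> + \<rho>)" by (simp add: B_def distrib_left)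
    moreover have "(eig m powr (\<zeta> / 2))\<^sup>2 = eig m powr \<zeta>"
      unfolding power2_eq_square powr_add[symmetric] by simp
    ultimately show ?thesis by (simp add: power_mult_distrib)
  qed
  have "suminf t = (\<Sum>k. t (k + Suc m)) + sum t {..m}"
    using suminf_split_initial_segment[OF st, of "Suc m"] by (simp only: lessThan_Suc_atMost)
  also have "\<dots> \<le> E\<^sup>2 + eig m powr \<zeta> * (\<kappa> * (\<beta> + \<rho>)\<^sup>2)"
    unfolding E2 by (intro add_mono highsum lowsum)
  also have "\<dots> = \<kappa> * (B + E)\<^sup>2 + E\<^sup>2"
    unfolding BE[symmetric] by (simp add: mult_ac)
  finally have "suminf t \<le> \<kappa> * (B + E)\<^sup>2 + E\<^sup>2" .
  then have "sqrt (suminf t) \<le> sqrt (1 + \<kappa>) * E + sqrt \<kappa> * B"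
    using \<kappa>0 \<beta> S0 s by (intro sqrt_le_weighted_sum) (auto simp: B_def E_def)
  then show "sobolev_norm \<zeta> ?D \<le> sqrt (1 + \<kappa>) * (sqrt (eig m powr (- s) / s) * ?S) + sqrt \<kappa> * (eig m powr (\<zeta> / 2) * \<beta>)"
    by (simp add: sobolev_norm_def t_def[abs_def] eig B_def E_def)
qed

text \<open>Parseval reduces the claim to single degrees, where the \<zeta>-weight compensates the
  smallness of the multiplier: c squared is at most the weight times the squared modulus of
  b_k.\<close>

lemma L2_norm_le_sobolev_norm_conv:
  assumes f: "f \<in> sphere_L2" and p: "p \<in> sphere_L2"
    and S: "(\<lambda>z. sphere_conv G h f z - sphere_conv G h p z) \<in> sobolev \<zeta>"
    and c: "0 < c" "\<And>k. c * eig k powr (- \<zeta> / 2) \<le> cmod (conv_coeff h k)"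
  shows "L2_norm (\<lambda>z. f z - p z) \<le> inverse c * sobolev_norm \<zeta> (\<lambda>z. sphere_conv G h f z - sphere_conv G h p z)"
proof -
  let ?b = "conv_coeff h" and ?D = "\<lambda>z. sphere_conv G h f z - sphere_conv G h p z"
  let ?e = "\<lambda>z. f z - p z"
  have e: "?e \<in> sphere_L2" by (rule sphere_L2_diff[OF f p])
  note g2 = conv_L2[OF haar D h f] and gp2 = conv_L2[OF haar D h p]
  have PD: "harmonic_proj k ?D = (\<lambda>z. ?b k * harmonic_proj k ?e z)" for k
    unfolding harmonic_proj_diff[OF g2 gp2] harmonic_proj_conv[OF haar D h f] harmonic_proj_conv[OF haar D h p]
      harmonic_proj_diff[OF f p] right_diff_distrib ..
  have "c\<^sup>2 * (L2_norm ?e)\<^sup>2 \<le> (\<Sum>k. eig k powr \<zeta> * (L2_norm (harmonic_proj k ?D))\<^sup>2)"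
  proof (rule sums_le)
    show "(\<lambda>k. c\<^sup>2 * (L2_norm (harmonic_proj k ?e))\<^sup>2) sums (c\<^sup>2 * (L2_norm ?e)\<^sup>2)"
      by (rule sums_mult[OF parseval[OF e]])
    show "(\<lambda>k. eig k powr \<zeta> * (L2_norm (harmonic_proj k ?D))\<^sup>2) sums (\<Sum>k. eig k powr \<zeta> * (L2_norm (harmonic_proj k ?D))\<^sup>2)"
      using S by (intro summable_sums) (simp add: sobolev_def eig)
    show "c\<^sup>2 * (L2_norm (harmonic_proj k ?e))\<^sup>2 \<le> eig k powr \<zeta> * (L2_norm (harmonic_proj k ?D))\<^sup>2" for k
    proof -
      have 1: "eig k powr \<zeta> * eig k powr (- \<zeta>) = 1"
        using eig_ge_1[of k] by (simp add: powr_add[symmetric])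
      have "(c * eig k powr (- \<zeta> / 2))\<^sup>2 \<le> (cmod (?b k))\<^sup>2"
        using c by (intro power_mono) auto
      moreover have "(c * eig k powr (- \<zeta> / 2))\<^sup>2 = c\<^sup>2 * eig k powr (- \<zeta>)"
        unfolding power_mult_distrib power2_eq_square[of "eig k powr _"] powr_add[symmetric] by simp
      ultimately have "eig k powr \<zeta> * (c\<^sup>2 * eig k powr (- \<zeta>)) \<le> eig k powr \<zeta> * (cmod (?b k))\<^sup>2"
        by (intro mult_left_mono) auto
      moreover have "eig k powr \<zeta> * (c\<^sup>2 * eig k powr (- \<zeta>)) = c\<^sup>2 * (eig k powr \<zeta> * eig k powr (- \<zeta>))"
        by (simp add: mult_ac)
      ultimately have "c\<^sup>2 \<le> eig k powr \<zeta> * (cmod (?b k))\<^sup>2" unfolding 1 by simp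
      then have "c\<^sup>2 * (L2_norm (harmonic_proj k ?e))\<^sup>2 \<le> eig k powr \<zeta> * (cmod (?b k))\<^sup>2 * (L2_norm (harmonic_proj k ?e))\<^sup>2"
        by (intro mult_right_mono) auto
      then show ?thesis unfolding PD L2_norm_sq_cmult by (simp add: mult.assoc)
    qed
  qed
  then have "(c * L2_norm ?e)\<^sup>2 \<le> (sobolev_norm \<zeta> ?D)\<^sup>2"
    unfolding sobolev_norm_sq[OF S] by (simp add: power_mult_distrib)
  moreover have "0 \<le> sobolev_norm \<zeta> ?D" by (rule sobolev_norm_nonneg[OF S])
  ultimately have "c * L2_norm ?e \<le> sobolev_norm \<zeta> ?D" by (rule power2_le_imp_le)
  then show ?thesis using c(1) by (simp add: field_simps)
qed

end

theorem theorem3: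
  fixes d m L :: nat
    and G :: "(real ^ ('d::finite option) ^ ('d option)) measure"
    and h f p :: "real ^ ('d option) \<Rightarrow> complex"
    and F :: "(real ^ ('d option) \<Rightarrow> complex) \<Rightarrow> (real ^ ('d option) \<Rightarrow> complex)"
    and b :: "nat \<Rightarrow> complex"
    and x :: "nat \<Rightarrow> real ^ ('d option)"
    and y :: "nat \<Rightarrow> complex"
    and c C\<^sub>1 \<gamma> \<omega> \<zeta> \<sigma> \<epsilon> \<beta> \<kappa> :: real
  assumes d: "d = CARD('d)" "d \<ge> 2"
    and haar: "haar_prob_SO G"
    and h: "h \<in> sphere_L2"
    and b: "\<And>k. b k = conv_coeff h k"
    and b0: "b 0 \<noteq> 0"
    and c: "c \<ge> 0"
    and \<gamma>: "\<gamma> \<ge> 0"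
    and b_bound: "\<And>k. cmod (b k) \<le> c * (1 + lb_eigenvalue d k) powr (- \<gamma> / 2)"
    and F: "\<And>u. F u = sphere_conv G h u"
    and \<omega>: "\<omega> \<ge> 0"
    and f: "f \<in> sobolev \<omega>"
    and \<zeta>: "\<zeta> \<ge> 0"
    and \<sigma>: "\<sigma> = \<omega> + \<gamma>" "\<sigma> > real d / 2 + \<zeta>"
    and \<epsilon>: "0 < \<epsilon>" "\<epsilon> < 1"
    and C\<^sub>1: "C\<^sub>1 > 0"
    and L: "L = nat \<lceil>C\<^sub>1 * lb_eigenvalue d m powr (real d / 2)\<rceil>"
    and x: "x ` {1..L} \<subseteq> sphere 0 1" "inj_on x {1..L}"
    and MZ: "\<And>q. q \<in> harmonics_upto m \<Longrightarrow>
        (1 - \<epsilon>) * (L2_norm q)\<^sup>2 \<le> 1 / real L * (\<Sum>j=1..L. (cmod (q (x j)))\<^sup>2) \<and>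
        1 / real L * (\<Sum>j=1..L. (cmod (q (x j)))\<^sup>2) \<le> (1 + \<epsilon>) * (L2_norm q)\<^sup>2"
    and \<beta>: "\<beta> \<ge> 0"
    and y: "\<And>j. j \<in> {1..L} \<Longrightarrow> cmod (y j - F f (x j)) \<le> \<beta>"
    and p: "is_arg_min (\<lambda>q. 1 / real L * (\<Sum>j=1..L. (cmod (y j - F q (x j)))\<^sup>2))
        (\<lambda>q. q \<in> harmonics_upto m) p"
    and \<kappa>: "\<kappa> = (1 + \<epsilon>) / (1 - \<epsilon>)"
  shows "F f \<in> sobolev \<sigma> \<and>
    (\<lambda>z. F f z - F p z) \<in> sobolev \<zeta> \<and>
    sobolev_norm \<zeta> (\<lambda>z. F f z - F p z) \<le>
      sqrt ((1 + \<kappa>) / (\<sigma> - \<zeta> - real d / 2)) * sobolev_norm \<sigma> (F f)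
        * (1 + lb_eigenvalue d m) powr (- (\<sigma> - \<zeta>) / 2 + real d / 4)
      + sqrt \<kappa> * \<beta> * (1 + lb_eigenvalue d m) powr (\<zeta> / 2) \<and>
    (\<forall>c\<^sub>0>0. \<zeta> \<ge> \<gamma> \<longrightarrow>
      (\<forall>k. cmod (b k) \<ge> c\<^sub>0 * (1 + lb_eigenvalue d k) powr (- \<zeta> / 2)) \<longrightarrow>
      L2_norm (\<lambda>z. f z - p z) \<le> inverse c\<^sub>0 * sobolev_norm \<zeta> (\<lambda>z. F f z - F p z))"
proof -
  let ?eig = "\<lambda>k. 1 + lb_eigenvalue CARD('d) k"
  have D: "2 \<le> CARD('d)" using d by simp
  have F': "F = sphere_conv G h" by (rule ext) (rule F)
  have f2: "f \<in> sphere_L2" using f by (simp add: sobolev_def)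
  have pm: "p \<in> harmonics_upto m" using p by (simp add: is_arg_min_def)
  define s where "s = \<sigma> - \<zeta> - real d / 2"
  have s: "0 < s" "s + real CARD('d) / 2 + \<zeta> = \<sigma>" using \<sigma> d by (simp_all add: s_def)
  have FS: "sphere_conv G h f \<in> sobolev \<sigma>"
    unfolding \<sigma>(1) using b_bound unfolding b d(1) by (intro conv_sobolev[OF haar D h refl f c])
  \<comment> \<open>At m = 0 the eigenvalue is 0, and \<open>0 powr (d / 2) = 0\<close> makes L
    zero. The empty average is then 0, against the sampling inequality for the constant 1.\<close>
  have m: "1 \<le> m"
  proof (rule ccontr)
    assume "\<not> 1 \<le> m"
    then have m0: "m = 0" by simp
    then have L0: "L = 0" using d by (simp add: L lb_eigenvalue_def)
    let ?q = "sphere_restrict (\<lambda>x. 1) :: real ^ ('d option) \<Rightarrow> complex"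
    have "?q \<in> harmonics_upto m"
      unfolding harmonics_upto_def m0 by (intro CollectI exI[of _ "\<lambda>l. ?q"]) (simp add: const_in_harmonics)
    from MZ[OF this] show False using \<epsilon> by (simp add: L0 L2_norm_const)
  qed
  have "0 < lb_eigenvalue d m" using m d by (simp add: lb_eigenvalue_def)
  then have L_pos: "0 < L" using C\<^sub>1 by (simp add: L)
  \<comment> \<open>In \<open>is_arg_min\<close> no competitor is strictly smaller; the positive
    factor 1 / L cancels from the comparison.\<close>
  have min: "(\<Sum>j=1..L. (cmod (y j - sphere_conv G h p (x j)))\<^sup>2) \<le> (\<Sum>j=1..L. (cmod (y j - sphere_conv G h q (x j)))\<^sup>2)"
    if "q \<in> harmonics_upto m" for q
    using p that L_pos unfolding is_arg_min_def F' by (auto simp: not_less divide_le_cancel dest!: spec[of _ q])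
  have xs: "x j \<in> sphere 0 1" if "j \<in> {1..L}" for j using x that by blast
  note est = least_squares_sobolev_estimate[OF haar D h refl f2 FS s \<zeta> m L_pos xs \<epsilon> conjunct1[OF MZ] \<beta> y[unfolded F'] pm min \<kappa>]
  \<comment> \<open>Half of - s, with s = \<sigma> - \<zeta> - d / 2, is the exponent in the claim;
    the remaining 1 / s joins 1 + \<kappa> under the root.\<close>
  have "sqrt ((1 + lb_eigenvalue d m) powr (- s)) = (1 + lb_eigenvalue d m) powr (- s / 2)"
    by (rule real_sqrt_unique) (simp_all add: power2_eq_square powr_add[symmetric])
  moreover have "- s / 2 = - (\<sigma> - \<zeta>) / 2 + real d / 4" by (simp add: s_def field_simps)
  ultimately have "sqrt ((1 + lb_eigenvalue d m) powr (- s)) = (1 + lb_eigenvalue d m) powr (- (\<sigma> - \<zeta>) / 2 + real d / 4)"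
    by (simp only:)
  then have rate: "sqrt (1 + \<kappa>) * (sqrt (?eig m powr (- s) / s) * sobolev_norm \<sigma> (sphere_conv G h f)) =
      sqrt ((1 + \<kappa>) / (\<sigma> - \<zeta> - real d / 2)) * sobolev_norm \<sigma> (sphere_conv G h f)
        * (1 + lb_eigenvalue d m) powr (- (\<sigma> - \<zeta>) / 2 + real d / 4)"
    by (simp add: d(1)[symmetric] real_sqrt_divide s_def[symmetric] mult_ac)
  show ?thesis
    unfolding F'
  proof (intro conjI allI impI)
    \<comment> \<open>The two memberships give the norms their meaning: without summability
      \<open>suminf\<close> has no relation to the partial sums.\<close>
    show "sphere_conv G h f \<in> sobolev \<sigma>" by (rule FS)
    show DS: "(\<lambda>z. sphere_conv G h f z - sphere_conv G h p z) \<in> sobolev \<zeta>" by (rule est(1))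
    show "sobolev_norm \<zeta> (\<lambda>z. sphere_conv G h f z - sphere_conv G h p z) \<le>
      sqrt ((1 + \<kappa>) / (\<sigma> - \<zeta> - real d / 2)) * sobolev_norm \<sigma> (sphere_conv G h f)
        * (1 + lb_eigenvalue d m) powr (- (\<sigma> - \<zeta>) / 2 + real d / 4)
      + sqrt \<kappa> * \<beta> * (1 + lb_eigenvalue d m) powr (\<zeta> / 2)"
      using est(2) unfolding rate by (simp add: d(1)[symmetric] mult_ac)
    fix c\<^sub>0 :: real
    assume c0: "0 < c\<^sub>0" "\<zeta> \<ge> \<gamma>" "\<forall>k. cmod (b k) \<ge> c\<^sub>0 * (1 + lb_eigenvalue d k) powr (- \<zeta> / 2)"
    have "c\<^sub>0 * ?eig k powr (- \<zeta> / 2) \<le> cmod (conv_coeff h k)" for k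
      using c0(3) by (simp add: b d(1))
    from L2_norm_le_sobolev_norm_conv[OF haar D h refl f2 harmonics_upto_L2[OF pm] DS c0(1) this]
    show "L2_norm (\<lambda>z. f z - p z) \<le> inverse c\<^sub>0 * sobolev_norm \<zeta> (\<lambda>z. sphere_conv G h f z - sphere_conv G h p z)" .
  qed
qed

end
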